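(* Fix a tuple $\mathbf t=(t_1,\dots,t_n)$ of nonnegative integers, not all zero, $n\ge1$. The polytope $$C'(\mathbf t)=\sum_TP(T)$$ (Minkowski sum), where $T$ ranges over all the concentrated rooted plane trees of depth $n$ and profile $\mathbf t$, is a constrainahedron of profile $\mathbf t$; that is, $C'(\mathbf t)$ and $C(\mathbf t)$ have the same normal fan.
   Context: **Trees.** A rooted plane tree $T$ is a finite rooted tree with a total order on the set $\mathrm{ch}(u)$ of children of every vertex $u$. $V^k(T)$ is the set of vertices at distance $k$ from the root; the depth of $T$ is the largest $k$ with $V^k(T)\ne\emptyset$. $V^k(T)$ is totally ordered lexicographically; $u^k_i$ is its $i$-th element. $T$ of depth $n$ is concentrated if for every $k<n$ exactly one vertex of depth $k$ has children. $T$ has profile $\mathbf t=(t_1,\dots,t_n)$ if $|V^k(T)|=t_k+1$ for $1\le k\le n$. $m=\sum_{k=1}^nt_k$; $\mathbb R^m$ has coordinates $x^k_i$, $1\le k\le n$, $1\le i\le t_k$. **Brackets.** For $0\le k\le n$ a $k$-bracket of $T$ is $A=(A^0,\dots,A^k)$ with $A^i\subseteq V^i(T)$, $A^k\neq\emptyset$, such that the parent of every $u\in A^i$ ($i\ge 1$) lies in $A^{i-1}$, and for every $u\in A^{i-1}$ the set $A^i\cap\mathrm{ch}(u)$ is a (possibly empty) set of consecutive elements of $\mathrm{ch}(u)$. For $k$-brackets, $A\subseteq A'$ means $A^i\subseteq A'^i$ for all $i$. For $k\ge1$, $\pi(A)=(A^0,\dots,A^{k-1})$. The singleton $k$-bracket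 $A(u)$ of $u\in V^k(T)$ has $A(u)^i=\{\text{the depth-}i\text{ vertex on the path from the root to }u\}$; the maximum $k$-bracket is $(V^0(T),\dots,V^k(T))$. A bracket is nontrivial if it is neither singleton nor maximum. **$n$-bracketings.** An $n$-bracketing $\mathcal B$ of $T$ consists of sets $\mathcal B^k$ of $k$-brackets ($0\le k\le n$) and a strict partial order $<_{\mathcal B}$ on $\bigsqcup_k\mathcal B^k$ such that, writing $\mathcal B_A=\{A'\in\mathcal B^{k}:\pi(A')=A\}$ for $A\in\mathcal B^{k-1}$: (1) $\mathcal B^k$ contains the maximum and all singleton $k$-brackets; (2) $A\in\mathcal B^k$, $k\ge1$, implies $\pi(A)\in\mathcal B^{k-1}$; (3) if $A_1,A_2\in\mathcal B^k$ and $A_1^k\cap A_2^k\ne\emptyset$ then $A_1\subseteq A_2$ or $A_2\subseteq A_1$; (4a) for $A\in\mathcal B^{k-1}$, $1\le k\le n$: $\bigcup_{A'\in\mathcal B_A}A'^k=\bigcup_{u\in A^{k-1}}\mathrm{ch}(u)$; (4b) if $A_1,A_2\in\mathcal B_A$, $A_2\subsetneq A_1$, then every $u'\in A_1^k$ lies in $A_3^k$ for some $A_3\in\mathcal B_A$ with $A_3\subsetneq A_1$; (5a) distinct elements $A_1,A_2\in\mathcal B^k$ are comparable under $<_{\mathcal B}$ iff $\pi(A_1)=\pi(A_2)$ and $A_1^k\cap A_2^k=\emptyset$ (elements of different levels are incomparable); (5b) if $u_1$ precedes $u_2$ in $\mathrm{ch}(u)$ then $A(u_1)<_{\mathcal B}A(u_2)$;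 (5c) if $A,\tilde A\in\mathcal B^{k-1}$, $\tilde A\subseteq A$, $A_1\ne A_2\in\mathcal B_A$ are comparable, $\tilde A_1\ne\tilde A_2\in\mathcal B_{\tilde A}$ are comparable, and $\tilde A_i\subseteq A_i$ for $i=1,2$, then $A_1<_{\mathcal B}A_2\iff\tilde A_1<_{\mathcal B}\tilde A_2$. $\mathcal K(T)$ is the set of $n$-bracketings of $T$ ordered by: $\mathcal B_1\le\mathcal B_2$ iff $\mathcal B_1^k\subseteq\mathcal B_2^k$ for all $k$ and $<_{\mathcal B_1}$ is the restriction of $<_{\mathcal B_2}$. Its minimum $\mathcal B_{\min}$ has only singleton and maximum brackets. **Collisions.** A collision is an atom of $\mathcal K(T)$. The fusion bracket of a collision $\mathcal C$ is the (unique) nonsingleton bracket $E_0$ of $\mathcal C$ such that $\pi(E_0)$ is singleton and $E_0=\pi^{l}(A')$ for some nontrivial $A'$ in $\mathcal C$, $l\ge0$. A bracket $E$ of $\mathcal C$ is essential if $E=\pi^l(A')$ for some nontrivial $A'$ in $\mathcal C$, $l\ge0$, and $\pi^j(E)=E_0$ for some $j\ge0$. For concentrated $T$ the velocity-fan ray generator of $\mathcal C$ is the $0$-$1$ vector $\rho(\mathcal C)\in\mathbb R^m$ with $\rho(\mathcal C)^k_i=1$ iff $u^k_i,u^k_{i+1}\in E^k$ for some essential $E\in\mathcal C^k$. **Collision units and $P(T)$.** A collision unit is $\mathbf c=(\mathbf c_1,\dots,\mathbf c_n)$ where each $\mathbf c_k$ is $\emptyset$ or a pair $\{u^k_i,u^k_j\}$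 of distinct depth-$k$ vertices, at least one $\mathbf c_k$ is nonempty, and if at least two are nonempty then each nonempty $\mathbf c_k$ is of the form $\{u^k_i,u^k_{i+1}\}$. $U(T)$ is the set of collision units. The level of $\mathbf c$ is the largest $k$ with $\mathbf c_k\ne\emptyset$. For a $k$-bracket $A$, $U(A)$ is the set of level-$k$ collision units with $\mathbf c_i\subseteq A^i$ for all $i\le k$. For concentrated $T$, $$P(T)=\Big\{x\in\mathbb R^m:\sum_{k,i}x^k_i=|U(T)|,\ \langle\rho(\mathcal C),x\rangle\ge\sum_{E\text{ essential in }\mathcal C}|U(E)|\text{ for every collision }\mathcal C\Big\}.$$ **Constrainahedra.** For $S$ a nonempty set of coordinate indices $(k,i)$, $\Delta(S)$ is the convex hull of the standard basis vectors indexed by $S$. $C(\mathbf t)\subset\mathbb R^m$ is the Minkowski sum of all $\Delta(\{(k,i),(k,i+1),\dots,(k,j)\})$ with $1\le k\le n$, $1\le i<j\le t_k$, and all $\Delta(\{(k,i),(k',j)\})$ with $k\ne k'$, $1\le i\le t_k$, $1\le j\le t_{k'}$ (each such set once). A constrainahedron of profile $\mathbf t$ is any polytope with the same normal fan as $C(\mathbf t)$. *)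

theory Defs
  imports "HOL-Analysis.Analysis" "HOL-Library.List_Lexorder"
begin

text \<open>
  A vertex of a rooted plane tree is its Ulam--Harris address, the list of child positions on the
  path from the root (so the root is \<open>[]\<close>, the parent of \<open>u\<close> is \<open>butlast u\<close>, and the depth is the
  length); a tree is the set of its vertices.  Each isomorphism class of rooted plane trees contains
  exactly one such set.  On a fixed level, the order on lists from \<open>List_Lexorder\<close> is the
  lexicographic order of the vertices; on the children of a vertex it is the order of siblings.
\<close>

type_synonym vertex = "nat list"
type_synonym tree = "vertex set"

definition plane_tree :: "tree \<Rightarrow> bool" where
  "plane_tree T \<longleftrightarrow> finite T \<and> [] \<in> T \<and>
     (\<forall>u i. u @ [i] \<in> T \<longrightarrow> u \<in> T \<and> (\<forall>j<i. u @ [j] \<in> T))"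

definition children :: "tree \<Rightarrow> vertex \<Rightarrow> vertex set" where
  "children T u = {v \<in> T. \<exists>i. v = u @ [i]}"

definition level :: "tree \<Rightarrow> nat \<Rightarrow> vertex set" where
  "level T k = {u \<in> T. length u = k}"

definition depth :: "tree \<Rightarrow> nat" where
  "depth T = Max {k. level T k \<noteq> {}}"

definition concentrated :: "tree \<Rightarrow> bool" where
  "concentrated T \<longleftrightarrow> (\<forall>k<depth T. \<exists>!u. u \<in> level T k \<and> children T u \<noteq> {})"

text \<open>A tuple \<open>(t\<^sub>1, \<dots>, t\<^sub>n)\<close> is a list, so \<open>t\<^sub>k\<close> is \<open>t ! (k - 1)\<close>.\<close>

definition has_profile :: "tree \<Rightarrow> nat list \<Rightarrow> bool" where
  "has_profile T t \<longleftrightarrow>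
     length t = depth T \<and> (\<forall>k\<in>{1..length t}. card (level T k) = t ! (k - 1) + 1)"

definition concentrated_trees :: "nat list \<Rightarrow> tree set" where
  "concentrated_trees t = {T. plane_tree T \<and> concentrated T \<and> has_profile T t}"

text \<open>The vertex \<open>u\<^sup>k\<^sub>i\<close>, for \<open>1 \<le> i \<le> card (level T k)\<close>.\<close>

definition vtx :: "tree \<Rightarrow> nat \<Rightarrow> nat \<Rightarrow> vertex" where
  "vtx T k i = sorted_list_of_set (level T k) ! (i - 1)"


text \<open>
  A \<open>k\<close>-bracket \<open>(A\<^sup>0, \<dots>, A\<^sup>k)\<close> is a list of length \<open>k + 1\<close>; its projection \<open>\<pi>\<close> is \<open>butlast\<close>
  and \<open>A\<^sup>k\<close> is \<open>last A\<close>.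
\<close>

type_synonym bracket = "vertex set list"

definition consecutive_in :: "vertex set \<Rightarrow> vertex set \<Rightarrow> bool" where
  "consecutive_in S X \<longleftrightarrow>
     S \<subseteq> X \<and> (\<forall>u\<in>S. \<forall>w\<in>S. \<forall>v\<in>X. u < v \<and> v < w \<longrightarrow> v \<in> S)"

definition is_bracket :: "tree \<Rightarrow> nat \<Rightarrow> bracket \<Rightarrow> bool" where
  "is_bracket T k A \<longleftrightarrow> length A = Suc k \<and> (\<forall>i\<le>k. A ! i \<subseteq> level T i) \<and> A ! k \<noteq> {} \<and>
     (\<forall>i\<in>{1..k}. \<forall>u\<in>A ! i. butlast u \<in> A ! (i - 1)) \<and>
     (\<forall>i\<in>{1..k}. \<forall>u\<in>A ! (i - 1). consecutive_in (A ! i \<inter> children T u) (children T u))"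

definition bracket_le :: "bracket \<Rightarrow> bracket \<Rightarrow> bool" where
  "bracket_le A A' \<longleftrightarrow> length A = length A' \<and> (\<forall>i<length A. A ! i \<subseteq> A' ! i)"

definition bracket_less :: "bracket \<Rightarrow> bracket \<Rightarrow> bool" where
  "bracket_less A A' \<longleftrightarrow> bracket_le A A' \<and> A \<noteq> A'"

definition singleton_bracket :: "vertex \<Rightarrow> bracket" where
  "singleton_bracket u = map (\<lambda>i. {take i u}) [0..<Suc (length u)]"

definition max_bracket :: "tree \<Rightarrow> nat \<Rightarrow> bracket" where
  "max_bracket T k = map (level T) [0..<Suc k]"

definition is_singleton_bracket :: "tree \<Rightarrow> bracket \<Rightarrow> bool" where
  "is_singleton_bracket T A \<longleftrightarrow> (\<exists>u\<in>T. A = singleton_bracket u)"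

definition nontrivial :: "tree \<Rightarrow> bracket \<Rightarrow> bool" where
  "nontrivial T A \<longleftrightarrow>
     \<not> is_singleton_bracket T A \<and> \<not> (\<exists>k\<le>depth T. A = max_bracket T k)"


text \<open>
  A bracketing is a pair \<open>(B, r)\<close> of the set \<open>B\<close> of all its brackets and its strict order \<open>r\<close>.
  Brackets of different levels are lists of different lengths, so \<open>B\<close> is the disjoint union of
  its levels \<open>B\<^sup>k\<close>.
\<close>

type_synonym bracketing = "bracket set \<times> (bracket \<times> bracket) set"

definition bracket_level :: "bracket set \<Rightarrow> nat \<Rightarrow> bracket set" where
  "bracket_level B k = {A \<in> B. length A = Suc k}"

text \<open>The set \<open>\<B>\<^sub>A\<close> of brackets of \<open>B\<close> lying directly over \<open>A\<close>.\<close>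

definition brackets_over :: "bracket set \<Rightarrow> bracket \<Rightarrow> bracket set" where
  "brackets_over B A = {A' \<in> B. length A' = Suc (length A) \<and> butlast A' = A}"

definition comparable :: "(bracket \<times> bracket) set \<Rightarrow> bracket \<Rightarrow> bracket \<Rightarrow> bool" where
  "comparable r A A' \<longleftrightarrow> (A, A') \<in> r \<or> (A', A) \<in> r"

definition is_bracketing :: "tree \<Rightarrow> bracket set \<Rightarrow> (bracket \<times> bracket) set \<Rightarrow> bool" where
  "is_bracketing T B r \<longleftrightarrow>
     (\<forall>A\<in>B. \<exists>k\<le>depth T. is_bracket T k A) \<and>
     r \<subseteq> B \<times> B \<and> irrefl r \<and> trans r \<and>
     \<comment> \<open>(1)\<close>
     (\<forall>k\<le>depth T. max_bracket T k \<in> B) \<and> (\<forall>u\<in>T. singleton_bracket u \<in> B) \<and>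
     \<comment> \<open>(2)\<close>
     (\<forall>k\<in>{1..depth T}. \<forall>A\<in>bracket_level B k. butlast A \<in> bracket_level B (k - 1)) \<and>
     \<comment> \<open>(3)\<close>
     (\<forall>k\<le>depth T. \<forall>A\<^sub>1\<in>bracket_level B k. \<forall>A\<^sub>2\<in>bracket_level B k.
        last A\<^sub>1 \<inter> last A\<^sub>2 \<noteq> {} \<longrightarrow> bracket_le A\<^sub>1 A\<^sub>2 \<or> bracket_le A\<^sub>2 A\<^sub>1) \<and>
     \<comment> \<open>(4a)\<close>
     (\<forall>k\<in>{1..depth T}. \<forall>A\<in>bracket_level B (k - 1).
        (\<Union>A'\<in>brackets_over B A. last A') = (\<Union>u\<in>last A. children T u)) \<and>
     \<comment> \<open>(4b)\<close>
     (\<forall>k\<in>{1..depth T}. \<forall>A\<in>bracket_level B (k - 1).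
        \<forall>A\<^sub>1\<in>brackets_over B A. \<forall>A\<^sub>2\<in>brackets_over B A. bracket_less A\<^sub>2 A\<^sub>1 \<longrightarrow>
          (\<forall>u\<in>last A\<^sub>1. \<exists>A\<^sub>3\<in>brackets_over B A. bracket_less A\<^sub>3 A\<^sub>1 \<and> u \<in> last A\<^sub>3)) \<and>
     \<comment> \<open>(5a)\<close>
     (\<forall>A\<^sub>1\<in>B. \<forall>A\<^sub>2\<in>B. A\<^sub>1 \<noteq> A\<^sub>2 \<longrightarrow>
        (comparable r A\<^sub>1 A\<^sub>2 \<longleftrightarrow>
          length A\<^sub>1 = length A\<^sub>2 \<and> butlast A\<^sub>1 = butlast A\<^sub>2 \<and> last A\<^sub>1 \<inter> last A\<^sub>2 = {})) \<and>
     \<comment> \<open>(5b)\<close>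
     (\<forall>u\<in>T. \<forall>u\<^sub>1\<in>children T u. \<forall>u\<^sub>2\<in>children T u.
        u\<^sub>1 < u\<^sub>2 \<longrightarrow> (singleton_bracket u\<^sub>1, singleton_bracket u\<^sub>2) \<in> r) \<and>
     \<comment> \<open>(5c); the primed brackets are those written with a tilde in the mathematics\<close>
     (\<forall>k\<in>{1..depth T}. \<forall>A\<in>bracket_level B (k - 1). \<forall>A'\<in>bracket_level B (k - 1).
        bracket_le A' A \<longrightarrow>
        (\<forall>A\<^sub>1\<in>brackets_over B A. \<forall>A\<^sub>2\<in>brackets_over B A.
         \<forall>A\<^sub>1'\<in>brackets_over B A'. \<forall>A\<^sub>2'\<in>brackets_over B A'.
           A\<^sub>1 \<noteq> A\<^sub>2 \<and> comparable r A\<^sub>1 A\<^sub>2 \<and> A\<^sub>1' \<noteq> A\<^sub>2' \<and> comparable r A\<^sub>1' A\<^sub>2' \<and>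
           bracket_le A\<^sub>1' A\<^sub>1 \<and> bracket_le A\<^sub>2' A\<^sub>2 \<longrightarrow>
           ((A\<^sub>1, A\<^sub>2) \<in> r \<longleftrightarrow> (A\<^sub>1', A\<^sub>2') \<in> r)))"

definition bracketings :: "tree \<Rightarrow> bracketing set" where
  "bracketings T = {(B, r). is_bracketing T B r}"

definition bracketing_le :: "bracketing \<Rightarrow> bracketing \<Rightarrow> bool" where
  "bracketing_le X Y \<longleftrightarrow> fst X \<subseteq> fst Y \<and> snd X = Restr (snd Y) (fst X)"

definition is_min_bracketing :: "tree \<Rightarrow> bracketing \<Rightarrow> bool" where
  "is_min_bracketing T X \<longleftrightarrow> X \<in> bracketings T \<and> (\<forall>Y\<in>bracketings T. bracketing_le X Y)"

definition collisions :: "tree \<Rightarrow> bracketing set" where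
  "collisions T = {C \<in> bracketings T. \<not> is_min_bracketing T C \<and>
     (\<forall>X\<in>bracketings T. bracketing_le X C \<longrightarrow> X = C \<or> is_min_bracketing T X)}"

text \<open>
  \<open>(butlast ^^ l) A\<close> is \<open>\<pi>\<^sup>l(A)\<close>.  For \<open>l \<ge> length A\<close> it is the empty list, which is not a bracket;
  below this is excluded by \<open>E \<in> fst C\<close>, and by \<open>butlast E\<close> being a singleton bracket.
\<close>

definition is_projection_of_nontrivial :: "tree \<Rightarrow> bracketing \<Rightarrow> bracket \<Rightarrow> bool" where
  "is_projection_of_nontrivial T C E \<longleftrightarrow>
     (\<exists>A'\<in>fst C. \<exists>l. nontrivial T A' \<and> E = (butlast ^^ l) A')"

definition fusion_bracket :: "tree \<Rightarrow> bracketing \<Rightarrow> bracket" where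
  "fusion_bracket T C = (THE E. E \<in> fst C \<and> \<not> is_singleton_bracket T E \<and>
     is_singleton_bracket T (butlast E) \<and> is_projection_of_nontrivial T C E)"

definition essential_brackets :: "tree \<Rightarrow> bracketing \<Rightarrow> bracket set" where
  "essential_brackets T C = {E \<in> fst C. is_projection_of_nontrivial T C E \<and>
     (\<exists>j. (butlast ^^ j) E = fusion_bracket T C)}"


text \<open>
  \<open>\<real>\<^sup>m\<close> is a Euclidean space \<open>'a\<close> whose standard basis is labelled by the coordinate indices
  \<open>(k, i)\<close>, i.e. \<open>bij_betw e (coords t) Basis\<close>.  The coordinate \<open>x\<^sup>k\<^sub>i\<close> of \<open>x\<close> is \<open>x \<bullet> e (k, i)\<close>.
\<close>

definition coords :: "nat list \<Rightarrow> (nat \<times> nat) set" where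
  "coords t = {(k, i). 1 \<le> k \<and> k \<le> length t \<and> 1 \<le> i \<and> i \<le> t ! (k - 1)}"

definition ray_generator ::
    "(nat \<times> nat \<Rightarrow> 'a::euclidean_space) \<Rightarrow> nat list \<Rightarrow> tree \<Rightarrow> bracketing \<Rightarrow> 'a" where
  "ray_generator e t T C = (\<Sum>(k, i)\<in>coords t.
     if \<exists>E\<in>essential_brackets T C. length E = Suc k \<and> {vtx T k i, vtx T k (Suc i)} \<subseteq> last E
     then e (k, i) else 0)"

text \<open>
  A collision unit is a function \<open>c\<close> with \<open>c k\<close> the component \<open>\<c>\<^sub>k\<close> for \<open>1 \<le> k \<le> n\<close> and
  \<open>c k = {}\<close> for all other \<open>k\<close>.
\<close>

definition collision_units :: "tree \<Rightarrow> (nat \<Rightarrow> vertex set) set" where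
  "collision_units T = {c.
     (\<forall>k. k \<notin> {1..depth T} \<longrightarrow> c k = {}) \<and>
     (\<forall>k\<in>{1..depth T}. c k = {} \<or>
        (\<exists>i j. 1 \<le> i \<and> i < j \<and> j \<le> card (level T k) \<and> c k = {vtx T k i, vtx T k j})) \<and>
     (\<exists>k. c k \<noteq> {}) \<and>
     (card {k. c k \<noteq> {}} \<ge> 2 \<longrightarrow>
        (\<forall>k. c k \<noteq> {} \<longrightarrow>
           (\<exists>i. 1 \<le> i \<and> Suc i \<le> card (level T k) \<and> c k = {vtx T k i, vtx T k (Suc i)})))}"

definition unit_level :: "(nat \<Rightarrow> vertex set) \<Rightarrow> nat" where
  "unit_level c = Max {k. c k \<noteq> {}}"

definition units_in :: "tree \<Rightarrow> bracket \<Rightarrow> (nat \<Rightarrow> vertex set) set" where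
  "units_in T A = {c \<in> collision_units T. Suc (unit_level c) = length A \<and>
     (\<forall>i\<in>{1..unit_level c}. c i \<subseteq> A ! i)}"

definition tree_polytope ::
    "(nat \<times> nat \<Rightarrow> 'a::euclidean_space) \<Rightarrow> nat list \<Rightarrow> tree \<Rightarrow> 'a set" where
  "tree_polytope e t T = {x.
     (\<Sum>p\<in>coords t. x \<bullet> e p) = real (card (collision_units T)) \<and>
     (\<forall>C\<in>collisions T. ray_generator e t T C \<bullet> x \<ge>
        (\<Sum>E\<in>essential_brackets T C. real (card (units_in T E))))}"

text \<open>Sums of sets are Minkowski sums (\<open>HOL-Library.Set_Algebras\<close>).\<close>

definition concentrated_sum ::
    "(nat \<times> nat \<Rightarrow> 'a::euclidean_space) \<Rightarrow> nat list \<Rightarrow> 'a set" where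
  "concentrated_sum e t = (\<Sum>T\<in>concentrated_trees t. tree_polytope e t T)"

definition constrainahedron_summands :: "nat list \<Rightarrow> (nat \<times> nat) set set" where
  "constrainahedron_summands t =
     {{(k, l) |l. i \<le> l \<and> l \<le> j} |k i j.
        1 \<le> k \<and> k \<le> length t \<and> 1 \<le> i \<and> i < j \<and> j \<le> t ! (k - 1)} \<union>
     {{(k, i), (k', j)} |k k' i j. k \<noteq> k' \<and> (k, i) \<in> coords t \<and> (k', j) \<in> coords t}"

definition standard_constrainahedron ::
    "(nat \<times> nat \<Rightarrow> 'a::euclidean_space) \<Rightarrow> nat list \<Rightarrow> 'a set" where
  "standard_constrainahedron e t = (\<Sum>S\<in>constrainahedron_summands t. convex hull (e ` S))"

definition normal_cone :: "'a::euclidean_space set \<Rightarrow> 'a set \<Rightarrow> 'a set" where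
  "normal_cone P F = {y. \<forall>x\<in>F. \<forall>z\<in>P. y \<bullet> z \<le> y \<bullet> x}"

definition normal_fan :: "'a::euclidean_space set \<Rightarrow> 'a set set" where
  "normal_fan P = {normal_cone P F |F. F face_of P \<and> F \<noteq> {}}"

definition constrainahedron ::
    "(nat \<times> nat \<Rightarrow> 'a::euclidean_space) \<Rightarrow> nat list \<Rightarrow> 'a set \<Rightarrow> bool" where
  "constrainahedron e t Q \<longleftrightarrow>
     polytope Q \<and> normal_fan Q = normal_fan (standard_constrainahedron e t)"


text \<open>
  The index sets of the sums and the sets whose cardinality is taken are finite, so the
  conventions for infinite sets never apply.
\<close>

lemma finite_coords: "finite (coords t)"
proof (rule finite_subset)
  show "coords t \<subseteq> (SIGMA k:{..length t}. {..t ! (k - 1)})"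
    by (auto simp: coords_def)
qed auto

lemma finite_constrainahedron_summands: "finite (constrainahedron_summands t)"
proof (rule finite_subset)
  show "constrainahedron_summands t \<subseteq> Pow (coords t)"
    by (auto simp: constrainahedron_summands_def coords_def)
qed (simp add: finite_coords)

lemma finite_concentrated_trees: "finite (concentrated_trees t)"
proof (rule finite_subset)
  let ?m = "Max (insert 0 (set t)) + 1"
  let ?L = "{u. set u \<subseteq> {..?m} \<and> length u \<le> length t}"
  show "concentrated_trees t \<subseteq> Pow ?L"
  proof clarify
    fix T u assume T: "T \<in> concentrated_trees t" and u: "u \<in> T"
    have pl: "plane_tree T" and len: "length t = depth T"
      and card: "\<And>k. k \<in> {1..length t} \<Longrightarrow> card (level T k) = t ! (k - 1) + 1"
      using T by (auto simp: concentrated_trees_def has_profile_def)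
    have fin: "finite T" and sib: "\<And>v i j. v @ [i] \<in> T \<Longrightarrow> j < i \<Longrightarrow> v @ [j] \<in> T"
      and par: "\<And>v i. v @ [i] \<in> T \<Longrightarrow> v \<in> T"
      using pl by (auto simp: plane_tree_def)
    have "finite {k. level T k \<noteq> {}}"
      by (rule finite_subset[of _ "length ` T"]) (use fin in \<open>auto simp: level_def\<close>)
    then have le: "length v \<le> length t" if "v \<in> T" for v
      unfolding len depth_def using that by (intro Max_ge) (auto simp: level_def)
    have "set v \<subseteq> {..?m}" if "v \<in> T" for v
      using that
    proof (induction v rule: rev_induct)
      case (snoc i v)
      let ?k = "Suc (length v)"
      have k: "?k \<in> {1..length t}"
        using le[OF snoc.prems] by simp
      have "(\<lambda>j. v @ [j]) ` {..i} \<subseteq> level T ?k"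
        using sib[OF snoc.prems] snoc.prems by (auto simp: level_def le_less)
      moreover have "finite (level T ?k)"
        using fin by (simp add: level_def)
      ultimately have "card ((\<lambda>j. v @ [j]) ` {..i}) \<le> card (level T ?k)"
        by (rule card_mono[rotated])
      moreover have "card ((\<lambda>j. v @ [j]) ` {..i}) = Suc i"
        by (subst card_image) (auto simp: inj_on_def)
      ultimately have "i \<le> t ! (?k - 1)"
        using card[OF k] by simp
      also have "\<dots> \<le> Max (insert 0 (set t))"
        using k by (intro Max_ge) auto
      finally show ?case
        using snoc.IH[OF par[OF snoc.prems]] by auto
    qed simp
    then show "set u \<subseteq> {..?m} \<and> length u \<le> length t"
      using u le by blast
  qed
  show "finite (Pow ?L)"
    by (simp add: finite_lists_length_le)
qed

lemma finite_collision_units: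
  assumes "finite T"
  shows "finite (collision_units T)"
proof (rule finite_subset)
  show "collision_units T \<subseteq>
      {c. \<forall>k. (k \<in> {1..depth T} \<longrightarrow> c k \<in> Pow T) \<and> (k \<notin> {1..depth T} \<longrightarrow> c k = {})}"
  proof
    fix c assume c: "c \<in> collision_units T"
    have fin: "finite (level T k)" for k
      using assms by (simp add: level_def)
    have v: "vtx T k i \<in> T" if "1 \<le> i" "i \<le> card (level T k)" for k i
    proof -
      have "vtx T k i \<in> set (sorted_list_of_set (level T k))"
        unfolding vtx_def using that by (intro nth_mem) auto
      then show ?thesis
        using fin by (simp add: level_def)
    qed
    have "c k \<subseteq> T" if k: "k \<in> {1..depth T}" for k
    proof (cases "c k = {}")
      case False
      then obtain i j where "1 \<le> i" "i < j" "j \<le> card (level T k)" "c k = {vtx T k i, vtx T k j}"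
        using c k unfolding collision_units_def by blast
      then show ?thesis
        using v[of i k] v[of j k] by simp
    qed simp
    moreover have "c k = {}" if "k \<notin> {1..depth T}" for k
      using c that unfolding collision_units_def by blast
    ultimately show "c \<in> {c. \<forall>k. (k \<in> {1..depth T} \<longrightarrow> c k \<in> Pow T) \<and>
        (k \<notin> {1..depth T} \<longrightarrow> c k = {})}"
      by blast
  qed
  show "finite {c. \<forall>k. (k \<in> {1..depth T} \<longrightarrow> c k \<in> Pow T) \<and> (k \<notin> {1..depth T} \<longrightarrow> c k = {})}"
    using assms by (intro finite_set_of_finite_funs) auto
qed

lemma finite_essential_brackets:
  assumes "finite T" and "C \<in> bracketings T"
  shows "finite (essential_brackets T C)"
proof (rule finite_subset)
  show "essential_brackets T C \<subseteq> {A. set A \<subseteq> Pow T \<and> length A \<le> Suc (depth T)}"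
  proof
    fix A assume "A \<in> essential_brackets T C"
    then have "A \<in> fst C"
      by (simp add: essential_brackets_def)
    moreover have "is_bracketing T (fst C) (snd C)"
      using assms(2) by (simp add: bracketings_def case_prod_beta)
    then have "\<forall>A\<in>fst C. \<exists>k\<le>depth T. is_bracket T k A"
      unfolding is_bracketing_def by (rule conjunct1)
    ultimately obtain k where k: "k \<le> depth T" "is_bracket T k A"
      by blast
    then have "length A = Suc k" "\<And>i. i \<le> k \<Longrightarrow> A ! i \<subseteq> level T i"
      by (auto simp: is_bracket_def)
    then show "A \<in> {A. set A \<subseteq> Pow T \<and> length A \<le> Suc (depth T)}"
      using k(1) by (fastforce simp: in_set_conv_nth level_def less_Suc_eq_le)
  qed
  show "finite {A. set A \<subseteq> Pow T \<and> length A \<le> Suc (depth T)}"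
    using assms(1) by (intro finite_lists_length_le) simp
qed

end

theory Submission
  imports Defs
begin

text \<open>
  Every polytope involved is a Minkowski sum of faces of the standard simplex, and the normal fan of
  such a sum only depends on which maximizers over the summands are preserved when one linear
  functional is replaced by another.

  Identify the coordinate \<open>(k, p)\<close> with the gap between the \<open>p\<close>-th and the next vertex of level \<open>k\<close>.
  In a concentrated tree only one vertex per level branches, so a set \<open>S\<close> of gaps cuts each level into
  blocks of vertices, and the blocks give brackets.  The collisions turn out to be the bracketings
  built in this way from the sets \<open>S\<close> that are connected: a single interval in the lowest level,
  with anything above it if the interval meets the branching vertex.  The inequalities of \<open>P(T)\<close> then
  say that the sum of the coordinates in \<open>S\<close> is at least the number of units whose gaps, each
  lower pair being joined to the branching vertex of its level, lie in \<open>S\<close>.  Every \<open>S\<close> splits into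
  connected pieces, so these are all the inequalities of the Minkowski sum of the simplices on
  the gap sets of the units.  Finally, the gap set of a unit meets every level in an interval, so
  its maximizers are controlled by the summands of \<open>C(t)\<close>, and each of these summands is the gap
  set of some unit for some choice of the branching vertices.
\<close>

section \<open>Normal fans and Minkowski sums of simplices\<close>

text \<open>Two features of concentrated trees carry the argument. Proper ancestors are always
  branching vertices, so a bracket reaching above level \<open>k\<close> contains the branching
  vertex of level \<open>k\<close>: this is why a lower pair of a unit is joined to that vertex. All
  vertices of a positive level are siblings, so the brackets of a bracketing determine its partial
  order, and comparing bracketings becomes inclusion of bracket sets. The delicate point is
  atomicity: a proper connected gap set must be found inside an arbitrary nonminimal bracketing. The
  lowest nonsingleton projection of a nontrivial bracket gives the interval, and if the interval
  contains the branching vertex, inclusion-minimal brackets are chosen on all higher levels. If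
  these choices gave all gaps, the bracket from which the search started would be maximum. One tree
  is not enough for the summands of \<open>C(t)\<close> on two levels: the lower gap of a two-level
  unit remains a single gap only if the branching vertex is one of its two ends. Summing over all
  trees provides a suitable branching vertex for every gap.\<close>

definition max_face :: "'a::euclidean_space set \<Rightarrow> 'a \<Rightarrow> 'a set" where
  "max_face P y = {x \<in> P. \<forall>z\<in>P. y \<bullet> z \<le> y \<bullet> x}"

lemma max_face_nonempty:
  assumes "compact P" "P \<noteq> {}"
  shows "max_face P y \<noteq> {}"
proof -
  have "continuous_on P (\<lambda>z. y \<bullet> z)" by (intro continuous_intros)
  then obtain x where "x \<in> P" "\<forall>z\<in>P. y \<bullet> z \<le> y \<bullet> x"
    using continuous_attains_sup[OF assms] by blast
  then show ?thesis by (auto simp: max_face_def)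
qed

text \<open>Faces of a polytope are exposed, so a nonempty one is the set of maximizers of a
  functional. In the other direction compactness provides a maximizer.\<close>

lemma nonempty_face_of_polytope_iff:
  assumes "polytope P"
  shows "F face_of P \<and> F \<noteq> {} \<longleftrightarrow> P \<noteq> {} \<and> (\<exists>y. F = max_face P y)"
proof
  assume F: "F face_of P \<and> F \<noteq> {}"
  then have "F exposed_face_of P"
    using assms by (simp add: exposed_face_of_polyhedron polytope_imp_polyhedron)
  then obtain a b where ab: "P \<subseteq> {x. a \<bullet> x \<le> b}" "F = P \<inter> {x. a \<bullet> x = b}"
    by (auto simp: exposed_face_of_def)
  obtain x where "x \<in> F" using F by auto
  then have "F = max_face P a"
    using ab by (fastforce simp: max_face_def)
  then show "P \<noteq> {} \<and> (\<exists>y. F = max_face P y)" using \<open>x \<in> F\<close> ab by auto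
next
  assume "P \<noteq> {} \<and> (\<exists>y. F = max_face P y)"
  then obtain y where y: "F = max_face P y" and ne: "P \<noteq> {}" by auto
  have "F \<noteq> {}"
    using max_face_nonempty[OF polytope_imp_compact[OF assms] ne] y by simp
  then obtain x where x: "x \<in> max_face P y" using y by auto
  then have "max_face P y = P \<inter> {z. y \<bullet> z = y \<bullet> x}"
    by (force simp: max_face_def)
  moreover have "(P \<inter> {z. y \<bullet> z = y \<bullet> x}) face_of P"
    using x by (intro face_of_Int_supporting_hyperplane_le polytope_imp_convex assms)
      (auto simp: max_face_def)
  ultimately show "F face_of P \<and> F \<noteq> {}" using y \<open>F \<noteq> {}\<close> by simp
qed

text \<open>The normal cone of the face picked out by \<open>y\<close> consists of those
  \<open>y'\<close> that keep all maximizers of \<open>y\<close>. Two fans can therefore be compared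
  through the relation \<open>max_face P y \<subseteq> max_face P y'\<close> alone.\<close>

lemma normal_fan_polytope:
  assumes "polytope P" "P \<noteq> {}"
  shows "normal_fan P = range (\<lambda>y. {y'. max_face P y \<subseteq> max_face P y'})"
proof -
  have "normal_cone P (max_face P y) = {y'. max_face P y \<subseteq> max_face P y'}" for y
    by (auto simp: normal_cone_def max_face_def)
  then show ?thesis
    unfolding normal_fan_def nonempty_face_of_polytope_iff[OF assms(1)] using assms(2) by auto
qed

lemma max_face_plus:
  assumes "compact P" "P \<noteq> {}" "compact Q" "Q \<noteq> {}"
  shows "max_face (P + Q) y = max_face P y + max_face Q y"
proof
  show "max_face (P + Q) y \<subseteq> max_face P y + max_face Q y"
  proof
    fix x assume x: "x \<in> max_face (P + Q) y"
    then obtain p q where pq: "x = p + q" "p \<in> P" "q \<in> Q"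
      by (auto simp: max_face_def elim: set_plus_elim)
    have le: "y \<bullet> (p' + q') \<le> y \<bullet> (p + q)" if "p' \<in> P" "q' \<in> Q" for p' q'
      using x pq(1) that by (auto simp: max_face_def)
    have "p \<in> max_face P y"
      using le[OF _ pq(3)] pq by (auto simp: max_face_def inner_simps)
    moreover have "q \<in> max_face Q y"
      using le[OF pq(2)] pq by (auto simp: max_face_def inner_simps)
    ultimately show "x \<in> max_face P y + max_face Q y"
      using pq(1) by auto
  qed
  show "max_face P y + max_face Q y \<subseteq> max_face (P + Q) y"
    by (fastforce simp: max_face_def inner_add_right elim!: set_plus_elim intro: add_mono)
qed

text \<open>If \<open>p + q\<close> is maximal for \<open>y'\<close>, then varying one summand while
  the other is fixed shows that \<open>p\<close> and \<open>q\<close> are both maximal. Compactness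
  supplies a maximizer to pair with in the other summand.\<close>

lemma max_face_plus_subset_iff:
  assumes "compact P" "P \<noteq> {}" "compact Q" "Q \<noteq> {}"
  shows "max_face (P + Q) y \<subseteq> max_face (P + Q) y' \<longleftrightarrow>
    max_face P y \<subseteq> max_face P y' \<and> max_face Q y \<subseteq> max_face Q y'"
proof
  assume sub: "max_face (P + Q) y \<subseteq> max_face (P + Q) y'"
  have *: "p \<in> max_face P y' \<and> q \<in> max_face Q y'"
    if "p \<in> max_face P y" "q \<in> max_face Q y" for p q
  proof -
    have "p + q \<in> max_face (P + Q) y'"
      using that sub max_face_plus[OF assms, of y] by blast
    then have le: "y' \<bullet> (p' + q') \<le> y' \<bullet> (p + q)" if "p' \<in> P" "q' \<in> Q" for p' q'
      using that by (auto simp: max_face_def)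
    have "p \<in> P" "q \<in> Q" using that by (auto simp: max_face_def)
    then show ?thesis
      using le[of p] le[of _ q] by (auto simp: max_face_def inner_simps)
  qed
  show "max_face P y \<subseteq> max_face P y' \<and> max_face Q y \<subseteq> max_face Q y'"
    using * max_face_nonempty[OF assms(1,2), of y] max_face_nonempty[OF assms(3,4), of y] by blast
next
  assume "max_face P y \<subseteq> max_face P y' \<and> max_face Q y \<subseteq> max_face Q y'"
  then show "max_face (P + Q) y \<subseteq> max_face (P + Q) y'"
    by (simp add: max_face_plus[OF assms] set_plus_mono2)
qed

lemma polytope_set_plus:
  fixes P Q :: "'a::euclidean_space set"
  assumes "polytope P" "polytope Q"
  shows "polytope (P + Q)"
proof -
  obtain V W where "finite V" "P = convex hull V" "finite W" "Q = convex hull W"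
    using assms by (auto simp: polytope_def)
  then have "P + Q = convex hull (V + W)" "finite (V + W)"
    by (auto simp: convex_hull_set_plus finite_set_plus)
  then show ?thesis
    by (simp add: polytope_convex_hull)
qed

text \<open>Combined with \<open>normal_fan_polytope\<close>, this says that the fan of a Minkowski
  sum is the common refinement of the fans of its summands.\<close>

lemma sum_polytopes:
  fixes P :: "'i \<Rightarrow> 'a::euclidean_space set"
  assumes "finite I" "\<And>i. i \<in> I \<Longrightarrow> polytope (P i) \<and> P i \<noteq> {}"
  shows "polytope (\<Sum>i\<in>I. P i)" and "(\<Sum>i\<in>I. P i) \<noteq> {}"
    and "max_face (\<Sum>i\<in>I. P i) y \<subseteq> max_face (\<Sum>i\<in>I. P i) y' \<longleftrightarrow>
      (\<forall>i\<in>I. max_face (P i) y \<subseteq> max_face (P i) y')"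
proof -
  have "polytope (\<Sum>i\<in>I. P i) \<and> (\<Sum>i\<in>I. P i) \<noteq> {} \<and>
    (max_face (\<Sum>i\<in>I. P i) y \<subseteq> max_face (\<Sum>i\<in>I. P i) y' \<longleftrightarrow>
      (\<forall>i\<in>I. max_face (P i) y \<subseteq> max_face (P i) y'))"
    using assms
  proof (induction I rule: finite_induct)
    case empty
    \<comment> \<open>The empty Minkowski sum is \<open>{0}\<close>, not the empty set.\<close>
    show ?case
      by (auto simp: max_face_def set_zero polytope_sing)
  next
    case (insert i I)
    have 1: "polytope (P i)" "P i \<noteq> {}" using insert.prems by auto
    have 2: "polytope (\<Sum>i\<in>I. P i)" "(\<Sum>i\<in>I. P i) \<noteq> {}" using insert by auto
    have "polytope (P i + (\<Sum>i\<in>I. P i))"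
      using 1(1) 2(1) by (rule polytope_set_plus)
    moreover have "P i + (\<Sum>i\<in>I. P i) \<noteq> {}"
      using 1 2 by (auto simp: set_plus_def)
    ultimately show ?case
      using insert 1 2 by (simp add: max_face_plus_subset_iff polytope_imp_compact)
  qed
  then show "polytope (\<Sum>i\<in>I. P i)" "(\<Sum>i\<in>I. P i) \<noteq> {}"
    "max_face (\<Sum>i\<in>I. P i) y \<subseteq> max_face (\<Sum>i\<in>I. P i) y' \<longleftrightarrow>
      (\<forall>i\<in>I. max_face (P i) y \<subseteq> max_face (P i) y')" by auto
qed

section \<open>Simplices in labelled coordinates\<close>

context
  fixes e :: "'c \<Rightarrow> 'a::euclidean_space" and A :: "'c set"
  assumes e: "bij_betw e A Basis"
begin

lemma finite_index: "finite A"
  using bij_betw_finite[OF e] by simp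

lemma inner_labelled:
  assumes "p \<in> A" "q \<in> A"
  shows "e p \<bullet> e q = (if p = q then 1 else 0)"
proof -
  have "e p \<in> Basis" "e q \<in> Basis"
    using e assms by (auto simp: bij_betw_def)
  then show ?thesis
    using e assms by (auto simp: inner_Basis bij_betw_def inj_on_def)
qed

lemma inner_coordinates: "y \<bullet> x = (\<Sum>p\<in>A. (y \<bullet> e p) * (x \<bullet> e p))"
  by (subst euclidean_inner) (rule sum.reindex_bij_betw[OF e, symmetric])

lemma simplex_coordinates:
  assumes "S \<subseteq> A" "x \<in> convex hull (e ` S)"
  shows "\<And>p. p \<in> A \<Longrightarrow> 0 \<le> x \<bullet> e p" and "\<And>p. p \<in> A \<Longrightarrow> p \<notin> S \<Longrightarrow> x \<bullet> e p = 0"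
    and "(\<Sum>p\<in>A. x \<bullet> e p) = 1"
proof -
  have fin: "finite S" using assms(1) finite_index finite_subset by blast
  have inj: "inj_on e S" using e assms(1) by (auto simp: bij_betw_def inj_on_def)
  obtain u where u: "\<forall>b\<in>e ` S. 0 \<le> u b" "sum u (e ` S) = 1" "(\<Sum>b\<in>e ` S. u b *\<^sub>R b) = x"
    using assms(2) fin by (auto simp: convex_hull_finite)
  have x: "x = (\<Sum>q\<in>S. u (e q) *\<^sub>R e q)"
    using u(3) by (simp add: sum.reindex[OF inj])
  have *: "x \<bullet> e p = (if p \<in> S then u (e p) else 0)" if "p \<in> A" for p
  proof -
    have "x \<bullet> e p = (\<Sum>q\<in>S. if q = p then u (e q) else 0)"
      unfolding x inner_sum_left
      using assms(1) that by (intro sum.cong) (auto simp: inner_labelled)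
    then show ?thesis using fin by simp
  qed
  show "0 \<le> x \<bullet> e p" if "p \<in> A" for p using * that u(1) by auto
  show "x \<bullet> e p = 0" if "p \<in> A" "p \<notin> S" for p using * that by auto
  have "(\<Sum>p\<in>A. x \<bullet> e p) = (\<Sum>p\<in>S. u (e p))"
    using assms(1) * finite_index by (intro sum.mono_neutral_cong_right) auto
  also have "\<dots> = 1" using u(2) by (simp add: sum.reindex[OF inj])
  finally show "(\<Sum>p\<in>A. x \<bullet> e p) = 1" .
qed

text \<open>The coordinates of a point of the simplex are convex weights, and a point attaining the
  maximum can put weight only on labels where \<open>y\<close> is maximal.\<close>

lemma max_face_simplex:
  assumes "S \<subseteq> A"
  shows "max_face (convex hull (e ` S)) y =
    convex hull (e ` {p \<in> S. \<forall>q\<in>S. y \<bullet> e q \<le> y \<bullet> e p})"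
    (is "?F = convex hull (e ` ?M)")
proof (cases "S = {}")
  case False
  have fin: "finite S" using assms finite_index finite_subset by blast
  have "Max ((\<lambda>q. y \<bullet> e q) ` S) \<in> (\<lambda>q. y \<bullet> e q) ` S"
    using fin False by (intro Max_in) auto
  then obtain m where "m \<in> S" "Max ((\<lambda>q. y \<bullet> e q) ` S) = y \<bullet> e m"
    by auto
  then have m: "m \<in> S" "\<And>q. q \<in> S \<Longrightarrow> y \<bullet> e q \<le> y \<bullet> e m"
    using Max_ge[of "(\<lambda>q. y \<bullet> e q) ` S"] fin by force+
  define b where "b = y \<bullet> e m"
  have M: "?M = {p \<in> S. y \<bullet> e p = b}"
    using m by (force simp: b_def)
  have hull: "convex hull (e ` S) \<subseteq> {z. y \<bullet> z \<le> b}"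
    by (rule hull_minimal) (auto simp: convex_halfspace_le b_def m(2))
  have "?F = convex hull (e ` S) \<inter> {z. y \<bullet> z = b}"
  proof -
    have "e m \<in> convex hull (e ` S)" using m by (simp add: hull_inc)
    then show ?thesis using hull by (force simp: max_face_def b_def)
  qed
  also have "\<dots> = convex hull (e ` ?M)"
  proof
    show "convex hull (e ` ?M) \<subseteq> convex hull (e ` S) \<inter> {z. y \<bullet> z = b}"
      by (rule hull_minimal)
        (auto simp: M hull_inc intro!: convex_Int convex_hyperplane)
    show "convex hull (e ` S) \<inter> {z. y \<bullet> z = b} \<subseteq> convex hull (e ` ?M)"
    proof
      fix x assume x: "x \<in> convex hull (e ` S) \<inter> {z. y \<bullet> z = b}"
      have c: "\<And>p. p \<in> A \<Longrightarrow> 0 \<le> x \<bullet> e p" "\<And>p. p \<in> A \<Longrightarrow> p \<notin> S \<Longrightarrow> x \<bullet> e p = 0"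
        "(\<Sum>p\<in>A. x \<bullet> e p) = 1"
        using simplex_coordinates[OF assms] x by auto
      \<comment> \<open>Complementary slackness: the deficits \<open>b - y \<bullet> e p\<close>,
        weighted by the coordinates of \<open>x\<close>, are nonnegative and sum to zero, so every
        term vanishes.\<close>
      have "(\<Sum>p\<in>A. (b - y \<bullet> e p) * (x \<bullet> e p)) = b * (\<Sum>p\<in>A. x \<bullet> e p) - y \<bullet> x"
        by (simp add: inner_coordinates[of y x] left_diff_distrib sum_subtractf sum_distrib_left)
      also have "\<dots> = 0" using x c(3) by simp
      finally have "(\<Sum>p\<in>A. (b - y \<bullet> e p) * (x \<bullet> e p)) = 0" .
      moreover have "0 \<le> (b - y \<bullet> e p) * (x \<bullet> e p)" if "p \<in> A" for p
        using c(1,2)[OF that] m(2)[of p] by (cases "p \<in> S") (auto simp: b_def)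
      ultimately have z: "(b - y \<bullet> e p) * (x \<bullet> e p) = 0" if "p \<in> A" for p
        using that finite_index by (simp add: sum_nonneg_eq_0_iff)
      have zero: "x \<bullet> e p = 0" if "p \<in> A" "p \<notin> ?M" for p
        using z[OF that(1)] c(2)[OF that(1)] that(2) unfolding M by auto
      have "x = (\<Sum>p\<in>A. (x \<bullet> e p) *\<^sub>R e p)"
        using euclidean_representation[of x] sum.reindex_bij_betw[OF e, of "\<lambda>b. (x \<bullet> b) *\<^sub>R b"]
        by simp
      also have "\<dots> = (\<Sum>p\<in>?M. (x \<bullet> e p) *\<^sub>R e p)"
        using zero assms finite_index by (intro sum.mono_neutral_right) auto
      also have "\<dots> \<in> convex hull (e ` ?M)"
      proof (rule convex_sum)
        show "finite ?M" using fin by simp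
        have "(\<Sum>p\<in>?M. x \<bullet> e p) = (\<Sum>p\<in>A. x \<bullet> e p)"
          using zero assms finite_index by (intro sum.mono_neutral_left) auto
        then show "(\<Sum>p\<in>?M. x \<bullet> e p) = 1" using c(3) by simp
      qed (use assms c(1) in \<open>auto intro: hull_inc\<close>)
      finally show "x \<in> convex hull (e ` ?M)" .
    qed
  qed
  finally show ?thesis .
next
  case True
  show ?thesis unfolding True by (simp add: max_face_def)
qed

lemma max_face_simplex_subset_iff:
  assumes "S \<subseteq> A"
  shows "max_face (convex hull (e ` S)) y \<subseteq> max_face (convex hull (e ` S)) y' \<longleftrightarrow>
    (\<forall>p\<in>S. (\<forall>q\<in>S. y \<bullet> e q \<le> y \<bullet> e p) \<longrightarrow> (\<forall>q\<in>S. y' \<bullet> e q \<le> y' \<bullet> e p))"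
proof
  assume sub: "max_face (convex hull (e ` S)) y \<subseteq> max_face (convex hull (e ` S)) y'"
  show "\<forall>p\<in>S. (\<forall>q\<in>S. y \<bullet> e q \<le> y \<bullet> e p) \<longrightarrow> (\<forall>q\<in>S. y' \<bullet> e q \<le> y' \<bullet> e p)"
  proof (intro ballI impI)
    fix p q assume p: "p \<in> S" "\<forall>q\<in>S. y \<bullet> e q \<le> y \<bullet> e p" and q: "q \<in> S"
    have "e p \<in> max_face (convex hull (e ` S)) y"
      unfolding max_face_simplex[OF assms] using p by (intro hull_inc imageI) blast
    then have "e p \<in> max_face (convex hull (e ` S)) y'"
      using sub by blast
    moreover have "e q \<in> convex hull (e ` S)"
      using q by (intro hull_inc imageI)
    ultimately show "y' \<bullet> e q \<le> y' \<bullet> e p"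
      by (auto simp: max_face_def)
  qed
next
  assume "\<forall>p\<in>S. (\<forall>q\<in>S. y \<bullet> e q \<le> y \<bullet> e p) \<longrightarrow> (\<forall>q\<in>S. y' \<bullet> e q \<le> y' \<bullet> e p)"
  then show "max_face (convex hull (e ` S)) y \<subseteq> max_face (convex hull (e ` S)) y'"
    unfolding max_face_simplex[OF assms] by (intro hull_mono image_mono) blast
qed

end

section \<open>Inequalities describing a Minkowski sum of simplices\<close>

text \<open>
  Peeling off the top value of \<open>y\<close> changes both sides by a multiple of the constraint for the set
  where \<open>y\<close> is not maximal.
\<close>

lemma greedy_bound:
  fixes x y :: "'c \<Rightarrow> real" and D :: "'i \<Rightarrow> 'c set"
  assumes A: "finite A" and U: "finite U" "\<And>c. c \<in> U \<Longrightarrow> D c \<subseteq> A \<and> D c \<noteq> {}"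
    and total: "sum x A = card U"
    and x: "\<And>S. S \<subseteq> A \<Longrightarrow> sum x S \<ge> card {c \<in> U. D c \<subseteq> S}"
  shows "(\<Sum>p\<in>A. y p * x p) \<le> (\<Sum>c\<in>U. Max (y ` D c))"
\<comment> \<open>The measure is the number of values of \<open>y\<close>; lowering the top value to
  the next one removes a value.\<close>
proof (induction "card (y ` A)" arbitrary: y rule: less_induct)
  case less
  show ?case
  proof (cases "\<exists>a b. a \<in> A \<and> b \<in> A \<and> y a \<noteq> y b")
    case False
    show ?thesis
    proof (cases "A = {}")
      case True
      then have "U = {}" using U(2) by auto
      then show ?thesis using True by simp
    next
      case ne: False
      then obtain v where v: "\<And>a. a \<in> A \<Longrightarrow> y a = v" using False by (metis all_not_in_conv)
      have "y ` D c = {v}" if "c \<in> U" for c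
        using U(2)[OF that] v by fastforce
      then have "(\<Sum>c\<in>U. Max (y ` D c)) = v * card U" by simp
      moreover have "(\<Sum>p\<in>A. y p * x p) = v * sum x A"
        by (simp add: v sum_distrib_left)
      ultimately show ?thesis using total by simp
    qed
  next
    case True
    define m where "m = Max (y ` A)"
    define S where "S = {p \<in> A. y p < m}"
    define m' where "m' = Max (y ` S)"
    \<comment> \<open>The top value \<open>m\<close> is lowered to the second largest value
      \<open>m'\<close>. Coordinates outside \<open>S\<close> lose \<open>m - m'\<close>, and the
      maximum over \<open>D c\<close> loses the same amount exactly when \<open>D c\<close> is not
      contained in \<open>S\<close>.\<close>
    define y' where "y' p = min (y p) m'" for p
    have A0: "A \<noteq> {}" using True by auto
    have le_m: "y p \<le> m" if "p \<in> A" for p unfolding m_def using that A by auto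
    have "S \<noteq> {}"
    proof -
      obtain a b where ab: "a \<in> A" "b \<in> A" "y a < y b" using True by (metis neqE)
      then have "a \<in> S" using le_m[of b] by (auto simp: S_def)
      then show ?thesis by auto
    qed
    have finS: "finite S" using A by (simp add: S_def)
    have m'_in: "m' \<in> y ` S" unfolding m'_def using finS \<open>S \<noteq> {}\<close> by (intro Max_in) auto
    have le_m': "y p \<le> m'" if "p \<in> S" for p unfolding m'_def using that finS by auto
    have "m' < m" using m'_in by (auto simp: S_def)
    have y'S: "y' p = y p" if "p \<in> S" for p using le_m'[OF that] by (simp add: y'_def)
    have y'A: "y p = m \<and> y' p = m'" if "p \<in> A - S" for p
      using that le_m[of p] \<open>m' < m\<close> by (auto simp: y'_def S_def)
    have "y' p \<in> y ` S" if "p \<in> A" for p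
      using y'S[of p] y'A[of p] m'_in that by (cases "p \<in> S") auto
    then have "y' ` A \<subseteq> y ` S" by blast
    moreover have "y ` S \<subset> y ` A"
    proof -
      have "m \<in> y ` A" unfolding m_def using A A0 by (intro Max_in) auto
      moreover have "m \<notin> y ` S" by (auto simp: S_def)
      moreover have "y ` S \<subseteq> y ` A" by (auto simp: S_def)
      ultimately show ?thesis by blast
    qed
    ultimately have "card (y' ` A) < card (y ` A)"
      using A by (intro psubset_card_mono) auto
    then have IH: "(\<Sum>p\<in>A. y' p * x p) \<le> (\<Sum>c\<in>U. Max (y' ` D c))"
      by (rule less)
    have "S \<subseteq> A" by (auto simp: S_def)
    have Max_y: "Max (y ` D c) = Max (y' ` D c) + (m - m') * (if D c \<subseteq> S then 0 else 1)"
      if c: "c \<in> U" for c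
    proof (cases "D c \<subseteq> S")
      case True
      then have "y ` D c = y' ` D c" using y'S by (intro image_cong) auto
      then show ?thesis using True by simp
    next
      case False
      then obtain p where p: "p \<in> D c" "p \<in> A - S" using U(2)[OF c] by auto
      have fin: "finite (D c)" using U(2)[OF c] A finite_subset by blast
      have "Max (y ` D c) = m"
      proof (intro Max_eqI)
        show "m \<in> y ` D c" using y'A[OF p(2)] p(1) by auto
        show "\<And>v. v \<in> y ` D c \<Longrightarrow> v \<le> m" using le_m U(2)[OF c] by auto
      qed (use fin in simp)
      moreover have "Max (y' ` D c) = m'"
      proof (intro Max_eqI)
        show "m' \<in> y' ` D c" using y'A[OF p(2)] p(1) by (metis imageI)
        show "\<And>v. v \<in> y' ` D c \<Longrightarrow> v \<le> m'" by (auto simp: y'_def)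
      qed (use fin in simp)
      ultimately show ?thesis using False by simp
    qed
    have "(\<Sum>p\<in>A. y p * x p) = (\<Sum>p\<in>A. y' p * x p) + (m - m') * sum x (A - S)"
    proof -
      have "(\<Sum>p\<in>A. y p * x p) = (\<Sum>p\<in>A. y' p * x p + (if p \<in> A - S then (m - m') * x p else 0))"
        using y'S y'A by (intro sum.cong) (auto simp: algebra_simps)
      also have "\<dots> = (\<Sum>p\<in>A. y' p * x p) + (\<Sum>p\<in>A - S. (m - m') * x p)"
        using A by (simp add: sum.distrib sum.If_cases Int_def set_diff_eq conj_commute)
      finally show ?thesis by (simp add: sum_distrib_left)
    qed
    also have "sum x (A - S) = card U - sum x S"
      using total sum.subset_diff[OF \<open>S \<subseteq> A\<close> A, of x] by simp
    \<comment> \<open>The lower bound on \<open>sum x S\<close> is used here with a negative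
      coefficient, since \<open>m - m'\<close> is positive.\<close>
    also have "(\<Sum>p\<in>A. y' p * x p) + (m - m') * (card U - sum x S) \<le>
        (\<Sum>c\<in>U. Max (y' ` D c)) + (m - m') * (card U - real (card {c \<in> U. D c \<subseteq> S}))"
      using IH x[OF \<open>S \<subseteq> A\<close>] \<open>m' < m\<close> by (intro add_mono mult_left_mono) auto
    also have "card U - real (card {c \<in> U. D c \<subseteq> S}) = (\<Sum>c\<in>U. if D c \<subseteq> S then 0 else 1)"
    proof -
      have "(\<Sum>c\<in>U. if D c \<subseteq> S then 0 else 1::real) = (\<Sum>c\<in>U. 1 - (if D c \<subseteq> S then 1 else 0))"
        by (intro sum.cong) auto
      then show ?thesis using U(1) by (simp add: sum_subtractf sum.If_cases Int_def)
    qed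
    finally show ?thesis
      by (simp add: Max_y sum.distrib sum_distrib_left)
  qed
qed

context
  fixes e :: "'c \<Rightarrow> 'a::euclidean_space" and A :: "'c set"
  assumes e: "bij_betw e A Basis"
begin

text \<open>The right side is the base polytope of the supermodular function that counts the sets
  \<open>D c\<close> inside \<open>S\<close>. One inclusion holds because a simplex inside
  \<open>S\<close> contributes its full weight 1; for the other, a separating functional would
  violate \<open>greedy_bound\<close>, whose bound is attained by a sum of simplex vertices.
  Indexing by \<open>c\<close> counts equal simplices with multiplicity.\<close>

lemma minkowski_sum_simplices:
  fixes D :: "'i \<Rightarrow> 'c set"
  assumes U: "finite U" "\<And>c. c \<in> U \<Longrightarrow> D c \<subseteq> A \<and> D c \<noteq> {}"
  shows "(\<Sum>c\<in>U. convex hull (e ` D c)) =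
    {x. (\<Sum>p\<in>A. x \<bullet> e p) = card U \<and>
        (\<forall>S\<subseteq>A. (\<Sum>p\<in>S. x \<bullet> e p) \<ge> card {c \<in> U. D c \<subseteq> S})}" (is "?Q = ?P")
proof
  note fin = finite_index[OF e]
  have Q: "?Q = {\<Sum>c\<in>U. q c |q. \<forall>c\<in>U. q c \<in> convex hull (e ` D c)}"
    by (rule set_sum_alt[OF U(1)])
  show "?Q \<subseteq> ?P"
  proof
    fix x assume "x \<in> ?Q"
    then obtain q where q: "x = (\<Sum>c\<in>U. q c)" "\<And>c. c \<in> U \<Longrightarrow> q c \<in> convex hull (e ` D c)"
      unfolding Q by blast
    have c: "\<And>p. p \<in> A \<Longrightarrow> 0 \<le> q c \<bullet> e p" "\<And>p. p \<in> A \<Longrightarrow> p \<notin> D c \<Longrightarrow> q c \<bullet> e p = 0"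
      "(\<Sum>p\<in>A. q c \<bullet> e p) = 1" if "c \<in> U" for c
      using simplex_coordinates[OF e _ q(2)[OF that]] U(2)[OF that] by auto
    have swap: "(\<Sum>p\<in>S. x \<bullet> e p) = (\<Sum>c\<in>U. \<Sum>p\<in>S. q c \<bullet> e p)" for S
      unfolding q(1) inner_sum_left by (rule sum.swap)
    have "card {c \<in> U. D c \<subseteq> S} \<le> (\<Sum>p\<in>S. x \<bullet> e p)" if S: "S \<subseteq> A" for S
    proof -
      have "real (card {c \<in> U. D c \<subseteq> S}) = (\<Sum>c\<in>U. if D c \<subseteq> S then 1 else 0)"
        using U(1) by (simp add: sum.If_cases Int_def)
      also have "\<dots> \<le> (\<Sum>c\<in>U. \<Sum>p\<in>S. q c \<bullet> e p)"
      proof (rule sum_mono)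
        fix c assume cU: "c \<in> U"
        have "0 \<le> (\<Sum>p\<in>S. q c \<bullet> e p)"
          using c(1)[OF cU] S by (intro sum_nonneg) auto
        moreover have "(\<Sum>p\<in>S. q c \<bullet> e p) = 1" if "D c \<subseteq> S"
        proof -
          have "(\<Sum>p\<in>S. q c \<bullet> e p) = (\<Sum>p\<in>A. q c \<bullet> e p)"
            using c(2)[OF cU] S that fin by (intro sum.mono_neutral_left) auto
          then show ?thesis using c(3)[OF cU] by simp
        qed
        ultimately show "(if D c \<subseteq> S then 1 else 0) \<le> (\<Sum>p\<in>S. q c \<bullet> e p)" by simp
      qed
      finally show ?thesis unfolding swap .
    qed
    then show "x \<in> ?P" using c(3) by (simp add: swap)
  qed
  show "?P \<subseteq> ?Q"
  proof (rule ccontr)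
    assume "\<not> ?P \<subseteq> ?Q"
    then obtain x where x: "x \<in> ?P" "x \<notin> ?Q" by blast
    have poly: "polytope (convex hull (e ` D c)) \<and> convex hull (e ` D c) \<noteq> {}" if "c \<in> U" for c
    proof -
      have "finite (D c)" using U(2)[OF that] fin finite_subset by blast
      then show ?thesis using U(2)[OF that] by (simp add: polytope_convex_hull)
    qed
    have "polytope ?Q" "?Q \<noteq> {}"
      using sum_polytopes(1,2)[of U "\<lambda>c. convex hull (e ` D c)"] U(1) poly by blast+
    then obtain a b where ab: "a \<bullet> x < b" "\<forall>z\<in>?Q. b < a \<bullet> z"
      using separating_hyperplane_closed_point[of ?Q x] x(2)
      by (auto simp: polytope_imp_convex polytope_imp_closed)
    \<comment> \<open>Separation bounds the Minkowski sum from below; the sign change turns this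
      into a statement about maxima.\<close>
    define y where "y = - a"
    have "\<exists>p\<in>D c. Max ((\<lambda>p. y \<bullet> e p) ` D c) = y \<bullet> e p" if "c \<in> U" for c
    proof -
      have "finite (D c)" using U(2)[OF that] fin finite_subset by blast
      then have "Max ((\<lambda>p. y \<bullet> e p) ` D c) \<in> (\<lambda>p. y \<bullet> e p) ` D c"
        using U(2)[OF that] by (intro Max_in) auto
      then show ?thesis by auto
    qed
    \<comment> \<open>\<open>m c\<close> is a label of \<open>D c\<close> where \<open>y\<close> is
      largest, so the sum of the vertices \<open>e (m c)\<close> maximizes \<open>y\<close> on the
      Minkowski sum.\<close>
    then obtain m where m: "\<And>c. c \<in> U \<Longrightarrow> m c \<in> D c"
      "\<And>c. c \<in> U \<Longrightarrow> Max ((\<lambda>p. y \<bullet> e p) ` D c) = y \<bullet> e (m c)"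
      by metis
    have "(\<Sum>c\<in>U. e (m c)) \<in> ?Q"
      unfolding Q using m(1) by (auto intro!: exI[of _ "\<lambda>c. e (m c)"] hull_inc)
    then have "y \<bullet> (\<Sum>c\<in>U. e (m c)) < y \<bullet> x"
      using ab by (force simp: y_def)
    also have "y \<bullet> x = (\<Sum>p\<in>A. (y \<bullet> e p) * (x \<bullet> e p))"
      by (rule inner_coordinates[OF e])
    also have "\<dots> \<le> (\<Sum>c\<in>U. Max ((\<lambda>p. y \<bullet> e p) ` D c))"
      using x(1) by (intro greedy_bound fin U) auto
    also have "\<dots> = y \<bullet> (\<Sum>c\<in>U. e (m c))"
      by (simp add: inner_sum_right m(2))
    finally show False by simp
  qed
qed

end

section \<open>Concentrated trees and block brackets\<close>

text \<open>\<open>take k b\<close> is the branching vertex of level \<open>k\<close>, so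
  \<open>b\<close> records child positions along the stem. The last entry of \<open>b\<close> points
  to a leaf, and different \<open>b\<close> may give the same tree.\<close>

definition stem_tree :: "nat list \<Rightarrow> nat list \<Rightarrow> tree" where
  "stem_tree t b = {[]} \<union> {take k b @ [j] |k j. k < length t \<and> j \<le> t ! k}"

text \<open>Child positions start at 0, so gap \<open>p\<close> separates the positions
  \<open>p - 1\<close> and \<open>p\<close>; hence the half-open range. At the root
  \<open>last\<close> is unspecified, but the root is alone on its level and the range is
  empty.\<close>

definition block :: "tree \<Rightarrow> (nat \<times> nat) set \<Rightarrow> vertex \<Rightarrow> vertex set" where
  "block T S v = {w \<in> T. length w = length v \<and>
     (\<forall>p. min (last v) (last w) < p \<and> p \<le> max (last v) (last w) \<longrightarrow> (length v, p) \<in> S)}"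

definition block_bracket :: "tree \<Rightarrow> (nat \<times> nat) set \<Rightarrow> vertex \<Rightarrow> bracket" where
  "block_bracket T S v = map (\<lambda>i. block T S (take i v)) [0..<Suc (length v)]"

text \<open>Disjoint intervals over the same projection, compared from left to right. By
  \<open>bracketing_order\<close> below this is the order of every bracketing of a concentrated
  tree.\<close>

definition block_order :: "bracket set \<Rightarrow> (bracket \<times> bracket) set" where
  "block_order B = {(A, A') \<in> B \<times> B. butlast A = butlast A' \<and> (\<forall>u\<in>last A. \<forall>v\<in>last A'. u < v)}"

lemma snoc_less_snoc: "u @ [i] < u @ [j] \<longleftrightarrow> i < (j::nat)"
  by (induction u) auto

lemma length_block_bracket: "length (block_bracket T S v) = Suc (length v)"
  by (simp add: block_bracket_def)

lemma nth_block_bracket: "i \<le> length v \<Longrightarrow> block_bracket T S v ! i = block T S (take i v)"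
  by (simp add: block_bracket_def nth_append)

lemma last_block_bracket: "last (block_bracket T S v) = block T S v"
  by (simp add: block_bracket_def)

lemma butlast_block_bracket:
  "v \<noteq> [] \<Longrightarrow> butlast (block_bracket T S v) = block_bracket T S (butlast v)"
  by (rule nth_equalityI)
    (auto simp: length_block_bracket nth_butlast nth_block_bracket take_butlast)

lemma take_block_bracket:
  "i \<le> length v \<Longrightarrow> take (Suc i) (block_bracket T S v) = block_bracket T S (take i v)"
  by (rule nth_equalityI) (auto simp: length_block_bracket nth_block_bracket)

lemma bracket_le_block_bracket: "R \<subseteq> S \<Longrightarrow> bracket_le (block_bracket T R v) (block_bracket T S v)"
  by (auto simp: bracket_le_def length_block_bracket nth_block_bracket block_def)

lemma bracket_le_antisym: "bracket_le A A' \<Longrightarrow> bracket_le A' A \<Longrightarrow> A = A'"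
  by (auto simp: bracket_le_def intro!: nth_equalityI)

lemma bracket_le_last: "bracket_le A A' \<Longrightarrow> A \<noteq> [] \<Longrightarrow> last A \<subseteq> last A'"
  by (cases "A' = []") (auto simp: bracket_le_def last_conv_nth)

lemma length_eqI_butlast:
  "A \<noteq> [] \<Longrightarrow> A' \<noteq> [] \<Longrightarrow> butlast A = butlast A' \<Longrightarrow> length A = length A'"
  by (cases A rule: rev_cases; cases A' rule: rev_cases) auto

lemma is_bracket_last:
  assumes "is_bracket T k A"
  shows "length A = Suc k" "A \<noteq> []" "last A = A ! k" "last A \<noteq> {}" "last A \<subseteq> level T k"
proof -
  show "length A = Suc k" using assms by (simp add: is_bracket_def)
  then show "A \<noteq> []" by auto
  then show last: "last A = A ! k" using \<open>length A = Suc k\<close> by (simp add: last_conv_nth)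
  show "last A \<noteq> {}" "last A \<subseteq> level T k"
    using assms unfolding last is_bracket_def by blast+
qed

text \<open>Later proofs refer to the axioms by their position in this list: 5 and 6 are axiom (1),
  and 7 to 13 are (2), (3), (4a), (4b), (5a), (5b), (5c).\<close>

lemma is_bracketingD:
  assumes "is_bracketing T B r"
  shows "\<forall>A\<in>B. \<exists>k\<le>depth T. is_bracket T k A" "r \<subseteq> B \<times> B" "irrefl r" "trans r"
    "\<forall>k\<le>depth T. max_bracket T k \<in> B" "\<forall>u\<in>T. singleton_bracket u \<in> B"
    "\<forall>k\<in>{1..depth T}. \<forall>A\<in>bracket_level B k. butlast A \<in> bracket_level B (k - 1)"
    "\<forall>k\<le>depth T. \<forall>A\<^sub>1\<in>bracket_level B k. \<forall>A\<^sub>2\<in>bracket_level B k.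
        last A\<^sub>1 \<inter> last A\<^sub>2 \<noteq> {} \<longrightarrow> bracket_le A\<^sub>1 A\<^sub>2 \<or> bracket_le A\<^sub>2 A\<^sub>1"
    "\<forall>k\<in>{1..depth T}. \<forall>A\<in>bracket_level B (k - 1).
        (\<Union>A'\<in>brackets_over B A. last A') = (\<Union>u\<in>last A. children T u)"
    "\<forall>k\<in>{1..depth T}. \<forall>A\<in>bracket_level B (k - 1).
        \<forall>A\<^sub>1\<in>brackets_over B A. \<forall>A\<^sub>2\<in>brackets_over B A. bracket_less A\<^sub>2 A\<^sub>1 \<longrightarrow>
          (\<forall>u\<in>last A\<^sub>1. \<exists>A\<^sub>3\<in>brackets_over B A. bracket_less A\<^sub>3 A\<^sub>1 \<and> u \<in> last A\<^sub>3)"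
    "\<forall>A\<^sub>1\<in>B. \<forall>A\<^sub>2\<in>B. A\<^sub>1 \<noteq> A\<^sub>2 \<longrightarrow>
        (comparable r A\<^sub>1 A\<^sub>2 \<longleftrightarrow>
          length A\<^sub>1 = length A\<^sub>2 \<and> butlast A\<^sub>1 = butlast A\<^sub>2 \<and> last A\<^sub>1 \<inter> last A\<^sub>2 = {})"
    "\<forall>u\<in>T. \<forall>u\<^sub>1\<in>children T u. \<forall>u\<^sub>2\<in>children T u.
        u\<^sub>1 < u\<^sub>2 \<longrightarrow> (singleton_bracket u\<^sub>1, singleton_bracket u\<^sub>2) \<in> r"
    "\<forall>k\<in>{1..depth T}. \<forall>A\<in>bracket_level B (k - 1). \<forall>A'\<in>bracket_level B (k - 1).
        bracket_le A' A \<longrightarrow>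
        (\<forall>A\<^sub>1\<in>brackets_over B A. \<forall>A\<^sub>2\<in>brackets_over B A.
         \<forall>A\<^sub>1'\<in>brackets_over B A'. \<forall>A\<^sub>2'\<in>brackets_over B A'.
           A\<^sub>1 \<noteq> A\<^sub>2 \<and> comparable r A\<^sub>1 A\<^sub>2 \<and> A\<^sub>1' \<noteq> A\<^sub>2' \<and> comparable r A\<^sub>1' A\<^sub>2' \<and>
           bracket_le A\<^sub>1' A\<^sub>1 \<and> bracket_le A\<^sub>2' A\<^sub>2 \<longrightarrow>
           ((A\<^sub>1, A\<^sub>2) \<in> r \<longleftrightarrow> (A\<^sub>1', A\<^sub>2') \<in> r))"
  using assms unfolding is_bracketing_def by - (elim conjE; assumption)+

section \<open>Vertices, levels and blocks of a concentrated tree\<close>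

locale stem =
  fixes t b :: "nat list" and T :: tree
  assumes length_b: "length b = length t" and b_le: "\<And>k. k < length t \<Longrightarrow> b ! k \<le> t ! k"
    and T_def: "T = stem_tree t b"
begin

abbreviation br :: "(nat \<times> nat) set \<Rightarrow> vertex \<Rightarrow> bracket" where
  "br \<equiv> block_bracket T"

lemma mem_T: "v \<in> T \<longleftrightarrow> v = [] \<or>
    (length v \<le> length t \<and> butlast v = take (length v - 1) b \<and> last v \<le> t ! (length v - 1))"
proof
  assume "v \<in> T"
  then show "v = [] \<or>
    (length v \<le> length t \<and> butlast v = take (length v - 1) b \<and> last v \<le> t ! (length v - 1))"
    by (auto simp: T_def stem_tree_def length_b min_def)
next
  assume v: "v = [] \<or>
    (length v \<le> length t \<and> butlast v = take (length v - 1) b \<and> last v \<le> t ! (length v - 1))"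
  show "v \<in> T"
  proof (cases "v = []")
    case False
    then have "v = take (length v - 1) b @ [last v]"
      using v append_butlast_last_id[OF False] by simp
    moreover have "length v - 1 < length t" using v False by (cases v) auto
    ultimately show ?thesis using v False unfolding T_def stem_tree_def by blast
  qed (simp add: T_def stem_tree_def)
qed

lemma stem_mem: "k \<le> length t \<Longrightarrow> take k b \<in> T"
proof (cases k)
  case (Suc i)
  assume "k \<le> length t"
  then show ?thesis
    using b_le[of i] Suc length_b by (auto simp: mem_T take_Suc_conv_app_nth)
qed (simp add: mem_T)

lemma node_mem: "k < length t \<Longrightarrow> j \<le> t ! k \<Longrightarrow> take k b @ [j] \<in> T"
  by (auto simp: T_def stem_tree_def)

lemma length_le: "v \<in> T \<Longrightarrow> length v \<le> length t"
  by (auto simp: mem_T)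

text \<open>Proper ancestors have children, hence are branching vertices; only the last entry of a
  vertex can leave the stem.\<close>

lemma take_vertex: "v \<in> T \<Longrightarrow> i < length v \<Longrightarrow> take i v = take i b"
proof -
  assume "v \<in> T" "i < length v"
  then have "take i (butlast v) = take i b"
    by (auto simp: mem_T)
  then show ?thesis using \<open>i < length v\<close> by (simp add: take_butlast)
qed

lemma butlast_vertex: "v \<in> T \<Longrightarrow> v \<noteq> [] \<Longrightarrow> butlast v = take (length v - 1) b"
  by (auto simp: mem_T)

lemma take_mem: "v \<in> T \<Longrightarrow> take i v \<in> T"
proof (cases "i < length v")
  case True
  assume "v \<in> T"
  then show ?thesis using True length_le[of v] by (simp add: take_vertex stem_mem)
qed simp

lemma level_0: "level T 0 = {[]}"
  by (auto simp: level_def mem_T)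

lemma level_Suc:
  assumes "k < length t"
  shows "level T (Suc k) = (\<lambda>j. take k b @ [j]) ` {..t ! k}"
proof
  show "level T (Suc k) \<subseteq> (\<lambda>j. take k b @ [j]) ` {..t ! k}"
  proof
    fix v assume "v \<in> level T (Suc k)"
    then have v: "v \<in> T" "length v = Suc k" by (auto simp: level_def)
    then have "v \<noteq> []" by auto
    then have "v = take k b @ [last v]" "last v \<le> t ! k"
      using v append_butlast_last_id[OF \<open>v \<noteq> []\<close>] by (auto simp: mem_T)
    then show "v \<in> (\<lambda>j. take k b @ [j]) ` {..t ! k}" by blast
  qed
  show "(\<lambda>j. take k b @ [j]) ` {..t ! k} \<subseteq> level T (Suc k)"
    using assms node_mem by (auto simp: level_def length_b)
qed

lemma card_level: "k < length t \<Longrightarrow> card (level T (Suc k)) = t ! k + 1"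
  by (simp add: level_Suc card_image inj_on_def)

lemma level_nonempty: "level T k \<noteq> {} \<longleftrightarrow> k \<le> length t"
proof
  show "level T k \<noteq> {} \<Longrightarrow> k \<le> length t" by (auto simp: level_def length_le)
  show "k \<le> length t \<Longrightarrow> level T k \<noteq> {}"
    using stem_mem[of k] by (auto simp: level_def length_b)
qed

lemma depth: "depth T = length t"
proof -
  have "{k. level T k \<noteq> {}} = {..length t}" by (auto simp: level_nonempty)
  then show ?thesis unfolding depth_def by (auto intro!: Max_eqI)
qed

lemma finite_T: "finite T"
proof -
  have "T \<subseteq> (\<Union>k\<in>{..length t}. level T k)" by (auto simp: level_def length_le)
  moreover have "finite (level T k)" if "k \<le> length t" for k
    using that by (cases k) (auto simp: level_0 level_Suc)
  ultimately show ?thesis by (meson finite_UN_I finite_atMost atMost_iff finite_subset)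
qed

lemma vertex_snoc:
  assumes "v \<in> T" "v \<noteq> []"
  shows "take (length v - 1) b @ [last v] = v"
  using append_butlast_last_id[OF assms(2)] butlast_vertex[OF assms] by simp

text \<open>Vertices of the same level share their parent, so the lexicographic order is decided by
  the last child position.\<close>

lemma less_iff:
  assumes "u \<in> T" "v \<in> T" "length u = length v"
  shows "u < v \<longleftrightarrow> last u < last v"
proof (cases "u = []")
  case False
  then have "v \<noteq> []" using assms by auto
  have "u < v \<longleftrightarrow> take (length u - 1) b @ [last u] < take (length v - 1) b @ [last v]"
    using vertex_snoc[OF assms(1) False] vertex_snoc[OF assms(2) \<open>v \<noteq> []\<close>] by simp
  then show ?thesis by (simp add: assms(3) snoc_less_snoc)
qed (use assms in auto)

lemma vertex_eqI:
  assumes "u \<in> T" "v \<in> T" "length u = length v" "last u = last v"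
  shows "u = v"
proof (cases "u = []")
  case False
  then have "v \<noteq> []" using assms by auto
  then show ?thesis
    using vertex_snoc[OF assms(1) False] vertex_snoc[OF assms(2)] assms(3,4) by simp
qed (use assms in auto)

lemma children: "children T u =
    (if length u < length t \<and> u = take (length u) b then level T (Suc (length u)) else {})"
proof -
  have "\<exists>i. v = u @ [i]" if "v \<in> T" "length v = Suc (length u)" "u = take (length u) b" for v
  proof -
    have "v \<noteq> []" using that by auto
    then show ?thesis
      using that butlast_vertex[of v] append_butlast_last_id[of v] by (metis diff_Suc_1)
  qed
  moreover have "u = take (length u) b \<and> length u < length t" if "u @ [i] \<in> T" for i
    using that by (auto simp: mem_T)
  ultimately show ?thesis by (auto simp: children_def level_def)
qed

text \<open>The index of \<open>vtx\<close> starts at 1, child positions start at 0.\<close>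

lemma vtx:
  assumes "k < length t" "1 \<le> i" "i \<le> Suc (t ! k)"
  shows "vtx T (Suc k) i = take k b @ [i - 1]"
proof -
  let ?xs = "map (\<lambda>j. take k b @ [j]) [0..<Suc (t ! k)]"
  have "sorted_list_of_set (set ?xs) = ?xs"
  proof (rule sorted_list_of_set.idem_if_sorted_distinct)
    show "sorted ?xs"
      unfolding sorted_iff_nth_mono_less
      by (auto simp: nth_append snoc_less_snoc intro!: less_imp_le simp del: upt_Suc)
  qed (auto simp: distinct_map inj_on_def)
  moreover have "set ?xs = level T (Suc k)"
    using assms(1) by (auto simp: level_Suc simp del: upt_Suc)
  ultimately show ?thesis
    using assms nth_upt[of 0 "i - 1" "Suc (t ! k)"] by (simp add: vtx_def del: upt_Suc)
qed

lemma block_refl: "v \<in> T \<Longrightarrow> v \<in> block T S v"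
  by (auto simp: block_def)

lemma block_subset_level: "block T S v \<subseteq> level T (length v)"
  by (auto simp: block_def level_def)

text \<open>The gaps between two vertices are covered by the gaps from each of them to any third
  vertex, so sharing a block is an equivalence relation.\<close>

lemma block_eq:
  assumes "w \<in> block T S v"
  shows "block T S w = block T S v"
proof -
  have len: "length w = length v" using assms by (simp add: block_def)
  have *: "(length v, p) \<in> S" if "min (last v) (last w) < p" "p \<le> max (last v) (last w)" for p
    using assms that by (auto simp: block_def)
  have "(\<forall>p. min (last v) (last x) < p \<and> p \<le> max (last v) (last x) \<longrightarrow> (length v, p) \<in> S) \<longleftrightarrow>
        (\<forall>p. min (last w) (last x) < p \<and> p \<le> max (last w) (last x) \<longrightarrow> (length v, p) \<in> S)" for x
  proof (intro iffI allI impI)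
    fix p assume a: "\<forall>p. min (last v) (last x) < p \<and> p \<le> max (last v) (last x) \<longrightarrow> (length v, p) \<in> S"
      and p: "min (last w) (last x) < p \<and> p \<le> max (last w) (last x)"
    then show "(length v, p) \<in> S"
      using *[of p] a[rule_format, of p] by linarith
  next
    fix p assume a: "\<forall>p. min (last w) (last x) < p \<and> p \<le> max (last w) (last x) \<longrightarrow> (length v, p) \<in> S"
      and p: "min (last v) (last x) < p \<and> p \<le> max (last v) (last x)"
    then show "(length v, p) \<in> S"
      using *[of p] a[rule_format, of p] by linarith
  qed
  then show ?thesis by (simp add: block_def len)
qed

lemma block_convex:
  assumes "u \<in> block T S v" "w \<in> block T S v" "x \<in> T" "length x = length v"
    "last u \<le> last x" "last x \<le> last w"
  shows "x \<in> block T S v"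
proof -
  have "w \<in> block T S u" using assms block_eq by metis
  then have "x \<in> block T S u" using assms by (auto simp: block_def min_def max_def)
  then show ?thesis using assms block_eq by metis
qed

lemma block_trivial:
  assumes "v \<in> T" "\<And>p. (length v, p) \<notin> S"
  shows "block T S v = {v}"
proof -
  have "w = v" if "w \<in> block T S v" for w
  proof (rule ccontr)
    assume "w \<noteq> v"
    then have "last w \<noteq> last v"
      using that assms(1) vertex_eqI[of w v] by (auto simp: block_def)
    then have "min (last v) (last w) < max (last v) (last w)" by linarith
    then show False using that assms(2) by (auto simp: block_def)
  qed
  then show ?thesis using block_refl[OF assms(1), of S] by auto
qed

lemma block_empty: "v \<in> T \<Longrightarrow> block T {} v = {v}"
  by (rule block_trivial) auto

lemma block_coords:
  assumes "v \<in> T"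
  shows "block T (coords t) v = level T (length v)"
proof -
  have "(length v, p) \<in> coords t"
    if w: "w \<in> T" "length w = length v" "min (last v) (last w) < p" "p \<le> max (last v) (last w)"
    for w p
  proof -
    have "v \<noteq> []" using w by auto
    then have "w \<noteq> []" using w by auto
    then show ?thesis
      using w assms \<open>v \<noteq> []\<close> by (auto simp: coords_def mem_T Suc_le_eq)
  qed
  then show ?thesis by (auto simp: block_def level_def)
qed

text \<open>Recovers \<open>S\<close> from its blocks: the two vertices next to a gap test whether
  the gap belongs to \<open>S\<close>.\<close>

lemma gap_iff:
  assumes "(k, p) \<in> coords t"
  shows "take (k - 1) b @ [p] \<in> T" "take (k - 1) b @ [p - 1] \<in> T"
    "length (take (k - 1) b @ [p]) = k" "length (take (k - 1) b @ [p - 1]) = k"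
    "take (k - 1) b @ [p - 1] \<in> block T S (take (k - 1) b @ [p]) \<longleftrightarrow> (k, p) \<in> S"
proof -
  have k: "k - 1 < length t" "1 \<le> p" "p \<le> t ! (k - 1)" "1 \<le> k"
    using assms by (auto simp: coords_def)
  then show 1: "take (k - 1) b @ [p] \<in> T" "take (k - 1) b @ [p - 1] \<in> T"
    by (auto intro!: node_mem)
  show 2: "length (take (k - 1) b @ [p]) = k" "length (take (k - 1) b @ [p - 1]) = k"
    using k by (auto simp: length_b)
  have "p - 1 < q \<and> q \<le> p \<longleftrightarrow> q = p" for q using k by auto
  then show "take (k - 1) b @ [p - 1] \<in> block T S (take (k - 1) b @ [p]) \<longleftrightarrow> (k, p) \<in> S"
    using 1 2 k by (auto simp: block_def)
qed

lemma block_bracket_empty: "v \<in> T \<Longrightarrow> br {} v = singleton_bracket v"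
  unfolding block_bracket_def singleton_bracket_def by (simp add: block_empty take_mem)

lemma block_bracket_coords: "v \<in> T \<Longrightarrow> br (coords t) v = max_bracket T (length v)"
  unfolding block_bracket_def max_bracket_def
  by (auto simp: block_coords take_mem min_def)

lemma is_singleton_bracket_iff: "is_singleton_bracket T A \<longleftrightarrow> A \<in> br {} ` T"
  by (auto simp: is_singleton_bracket_def block_bracket_empty)

lemma is_max_bracket_iff:
  "(\<exists>k\<le>length t. A = max_bracket T k) \<longleftrightarrow> A \<in> br (coords t) ` T"
proof
  assume "\<exists>k\<le>length t. A = max_bracket T k"
  then obtain k where "k \<le> length t" "A = max_bracket T k" by blast
  then show "A \<in> br (coords t) ` T"
    using stem_mem[of k] block_bracket_coords[of "take k b"] by (intro image_eqI[of _ _ "take k b"]) (auto simp: length_b)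
qed (use block_bracket_coords length_le in blast)

text \<open>Two vertices of one level have the same proper prefixes, so the brackets can differ only
  in the top block. Any vertex of the top block may thus serve as base point.\<close>

lemma block_bracket_eq:
  assumes "v \<in> T" "w \<in> block T S v"
  shows "br S w = br S v"
proof -
  have w: "w \<in> T" "length w = length v" using assms(2) by (auto simp: block_def)
  show ?thesis
  proof (rule nth_equalityI)
    fix i assume "i < length (br S w)"
    then have "i \<le> length v" by (simp add: length_block_bracket w)
    then show "br S w ! i = br S v ! i"
      using w assms take_vertex[of v i] take_vertex[of w i] block_eq[OF assms(2)]
      by (cases "i = length v") (auto simp: nth_block_bracket)
  qed (simp add: length_block_bracket w)
qed

text \<open>The common parent of the vertices on level \<open>i\<close> is the prefix of
  \<open>v\<close> of length \<open>i - 1\<close>, which lies in its own block; consecutiveness is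
  convexity of blocks.\<close>

lemma is_bracket_block_bracket:
  assumes "v \<in> T"
  shows "is_bracket T (length v) (br S v)"
  unfolding is_bracket_def
proof (intro conjI allI impI ballI)
  show "br S v ! i \<subseteq> level T i" if "i \<le> length v" for i
    using that block_subset_level[of S "take i v"] by (simp add: nth_block_bracket min.absorb2)
  show "br S v ! length v \<noteq> {}"
    using block_refl[OF assms] by (auto simp: nth_block_bracket)
  fix i assume i: "i \<in> {1..length v}"
  have stem_in: "take (i - 1) b \<in> br S v ! (i - 1)"
  proof -
    have "take (i - 1) v = take (i - 1) b" using i assms by (intro take_vertex) auto
    moreover have "i - 1 \<le> length v" using i unfolding atLeastAtMost_iff by linarith
    ultimately show ?thesis
      using block_refl[OF take_mem[OF assms], of "i - 1" S]
        nth_block_bracket[of "i - 1" v T S] by simp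
  qed
  have mem: "u \<in> T" "length u = i" if "u \<in> br S v ! i" for u
    using that i by (auto simp: nth_block_bracket block_def)
  show "butlast u \<in> br S v ! (i - 1)" if "u \<in> br S v ! i" for u
    using mem[OF that] stem_in i butlast_vertex[of u] by (cases "u = []") auto
  show "consecutive_in (br S v ! i \<inter> children T u) (children T u)" for u
    unfolding consecutive_in_def
  proof (intro conjI ballI impI)
    fix x y z assume x: "x \<in> br S v ! i \<inter> children T u"
      and y: "y \<in> br S v ! i \<inter> children T u"
      and z: "z \<in> children T u" "x < z \<and> z < y"
    have "z \<in> T" "length z = i"
      using z x mem(2)[of x] by (auto simp: children_def)
    moreover have "x \<in> block T S (take i v)" "y \<in> block T S (take i v)"
      using x y i by (auto simp: nth_block_bracket)
    moreover have "last x < last z" "last z < last y"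
      using less_iff[of x z] less_iff[of z y] x y z(2) mem \<open>z \<in> T\<close> \<open>length z = i\<close> by simp_all
    ultimately have "z \<in> block T S (take i v)"
      using i by (intro block_convex[of x S "take i v" y z]) auto
    then show "z \<in> br S v ! i \<inter> children T u"
      using z(1) i by (simp add: nth_block_bracket)
  qed auto
qed (simp add: length_block_bracket)

text \<open>All vertices of a level have the same parent, so (5b) and (5c) leave no choice for the order.\<close>

lemma bracketing_order:
  assumes "is_bracketing T B r"
  shows "r = block_order B"
proof -
  note ax = is_bracketingD[OF assms, unfolded depth]
  have brk: "\<exists>k\<le>length t. is_bracket T k A" if "A \<in> B" for A
    using ax(1) that by blast
  note rB = ax(2) and irr = ax(3) and tr = ax(4)
  have sing: "singleton_bracket u \<in> B" if "u \<in> T" for u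
    using ax(6) that by blast
  have down: "butlast A \<in> bracket_level B (k - 1)"
    if "k \<in> {1..length t}" "A \<in> bracket_level B k" for k A
    using ax(7) that by blast
  note ax5a = ax(11)[rule_format] and ax5b = ax(12)[rule_format]
  have ax5c: "(A1, A2) \<in> r \<longleftrightarrow> (A1', A2') \<in> r"
    if "k \<in> {1..length t}" "A \<in> bracket_level B (k - 1)" "A' \<in> bracket_level B (k - 1)"
      "bracket_le A' A" "A1 \<in> brackets_over B A" "A2 \<in> brackets_over B A"
      "A1' \<in> brackets_over B A'" "A2' \<in> brackets_over B A'" "A1 \<noteq> A2" "comparable r A1 A2"
      "A1' \<noteq> A2'" "comparable r A1' A2'" "bracket_le A1' A1" "bracket_le A2' A2"
    for k A A' A1 A2 A1' A2'
    using ax(13)[rule_format, of k A A' A1 A2 A1' A2'] that by blast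
  \<comment> \<open>Closure under parents puts all ancestors of \<open>u\<close> into
    \<open>A\<close>. Singleton brackets can therefore play the role of the smaller pair in
    (5c).\<close>
  have below: "bracket_le (singleton_bracket u) A"
    if A: "is_bracket T k A" and u: "u \<in> last A" for k A u
  proof -
    have len: "length A = Suc k" and par: "\<And>i x. i \<in> {1..k} \<Longrightarrow> x \<in> A ! i \<Longrightarrow> butlast x \<in> A ! (i - 1)"
      and lev: "\<And>i. i \<le> k \<Longrightarrow> A ! i \<subseteq> level T i"
      using A by (auto simp: is_bracket_def)
    have uk: "u \<in> A ! k" using u is_bracket_last(3)[OF A] by simp
    then have lu: "length u = k" using lev[of k] by (auto simp: level_def)
    have "take (k - j) u \<in> A ! (k - j)" if "j \<le> k" for j
      using that
    proof (induction j)
      case (Suc j)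
      then have "butlast (take (k - j) u) \<in> A ! (k - j - 1)"
        by (intro par) auto
      then show ?case using Suc.prems lu by (simp add: butlast_take)
    qed (use uk lu in simp)
    then have "take i u \<in> A ! i" if "i \<le> k" for i
      using that by (metis diff_diff_cancel diff_le_self)
    then show ?thesis
      by (simp add: bracket_le_def singleton_bracket_def lu len less_Suc_eq_le del: upt_Suc)
  qed
  have main: "u < v" if AA: "(A, A') \<in> r" and u: "u \<in> last A" and v: "v \<in> last A'" for A A' u v
  proof (rule ccontr)
    assume "\<not> u < v"
    have AB: "A \<in> B" "A' \<in> B" using rB AA by auto
    have "A \<noteq> A'" using AA irr by (auto simp: irrefl_def)
    have cmp: "comparable r A A'" using AA by (simp add: comparable_def)
    then have eq: "length A = length A'" "butlast A = butlast A'" "last A \<inter> last A' = {}"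
      using ax5a[OF AB \<open>A \<noteq> A'\<close>] by auto
    obtain k where k: "k \<le> length t" "is_bracket T k A" using brk[OF AB(1)] by blast
    obtain k' where k': "k' \<le> length t" "is_bracket T k' A'" using brk[OF AB(2)] by blast
    have lenA: "length A = Suc k" "length A' = Suc k'" using k k' by (auto simp: is_bracket_def)
    then have kk: "k' = k" using eq by simp
    have uT: "u \<in> level T k" and vT: "v \<in> level T k"
      using u v is_bracket_last(5)[OF k(2)] is_bracket_last(5)[OF k'(2)] kk by auto
    have "k \<noteq> 0"
    proof
      assume "k = 0"
      then show False using uT vT level_0 eq(3) u v by auto
    qed
    then obtain m where m: "k = Suc m" by (cases k) auto
    have "u \<noteq> v" using eq(3) u v by auto
    then have "v < u" using \<open>\<not> u < v\<close> by simp
    have ch: "u \<in> children T (take m b)" "v \<in> children T (take m b)"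
      using uT vT k m by (auto simp: children length_b)
    have s: "take m b \<in> T" using k m by (intro stem_mem) simp
    have vu: "(singleton_bracket v, singleton_bracket u) \<in> r"
      by (rule ax5b[OF s ch(2,1) \<open>v < u\<close>])
    have but: "butlast (singleton_bracket x) = singleton_bracket (take m b)" if "x \<in> level T k" for x
    proof -
      have "x \<in> T" "length x = k" "x \<noteq> []" using that m by (auto simp: level_def)
      then show ?thesis
        using butlast_block_bracket[of x T "{}"] butlast_vertex[of x] s m
        by (simp add: block_bracket_empty)
    qed
    have lens: "length (singleton_bracket x) = Suc (length x)" for x
      by (simp add: singleton_bracket_def)
    have uv: "u \<in> T" "v \<in> T" "length u = k" "length v = k" using uT vT by (auto simp: level_def)
    \<comment> \<open>(5c) compares \<open>A\<close>, \<open>A'\<close> with the singletons of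
      \<open>u\<close>, \<open>v\<close>. By (5b) and \<open>v < u\<close> the singletons are
      ordered the other way round, so transitivity would relate a bracket to itself.\<close>
    have "(A, A') \<in> r \<longleftrightarrow> (singleton_bracket u, singleton_bracket v) \<in> r"
    proof (rule ax5c)
      show "k \<in> {1..length t}" using k m by auto
      show "butlast A \<in> bracket_level B (k - 1)"
        using AB(1) lenA by (intro down) (use k m in \<open>auto simp: bracket_level_def\<close>)
      show "singleton_bracket (take m b) \<in> bracket_level B (k - 1)"
        using sing[OF s] m k by (auto simp: bracket_level_def lens length_b)
      have "take m b \<in> last (butlast A)"
      proof -
        have "butlast u \<in> A ! m"
        proof -
          have "\<forall>i\<in>{1..k}. \<forall>u\<in>A ! i. butlast u \<in> A ! (i - 1)"
            using k(2) unfolding is_bracket_def by blast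
          from this[rule_format, of k u] show ?thesis using u is_bracket_last(3)[OF k(2)] m by simp
        qed
        moreover have "butlast u = take m b"
          using uv m butlast_vertex[of u] by (cases "u = []") auto
        moreover have "last (butlast A) = A ! m"
        proof -
          have "length (butlast A) = Suc m" using lenA m by simp
          then have "last (butlast A) = butlast A ! m" using last_conv_nth[of "butlast A"] by fastforce
          then show ?thesis using lenA m by (simp add: nth_butlast)
        qed
        ultimately show ?thesis by simp
      qed
      moreover have "\<exists>k\<le>length t. is_bracket T k (butlast A)"
        using down[of k A] AB(1) lenA k m by (intro brk) (auto simp: bracket_level_def)
      ultimately show "bracket_le (singleton_bracket (take m b)) (butlast A)"
      proof -
        assume 1: "take m b \<in> last (butlast A)" and "\<exists>k\<le>length t. is_bracket T k (butlast A)"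
        then obtain k'' where "is_bracket T k'' (butlast A)" by blast
        then show ?thesis using below[OF _ 1] by simp
      qed
      show "A \<in> brackets_over B (butlast A)" "A' \<in> brackets_over B (butlast A)"
        using AB lenA eq m kk by (auto simp: brackets_over_def)
      show "singleton_bracket u \<in> brackets_over B (singleton_bracket (take m b))"
        "singleton_bracket v \<in> brackets_over B (singleton_bracket (take m b))"
        using sing uv but uT vT m k by (auto simp: brackets_over_def lens length_b)
      show "singleton_bracket u \<noteq> singleton_bracket v"
      proof
        assume "singleton_bracket u = singleton_bracket v"
        then show False using vu irreflD[OF irr, of "singleton_bracket v"] by simp
      qed
      show "comparable r (singleton_bracket u) (singleton_bracket v)"
        using vu by (simp add: comparable_def)
      show "bracket_le (singleton_bracket u) A" "bracket_le (singleton_bracket v) A'"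
        using below[OF k(2) u] below[OF k'(2) v] by simp_all
    qed fact+
    then have "(singleton_bracket v, singleton_bracket v) \<in> r"
      using AA transD[OF tr vu] by simp
    then show False using irr by (simp add: irreflD)
  qed
  show ?thesis
  proof
    show "r \<subseteq> block_order B"
    proof clarify
      fix A A' assume AA: "(A, A') \<in> r"
      then have AB: "A \<in> B" "A' \<in> B" "A \<noteq> A'" using rB irr by (auto simp: irrefl_def)
      then have "butlast A = butlast A'"
        using ax5a[of A A'] AA by (auto simp: comparable_def)
      then show "(A, A') \<in> block_order B"
        using AB main[OF AA] by (auto simp: block_order_def)
    qed
    show "block_order B \<subseteq> r"
    proof clarify
      fix A A' assume AA: "(A, A') \<in> block_order B"
      then have AB: "A \<in> B" "A' \<in> B" "butlast A = butlast A'"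
        and less: "\<And>u v. u \<in> last A \<Longrightarrow> v \<in> last A' \<Longrightarrow> u < v"
        by (auto simp: block_order_def)
      have ne: "A \<noteq> [] \<and> last A \<noteq> {}" if "A \<in> B" for A
        using brk[OF that] is_bracket_last by blast
      have "last A \<inter> last A' = {}" using less by blast
      moreover have "length A = length A'"
        using length_eqI_butlast[OF _ _ AB(3)] ne[OF AB(1)] ne[OF AB(2)] by simp
      moreover have "A \<noteq> A'" using ne[OF AB(1)] \<open>last A \<inter> last A' = {}\<close> by auto
      ultimately have "comparable r A A'" using ax5a[OF AB(1,2)] AB(3) by blast
      moreover have False if "(A', A) \<in> r"
      proof -
        obtain u v where u: "u \<in> last A" and v: "v \<in> last A'" using ne[OF AB(1)] ne[OF AB(2)] by blast
        show False using main[OF that v u] less[OF u v] by (rule less_asym)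
      qed
      ultimately show "(A, A') \<in> r" unfolding comparable_def by blast
    qed
  qed
qed

end

text \<open>Intended for chains of gap sets, whose blocks form nested partitions of every level, as
  (3) requires. For collisions the chain is the empty set, \<open>S\<close> and all gaps, giving the
  singleton, block and maximum brackets.\<close>

definition chain_brackets :: "tree \<Rightarrow> (nat \<times> nat) set set \<Rightarrow> bracket set" where
  "chain_brackets T \<R> = (\<Union>R\<in>\<R>. block_bracket T R ` T)"

lemma block_bracket_not_Nil [simp]: "block_bracket T S v \<noteq> []"
  by (simp add: block_bracket_def)

context stem
begin

text \<open>Brackets that meet in \<open>u\<close> can both be based at \<open>u\<close>, where
  comparable gap sets give comparable brackets. Covering holds because each vertex lies in its own
  block, and the order axioms hold because blocks are intervals.\<close>

lemma is_bracketing_chain_brackets: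
  assumes chain: "\<And>R S. R \<in> \<R> \<Longrightarrow> S \<in> \<R> \<Longrightarrow> R \<subseteq> S \<or> S \<subseteq> R"
    and bounds: "{} \<in> \<R>" "coords t \<in> \<R>"
  shows "is_bracketing T (chain_brackets T \<R>) (block_order (chain_brackets T \<R>))"
proof -
  define B where "B = chain_brackets T \<R>"
  have B_iff: "A \<in> B \<longleftrightarrow> (\<exists>R\<in>\<R>. \<exists>v\<in>T. A = br R v)" for A
    by (auto simp: B_def chain_brackets_def)
  have last_refl: "v \<in> last (br R v)" if "v \<in> T" for v R
    using that by (simp add: last_block_bracket block_refl)
  have in_last: "u \<in> T" "length u = length v" "br R u = br R v"
    if "v \<in> T" "u \<in> last (br R v)" for u v R
    using that block_bracket_eq[of v u R] by (auto simp: last_block_bracket block_def)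
  have over: "\<exists>R\<in>\<R>. \<exists>v\<in>T. v \<noteq> [] \<and> A = br R v \<and> X = br R (take (length v - 1) b) \<and> length X = length v"
    if "A \<in> brackets_over B X" "X \<noteq> []" for A X
  proof -
    have X: "A \<in> B" "length A = Suc (length X)" "X = butlast A"
      using that(1) by (auto simp: brackets_over_def)
    then obtain R v where Rv: "R \<in> \<R>" "v \<in> T" "A = br R v"
      by (auto simp: B_iff)
    have "v \<noteq> []" using X(2) Rv(3) that(2) by (auto simp: length_block_bracket)
    then have "X = br R (take (length v - 1) b)"
      using Rv X butlast_vertex[of v] by (simp add: butlast_block_bracket)
    then show ?thesis using Rv X \<open>v \<noteq> []\<close> by (auto simp: length_block_bracket)
  qed
  have overI: "br R u \<in> brackets_over B (br R (take (length u - 1) b))"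
    if "R \<in> \<R>" "u \<in> T" "u \<noteq> []" for R u
    using that butlast_vertex[of u] length_le[of u]
    by (auto simp: brackets_over_def B_iff butlast_block_bracket length_block_bracket length_b
        simp flip: length_greater_0_conv)
  have nest: "bracket_le (br R v) (br S w) \<or> bracket_le (br S w) (br R v)"
    if "R \<in> \<R>" "S \<in> \<R>" "v \<in> T" "w \<in> T" "u \<in> last (br R v)" "u \<in> last (br S w)" for R S u v w
    using in_last(3)[OF that(3,5)] in_last(3)[OF that(4,6)] chain[OF that(1,2)]
      bracket_le_block_bracket[of R S T u] bracket_le_block_bracket[of S R T u] by auto
  have level_k: "\<exists>R\<in>\<R>. \<exists>v\<in>T. length v = k \<and> A = br R v" if "A \<in> bracket_level B k" for A k
  proof -
    obtain R v where "R \<in> \<R>" "v \<in> T" "A = br R v" "length A = Suc k"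
      using \<open>A \<in> bracket_level B k\<close> by (auto simp: bracket_level_def B_iff)
    then show ?thesis by (metis length_block_bracket nat.inject)
  qed
  show ?thesis
    unfolding B_def[symmetric] is_bracketing_def depth
  proof (intro conjI ballI allI impI)
    show "\<exists>k\<le>length t. is_bracket T k A" if "A \<in> B" for A
      using that is_bracket_block_bracket length_le unfolding B_iff by blast
    have ne: "last A \<noteq> {} \<and> A \<noteq> []" if "A \<in> B" for A
    proof -
      obtain R v where "v \<in> T" "A = br R v" using \<open>A \<in> B\<close> by (auto simp: B_iff)
      then show ?thesis using last_refl[of v R] length_block_bracket[of T R v] by auto
    qed
    show "block_order B \<subseteq> B \<times> B" by (auto simp: block_order_def)
    show "irrefl (block_order B)"
    proof (rule irreflI)
      fix A show "(A, A) \<notin> block_order B"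
        using ne[of A] by (auto simp: block_order_def)
    qed
    show "trans (block_order B)"
    proof (rule transI)
      fix A1 A2 A3 assume 12: "(A1, A2) \<in> block_order B" and 23: "(A2, A3) \<in> block_order B"
      then have "A2 \<in> B" by (auto simp: block_order_def)
      then obtain x where "x \<in> last A2" using ne by blast
      then show "(A1, A3) \<in> block_order B"
        using 12 23 by (auto simp: block_order_def intro: less_trans)
    qed
    show "max_bracket T k \<in> B" if "k \<le> length t" for k
      using that bounds(2) is_max_bracket_iff[of "max_bracket T k"] unfolding B_iff by blast
    show "singleton_bracket u \<in> B" if "u \<in> T" for u
      using that bounds(1) block_bracket_empty[OF that] unfolding B_iff by metis
    show "butlast A \<in> bracket_level B (k - 1)"
      if k: "k \<in> {1..length t}" and A: "A \<in> bracket_level B k" for k A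
    proof -
      obtain R v where Rv: "R \<in> \<R>" "v \<in> T" "length v = k" "A = br R v" using level_k[OF A] by blast
      then have "v \<noteq> []" using k by auto
      then have "butlast A = br R (take (k - 1) b)" "take (k - 1) b \<in> T" "length (take (k - 1) b) = k - 1"
        using Rv k butlast_vertex[of v] stem_mem[of "k - 1"] by (auto simp: butlast_block_bracket length_b)
      then show ?thesis using Rv(1) by (auto simp: bracket_level_def B_iff length_block_bracket)
    qed
    show "bracket_le A1 A2 \<or> bracket_le A2 A1"
      if "A1 \<in> bracket_level B k" "A2 \<in> bracket_level B k" "last A1 \<inter> last A2 \<noteq> {}" for k A1 A2
      using level_k[OF that(1)] level_k[OF that(2)] that(3) nest by (metis disjoint_iff)
    show "(\<Union>A'\<in>brackets_over B A. last A') = (\<Union>u\<in>last A. children T u)"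
      if k: "k \<in> {1..length t}" and A: "A \<in> bracket_level B (k - 1)" for k A
    proof -
      obtain R v where Rv: "R \<in> \<R>" "v \<in> T" "length v = k - 1" "A = br R v" using level_k[OF A] by blast
      have An: "A \<noteq> []" "length A = k" using Rv k by (auto simp: length_block_bracket simp flip: length_0_conv)
      have kb: "length (take (k - 1) b) = k - 1" "take (k - 1) b \<in> T"
        using k stem_mem[of "k - 1"] by (auto simp: length_b)
      show ?thesis
      proof (intro equalityI subsetI)
        fix x assume "x \<in> (\<Union>A'\<in>brackets_over B A. last A')"
        then obtain A' where A': "A' \<in> brackets_over B A" "x \<in> last A'" by blast
        obtain S w where Sw: "w \<in> T" "w \<noteq> []" "A' = br S w" "A = br S (take (length w - 1) b)"
          "length A = length w"
          using over[OF A'(1) An(1)] by blast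
        have "x \<in> level T k" using in_last[OF Sw(1), of x S] A' Sw An by (auto simp: level_def)
        moreover have "take (k - 1) b \<in> last A"
          using last_refl[OF kb(2), of S] Sw An by simp
        ultimately show "x \<in> (\<Union>u\<in>last A. children T u)"
          using k kb by (auto simp: children intro!: bexI[of _ "take (k - 1) b"])
      next
        fix x assume "x \<in> (\<Union>u\<in>last A. children T u)"
        then obtain u where u: "u \<in> last A" "x \<in> children T u" by blast
        have "length u = k - 1" using in_last(2)[OF Rv(2), of u R] u Rv by simp
        then have x: "x \<in> T" "length x = k" and ub: "u = take (k - 1) b"
          using u(2) k by (auto simp: children level_def split: if_splits)
        then have "x \<noteq> []" using k by auto
        have "A = br R (take (k - 1) b)" using in_last(3)[OF Rv(2), of u R] u ub Rv by simp
        then have "br R x \<in> brackets_over B A" using overI[OF Rv(1) x(1) \<open>x \<noteq> []\<close>] x by simp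
        then show "x \<in> (\<Union>A'\<in>brackets_over B A. last A')" using last_refl[OF x(1)] by blast
      qed
    qed
    show "\<exists>A3\<in>brackets_over B A. bracket_less A3 A1 \<and> u \<in> last A3"
      if k: "k \<in> {1..length t}" and A: "A \<in> bracket_level B (k - 1)" and A1: "A1 \<in> brackets_over B A"
        and A2: "A2 \<in> brackets_over B A" and less: "bracket_less A2 A1" and u: "u \<in> last A1"
      for k A A1 A2 u
    proof -
      have An: "A \<noteq> []" using A by (auto simp: bracket_level_def)
      obtain R v where Rv: "R \<in> \<R>" "v \<in> T" "v \<noteq> []" "A1 = br R v" "length A = length v"
        using over[OF A1 An] by blast
      obtain S w where Sw: "S \<in> \<R>" "w \<in> T" "w \<noteq> []" "A2 = br S w" "length A = length w"
        "A = br S (take (length w - 1) b)"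
        using over[OF A2 An] by blast
      have le: "bracket_le A2 A1" "A2 \<noteq> A1" using less by (auto simp: bracket_less_def)
      have w: "w \<in> last A2" using Sw last_refl by simp
      then have w1: "w \<in> last A1"
        using bracket_le_last[OF le(1)] Sw length_block_bracket[of T S w] by auto
      have A1w: "A1 = br R w" using in_last(3)[OF Rv(2), of w R] Rv w1 by simp
      have A1u: "A1 = br R u" "u \<in> T" "length u = length w"
        using in_last[OF Rv(2), of u R] Rv u Sw by auto
      have "\<not> R \<subseteq> S"
        using bracket_le_block_bracket[of R S T w] A1w Sw(4) le bracket_le_antisym by auto
      then have "S \<subseteq> R" using chain Rv Sw by blast
      \<comment> \<open>For (4b) the finer bracket \<open>A2\<close> shows that \<open>S\<close>
        cuts \<open>A1\<close>, and then it does so around every \<open>u\<close>: if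
        \<open>br S u\<close> were all of \<open>A1\<close>, it would contain \<open>w\<close> and
        coincide with \<open>br S w\<close>, which is \<open>A2\<close>.\<close>
      have "br S u \<noteq> A1"
      proof
        assume "br S u = A1"
        then have "w \<in> last (br S u)" using w1 by simp
        then have "br S w = br S u" using in_last(3)[OF A1u(2)] by blast
        then show False using \<open>br S u = A1\<close> le Sw by simp
      qed
      then have "bracket_less (br S u) A1"
        using bracket_le_block_bracket[OF \<open>S \<subseteq> R\<close>, of T u] A1u by (simp add: bracket_less_def)
      moreover have "u \<noteq> []" using A1u Sw by auto
      then have "br S u \<in> brackets_over B A"
        using overI[OF Sw(1) A1u(2)] Sw A1u by simp
      ultimately show ?thesis using last_refl[OF A1u(2)] by blast
    qed
    have dich: "(A, A') \<in> block_order B \<or> (A', A) \<in> block_order B"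
      if "A \<in> B" "A' \<in> B" "length A = length A'" "butlast A = butlast A'" "last A \<inter> last A' = {}"
      for A A'
    proof -
      obtain R v where Rv: "R \<in> \<R>" "v \<in> T" "A = br R v" using \<open>A \<in> B\<close> by (auto simp: B_iff)
      obtain S w where Sw: "S \<in> \<R>" "w \<in> T" "A' = br S w" using \<open>A' \<in> B\<close> by (auto simp: B_iff)
      have len: "length w = length v" using that Rv Sw by (simp add: length_block_bracket)
      have disj: "block T R v \<inter> block T S w = {}" using that Rv Sw by (simp add: last_block_bracket)
      have "v \<noteq> w" using disj Rv Sw block_refl by blast
      then have vw: "last v \<noteq> last w" using Rv Sw len vertex_eqI by metis
      \<comment> \<open>Disjoint intervals are ordered like their base points; a violation would, by
        convexity, give a common vertex. The gap sets and base points are quantified anew so that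
        the roles can be exchanged.\<close>
      have key: "x < y"
        if lt: "last v < last w" and RS: "block T R v \<inter> block T S w = {}" "v \<in> T" "w \<in> T" "length w = length v"
          and x: "x \<in> block T R v" and y: "y \<in> block T S w" for R S x y v w
      proof -
        have xy: "x \<in> T" "y \<in> T" "length x = length v" "length y = length v"
          using x y RS by (auto simp: block_def)
        have 1: "last x < last w"
        proof (rule ccontr)
          assume "\<not> last x < last w"
          then have "w \<in> block T R v"
            using block_convex[OF block_refl[OF RS(2), of R] x RS(3)] lt RS by simp
          then show False using RS block_refl by blast
        qed
        have "last x < last y"
        proof (rule ccontr)
          assume "\<not> last x < last y"
          then have "x \<in> block T S w"
            using block_convex[OF y block_refl[OF RS(3), of S] xy(1)] 1 RS xy by simp
          then show False using RS x by blast
        qed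
        then show ?thesis using xy less_iff by simp
      qed
      show ?thesis
      proof (cases "last v < last w")
        case True
        then show ?thesis
          using key[OF True disj Rv(2) Sw(2) len] that Rv Sw by (auto simp: block_order_def last_block_bracket)
      next
        case False
        then have "last w < last v" using vw by simp
        moreover have "block T S w \<inter> block T R v = {}" using disj by blast
        ultimately show ?thesis
          using key[OF _ _ Sw(2) Rv(2)] len that Rv Sw by (auto simp: block_order_def last_block_bracket)
      qed
    qed
    have ordD: "length A = length A' \<and> butlast A = butlast A' \<and> last A \<inter> last A' = {}"
      if "(A, A') \<in> block_order B" for A A'
    proof -
      have "A \<in> B" "A' \<in> B" "butlast A = butlast A'" using that by (auto simp: block_order_def)
      then have "length A = length A'"
        using ne[of A] ne[of A'] length_eqI_butlast[of A A'] by simp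
      then show ?thesis using that by (auto simp: block_order_def)
    qed
    show "comparable (block_order B) A A' \<longleftrightarrow>
        length A = length A' \<and> butlast A = butlast A' \<and> last A \<inter> last A' = {}"
      if "A \<in> B" "A' \<in> B" "A \<noteq> A'" for A A'
      using ordD[of A A'] ordD[of A' A] dich[of A A'] that unfolding comparable_def by auto
    show "(singleton_bracket u1, singleton_bracket u2) \<in> block_order B"
      if "u \<in> T" "u1 \<in> children T u" "u2 \<in> children T u" "u1 < u2" for u u1 u2
    proof -
      have uT: "u1 \<in> T" "u2 \<in> T" "u1 \<noteq> []" "u2 \<noteq> []" "butlast u1 = u" "butlast u2 = u"
        using that by (auto simp: children_def)
      have "br {} u1 \<in> B" "br {} u2 \<in> B" using uT bounds by (auto simp: B_iff)
      moreover have "butlast (br {} u1) = butlast (br {} u2)" using uT by (simp add: butlast_block_bracket)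
      ultimately have "(br {} u1, br {} u2) \<in> block_order B"
        using uT that(4) by (simp add: block_order_def last_block_bracket block_empty)
      then show ?thesis using uT by (simp add: block_bracket_empty)
    qed
    show "(A1, A2) \<in> block_order B \<longleftrightarrow> (A1', A2') \<in> block_order B"
      if "A1 \<in> brackets_over B A" "A2 \<in> brackets_over B A" "A1' \<in> brackets_over B A'"
        "A2' \<in> brackets_over B A'" and
        c: "A1 \<noteq> A2 \<and> comparable (block_order B) A1 A2 \<and> A1' \<noteq> A2' \<and> comparable (block_order B) A1' A2' \<and>
           bracket_le A1' A1 \<and> bracket_le A2' A2"
      for A A' A1 A2 A1' A2'
    proof -
      have AB: "A1 \<in> B" "A2 \<in> B" "A1' \<in> B" "A2' \<in> B" using that by (auto simp: brackets_over_def)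
      obtain x where x: "x \<in> last A1'" using ne[OF AB(3)] by blast
      obtain y where y: "y \<in> last A2'" using ne[OF AB(4)] by blast
      have xy: "x \<in> last A1" "y \<in> last A2"
        using x y c bracket_le_last[of A1' A1] bracket_le_last[of A2' A2] ne[OF AB(3)] ne[OF AB(4)] by auto
      have less: "(C, C') \<in> block_order B \<longleftrightarrow> u < v"
        if "comparable (block_order B) C C'" "u \<in> last C" "v \<in> last C'" for C C' u v
      proof
        show "(C, C') \<in> block_order B \<Longrightarrow> u < v" using that by (simp add: block_order_def)
        assume "u < v"
        then have "(C', C) \<notin> block_order B" using that less_asym[of u v] by (auto simp: block_order_def)
        then show "(C, C') \<in> block_order B" using that(1) by (simp add: comparable_def)
      qed
      show ?thesis using less[of A1 A2 x y] less[of A1' A2' x y] c x y xy by simp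
    qed
  qed
qed

end

section \<open>Bracketings contain block brackets\<close>

lemma eqI_butlast_last:
  "A \<noteq> [] \<Longrightarrow> A' \<noteq> [] \<Longrightarrow> butlast A = butlast A' \<Longrightarrow> last A = last A' \<Longrightarrow> A = A'"
  by (cases A rule: rev_cases; cases A' rule: rev_cases) auto

context stem
begin

lemma block_cong:
  assumes "\<And>p. (length v, p) \<in> S \<longleftrightarrow> (length v, p) \<in> S'"
  shows "block T S v = block T S' v"
  using assms by (simp add: block_def)

lemma block_bracket_cong:
  assumes "\<And>k p. k \<le> length v \<Longrightarrow> (k, p) \<in> S \<longleftrightarrow> (k, p) \<in> S'"
  shows "br S v = br S' v"
proof -
  have "block T S (take i v) = block T S' (take i v)" if "i \<le> length v" for i
    using assms[of "length (take i v)"] by (intro block_cong) simp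
  then show ?thesis unfolding block_bracket_def by (intro map_cong refl) auto
qed

text \<open>Both brackets have the same top block, so the first can be rebased at \<open>v\<close>.
  Equalities between brackets of different gap sets are thereby reduced to a common base
  point.\<close>

lemma block_bracket_eqI:
  assumes "br R u = br S v" "u \<in> T" "v \<in> T"
  shows "br R v = br S v"
proof -
  have "block T R u = block T S v"
    using arg_cong[OF assms(1), of last] by (simp add: last_block_bracket)
  then have "v \<in> block T R u" using block_refl[OF assms(3), of S] by simp
  then show ?thesis using block_bracket_eq[OF assms(2)] assms(1) by simp
qed

lemma block_bracket_singleton_iff:
  assumes "v \<in> T"
  shows "br S v = br {} v \<longleftrightarrow>
    (\<forall>i\<le>length v. block T S (take i v) = {take i v})"
proof
  assume eq: "br S v = br {} v"
  show "\<forall>i\<le>length v. block T S (take i v) = {take i v}"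
  proof (intro allI impI)
    fix i assume "i \<le> length v"
    then show "block T S (take i v) = {take i v}"
      using arg_cong[OF eq, of "\<lambda>A. A ! i"] block_empty[OF take_mem[OF assms]]
      by (simp add: nth_block_bracket)
  qed
next
  assume "\<forall>i\<le>length v. block T S (take i v) = {take i v}"
  then show "br S v = br {} v"
    using block_empty[OF take_mem[OF assms]] unfolding block_bracket_def
    by (intro map_cong refl) auto
qed

lemma level_eq: "1 \<le> k \<Longrightarrow> k \<le> length t \<Longrightarrow> level T k = (\<lambda>j. take (k - 1) b @ [j]) ` {..t ! (k - 1)}"
  using level_Suc[of "k - 1"] by simp

lemma level_nodeE:
  assumes "v \<in> level T k" "1 \<le> k" "k \<le> length t"
  shows "v = take (k - 1) b @ [last v]" "last v \<le> t ! (k - 1)"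
proof -
  obtain j where "v = take (k - 1) b @ [j]" "j \<le> t ! (k - 1)"
    using assms level_eq[of k] by auto
  then show "v = take (k - 1) b @ [last v]" "last v \<le> t ! (k - 1)" by simp_all
qed

lemma node_level:
  "1 \<le> k \<Longrightarrow> k \<le> length t \<Longrightarrow> j \<le> t ! (k - 1) \<Longrightarrow> take (k - 1) b @ [j] \<in> level T k"
  by (simp add: level_eq)

text \<open>A partition of a level into intervals is determined by the gaps that it does not cut;
  \<open>f v\<close> is the part containing \<open>v\<close>.\<close>

lemma block_of_partition:
  fixes f :: "vertex \<Rightarrow> vertex set"
  assumes k: "1 \<le> k" "k \<le> length t"
    and refl: "\<And>v. v \<in> level T k \<Longrightarrow> v \<in> f v"
    and eq: "\<And>v w. v \<in> level T k \<Longrightarrow> w \<in> f v \<Longrightarrow> w \<in> level T k \<and> f w = f v"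
    and convex: "\<And>v u w x. v \<in> level T k \<Longrightarrow> u \<in> f v \<Longrightarrow> w \<in> f v \<Longrightarrow> x \<in> level T k \<Longrightarrow>
      last u \<le> last x \<Longrightarrow> last x \<le> last w \<Longrightarrow> x \<in> f v"
    and S: "\<And>p. (k, p) \<in> S \<longleftrightarrow>
      (k, p) \<in> coords t \<and> f (take (k - 1) b @ [p - 1]) = f (take (k - 1) b @ [p])"
    and v: "v \<in> level T k"
  shows "block T S v = f v"
proof -
  let ?nd = "\<lambda>j. take (k - 1) b @ [j]"
  have len: "length x = k" "x \<in> T" if "x \<in> level T k" for x using that by (auto simp: level_def)
  have chain: "f (?nd i) = f (?nd j)"
    if "i \<le> j" "j \<le> t ! (k - 1)" "\<And>p. i < p \<Longrightarrow> p \<le> j \<Longrightarrow> (k, p) \<in> S" for i j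
    using that
  proof (induction j rule: dec_induct)
    case (step m)
    have "f (?nd i) = f (?nd m)" using step by simp
    also have "\<dots> = f (?nd (Suc m))"
      using step.prems(2)[of "Suc m"] step.hyps by (simp add: S)
    finally show ?case .
  qed simp
  show ?thesis
  proof (intro equalityI subsetI)
    fix w assume w: "w \<in> block T S v"
    then have wl: "w \<in> level T k" using len(1)[OF v] block_subset_level[of S v] by auto
    have gaps: "(k, p) \<in> S" if "min (last v) (last w) < p" "p \<le> max (last v) (last w)" for p
      using w that len(1)[OF v] by (auto simp: block_def)
    have "f (?nd (last v)) = f (?nd (last w))"
    proof (cases "last v \<le> last w")
      case True
      then show ?thesis
        using gaps level_nodeE(2)[OF wl k] by (intro chain) auto
    next
      case False
      then have "f (?nd (last w)) = f (?nd (last v))"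
        using gaps level_nodeE(2)[OF v k] by (intro chain) auto
      then show ?thesis by simp
    qed
    then have "f v = f w"
      using level_nodeE(1)[OF v k] level_nodeE(1)[OF wl k] by simp
    then show "w \<in> f v" using refl[OF wl] by simp
  next
    fix w assume w: "w \<in> f v"
    then have wl: "w \<in> level T k" using eq[OF v] by simp
    have "(k, p) \<in> S" if p: "min (last v) (last w) < p" "p \<le> max (last v) (last w)" for p
    proof -
      have pt: "1 \<le> p" "p \<le> t ! (k - 1)"
        using p level_nodeE(2)[OF v k] level_nodeE(2)[OF wl k] by auto
      have "?nd j \<in> f v" if "j = p - 1 \<or> j = p" for j
      proof -
        have "?nd j \<in> level T k" using that pt k by (intro node_level) auto
        then show ?thesis
          using convex[OF v refl[OF v] w, of "?nd j"] convex[OF v w refl[OF v], of "?nd j"] that p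
          by (cases "last v \<le> last w") (auto simp: min_def max_def)
      qed
      then have "f (?nd (p - 1)) = f v" "f (?nd p) = f v"
        using eq[OF v] by auto
      then show ?thesis using k pt by (simp add: S coords_def)
    qed
    then show "w \<in> block T S v"
      using len[OF v] len[OF wl] by (simp add: block_def)
  qed
qed

lemma is_bracket_parent:
  assumes "is_bracket T k A" "1 \<le> k" "k \<le> length t"
  shows "take (k - 1) b \<in> last (butlast A)" "take (k - 1) b \<in> A ! (k - 1)"
proof -
  obtain u where u: "u \<in> last A" using is_bracket_last(4)[OF assms(1)] by blast
  have uT: "u \<in> T" "length u = k" using u is_bracket_last(5)[OF assms(1)] by (auto simp: level_def)
  have "\<forall>i\<in>{1..k}. \<forall>u\<in>A ! i. butlast u \<in> A ! (i - 1)"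
    using assms(1) unfolding is_bracket_def by blast
  from this[rule_format, of k u] have "butlast u \<in> A ! (k - 1)"
    using u is_bracket_last(3)[OF assms(1)] assms(2) by simp
  then show 1: "take (k - 1) b \<in> A ! (k - 1)"
    using butlast_vertex[OF uT(1)] uT(2) assms(2) by (cases "u = []") auto
  have "length (butlast A) = k" using is_bracket_last(1)[OF assms(1)] by simp
  then have "last (butlast A) = butlast A ! (k - 1)"
    using assms(2) last_conv_nth[of "butlast A"] by fastforce
  also have "\<dots> = A ! (k - 1)"
    using is_bracket_last(1)[OF assms(1)] assms(2) by (simp add: nth_butlast)
  finally show "take (k - 1) b \<in> last (butlast A)" using 1 by simp
qed

text \<open>The whole level consists of children of one vertex, which lies in the bracket by closure
  under parents. The condition on consecutive siblings then makes the top set an interval.\<close>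

lemma is_bracket_convex:
  assumes A: "is_bracket T k A" and k: "1 \<le> k" "k \<le> length t"
    and u: "u \<in> last A" and w: "w \<in> last A" and x: "x \<in> level T k"
    and le: "last u \<le> last x" "last x \<le> last w"
  shows "x \<in> last A"
proof -
  have uw: "u \<in> level T k" "w \<in> level T k" using u w is_bracket_last(5)[OF A] by auto
  have T: "u \<in> T" "w \<in> T" "x \<in> T" "length u = k" "length w = k" "length x = k"
    using uw x by (auto simp: level_def)
  show ?thesis
  proof (cases "u = x \<or> w = x")
    case False
    have "last u \<noteq> last x" "last x \<noteq> last w"
      using False vertex_eqI[of u x] vertex_eqI[of w x] T by auto
    then have less: "u < x" "x < w"
      using less_iff[of u x] less_iff[of x w] T le by auto
    have "\<forall>i\<in>{1..k}. \<forall>u\<in>A ! (i - 1). consecutive_in (A ! i \<inter> children T u) (children T u)"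
      using A unfolding is_bracket_def by blast
    from this[rule_format, of k "take (k - 1) b"]
    have "consecutive_in (A ! k \<inter> children T (take (k - 1) b)) (children T (take (k - 1) b))"
      using is_bracket_parent(2)[OF A k] k by simp
    moreover have "children T (take (k - 1) b) = level T k"
    proof -
      have "k - 1 < length t" using k by linarith
      then show ?thesis using k by (simp add: children length_b)
    qed
    ultimately have c: "consecutive_in (A ! k \<inter> level T k) (level T k)" by simp
    have "u \<in> A ! k \<inter> level T k" "w \<in> A ! k \<inter> level T k"
      using u w uw is_bracket_last(3)[OF A] by auto
    then have "x \<in> A ! k \<inter> level T k"
      using c less x unfolding consecutive_in_def by blast
    then show ?thesis using is_bracket_last(3)[OF A] by simp
  qed (use u w in auto)
qed

lemma level_interval:
  assumes W: "W \<subseteq> level T a" "u \<in> W" "v \<in> W" "u \<noteq> v" and a: "1 \<le> a" "a \<le> length t"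
    and convex: "\<forall>x\<in>W. \<forall>y\<in>W. \<forall>z\<in>level T a. last x \<le> last z \<and> last z \<le> last y \<longrightarrow> z \<in> W"
  shows "\<exists>l r. l < r \<and> r \<le> t ! (a - 1) \<and> l \<in> last ` W \<and> r \<in> last ` W \<and>
    W = {w \<in> T. length w = a \<and> l \<le> last w \<and> last w \<le> r}"
proof -
  have WT: "w \<in> T" "length w = a" if "w \<in> W" for w using that W(1) by (auto simp: level_def)
  have fin: "finite W" using W(1) finite_T finite_subset[of W T] by (auto simp: level_def)
  define l where "l = Min (last ` W)"
  define r where "r = Max (last ` W)"
  obtain wl where wl: "wl \<in> W" "last wl = l"
    using Min_in[of "last ` W"] fin W(2) unfolding l_def by fastforce
  obtain wr where wr: "wr \<in> W" "last wr = r"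
    using Max_in[of "last ` W"] fin W(2) unfolding r_def by fastforce
  have lr: "l \<le> last w" "last w \<le> r" if "w \<in> W" for w
    using that fin unfolding l_def r_def by auto
  have "last u \<noteq> last v" using vertex_eqI[of u v] WT[OF W(2)] WT[OF W(3)] W(4) by auto
  then have "l < r" using lr[OF W(2)] lr[OF W(3)] by linarith
  moreover have "r \<le> t ! (a - 1)" using level_nodeE(2)[of wr a] wr W(1) a by auto
  moreover have "W = {w \<in> T. length w = a \<and> l \<le> last w \<and> last w \<le> r}"
  proof (intro equalityI subsetI)
    fix w assume "w \<in> {w \<in> T. length w = a \<and> l \<le> last w \<and> last w \<le> r}"
    then show "w \<in> W"
      using convex[rule_format, OF wl(1) wr(1), of w] wl(2) wr(2) by (simp add: level_def)
  qed (use WT lr in auto)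
  ultimately show ?thesis using wl wr by blast
qed

end

locale stem_bracketing = stem +
  fixes B :: "bracket set" and r
  assumes bracketing: "is_bracketing T B r"
begin

lemmas axioms_B = is_bracketingD[OF bracketing, unfolded depth]

lemma is_bracketB:
  assumes "A \<in> B"
  shows "is_bracket T (length A - 1) A" "length A - 1 \<le> length t" "A \<noteq> []"
proof -
  obtain k where k: "k \<le> length t" "is_bracket T k A" using axioms_B(1) assms by blast
  then have "length A = Suc k" using is_bracket_last(1) by blast
  then show "is_bracket T (length A - 1) A" "length A - 1 \<le> length t" "A \<noteq> []" using k by auto
qed

lemma butlastB: "A \<in> B \<Longrightarrow> 1 < length A \<Longrightarrow> butlast A \<in> B"
  using axioms_B(7)[rule_format, of "length A - 1" A] is_bracketB(2)[of A]
  by (simp add: bracket_level_def)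

lemma takeB:
  assumes "A \<in> B" "1 \<le> i" "i \<le> length A"
  shows "take i A \<in> B"
  using assms(2,3)
proof (induction "length A - i" arbitrary: i)
  case (Suc d)
  then have "take (Suc i) A \<in> B" by simp
  then have "butlast (take (Suc i) A) \<in> B" using Suc by (intro butlastB) auto
  then show ?case using Suc by (simp add: butlast_take)
qed (use assms(1) in simp)

text \<open>(4a) gives some bracket over \<open>X\<close> through \<open>v\<close>. One whose top
  set has least cardinality is minimal, since otherwise (4b) would give a smaller one that still
  contains \<open>v\<close>.\<close>

lemma minimal_bracket:
  assumes X: "X \<in> B" and len: "length X = k" and k: "1 \<le> k" "k \<le> length t"
    and stem: "take (k - 1) b \<in> last X" and v: "v \<in> level T k"
  shows "\<exists>M\<in>brackets_over B X. v \<in> last M \<and> (\<forall>A\<in>brackets_over B X. \<not> bracket_less A M)"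
proof -
  have XB: "X \<in> bracket_level B (k - 1)" using X len k by (simp add: bracket_level_def)
  have kk: "k \<in> {1..length t}" using k by simp
  have "v \<in> children T (take (k - 1) b)"
  proof -
    have "k - 1 < length t" using k by linarith
    then show ?thesis using v k by (simp add: children length_b)
  qed
  then have "v \<in> (\<Union>A'\<in>brackets_over B X. last A')"
    unfolding axioms_B(9)[rule_format, OF kk XB] using stem by blast
  then obtain A where "A \<in> brackets_over B X \<and> v \<in> last A" by blast
  from ex_has_least_nat[of "\<lambda>A. A \<in> brackets_over B X \<and> v \<in> last A", OF this, of "\<lambda>A. card (last A)"]
  obtain M where M: "M \<in> brackets_over B X" "v \<in> last M"
    and least: "\<And>A. A \<in> brackets_over B X \<Longrightarrow> v \<in> last A \<Longrightarrow> card (last M) \<le> card (last A)"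
    by blast
  have "\<not> bracket_less A M" if A: "A \<in> brackets_over B X" for A
  proof
    assume "bracket_less A M"
    then obtain A3 where A3: "A3 \<in> brackets_over B X" "bracket_less A3 M" "v \<in> last A3"
      using axioms_B(10)[rule_format, OF kk XB M(1) A _ M(2)] by blast
    have ne: "A3 \<noteq> []" "M \<noteq> []" using A3(1) M(1) by (auto simp: brackets_over_def)
    have "bracket_le A3 M" using A3(2) by (simp add: bracket_less_def)
    then have sub: "last A3 \<subseteq> last M" using bracket_le_last ne by blast
    have "last A3 \<noteq> last M"
    proof
      assume "last A3 = last M"
      moreover have "butlast A3 = butlast M" using A3(1) M(1) by (simp add: brackets_over_def)
      ultimately have "A3 = M"
        using eqI_butlast_last[OF ne] by blast
      then show False using A3(2) by (simp add: bracket_less_def)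
    qed
    moreover have "finite (last M)"
    proof -
      have "M \<in> B" using M(1) by (simp add: brackets_over_def)
      then have "last M \<subseteq> T"
        using is_bracket_last(5)[OF is_bracketB(1)] by (auto simp: level_def)
      then show ?thesis using finite_T finite_subset by blast
    qed
    ultimately have "card (last A3) < card (last M)"
      using sub by (intro psubset_card_mono) auto
    then show False using least[OF A3(1,3)] by simp
  qed
  then show ?thesis using M by blast
qed

text \<open>The minimal brackets over a fixed bracket partition the level above it into intervals.\<close>

lemma extend_block_set:
  assumes X: "br S (take m b) \<in> B" and m: "m < length t"
    and S: "\<And>k p. (k, p) \<in> S \<Longrightarrow> k \<le> m"
  shows "\<exists>S'. S \<subseteq> S' \<and> S' - S \<subseteq> coords t \<inter> {Suc m} \<times> UNIV \<and>
    (\<forall>v\<in>level T (Suc m). br S' v \<in> B \<and>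
      (\<forall>A\<in>brackets_over B (butlast (br S' v)). \<not> bracket_less A (br S' v)))"
proof -
  let ?X = "br S (take m b)" and ?k = "Suc m"
  have lenm: "length (take m b) = m" "take m b \<in> T" using m by (auto simp: length_b intro: stem_mem)
  have k: "1 \<le> ?k" "?k \<le> length t" using m by auto
  have stemX: "take (?k - 1) b \<in> last ?X"
    using block_refl[OF lenm(2), of S] by (simp add: last_block_bracket)
  have lenX: "length ?X = ?k" by (simp only: length_block_bracket lenm)
  have "\<forall>v\<in>level T ?k. \<exists>M. M \<in> brackets_over B ?X \<and> v \<in> last M \<and>
      (\<forall>A\<in>brackets_over B ?X. \<not> bracket_less A M)"
    using minimal_bracket[OF X lenX k stemX] by blast
  then obtain M where M: "\<And>v. v \<in> level T ?k \<Longrightarrow> M v \<in> brackets_over B ?X"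
      "\<And>v. v \<in> level T ?k \<Longrightarrow> v \<in> last (M v)"
      "\<And>v A. v \<in> level T ?k \<Longrightarrow> A \<in> brackets_over B ?X \<Longrightarrow> \<not> bracket_less A (M v)"
    by metis
  have MB: "M v \<in> B" "length (M v) = Suc ?k" "butlast (M v) = ?X" "is_bracket T ?k (M v)"
    if "v \<in> level T ?k" for v
  proof -
    show 1: "M v \<in> B" "length (M v) = Suc ?k" "butlast (M v) = ?X"
      using M(1)[OF that] lenX by (auto simp: brackets_over_def)
    show "is_bracket T ?k (M v)" using is_bracketB(1)[OF 1(1)] 1(2) by simp
  qed
  \<comment> \<open>Two of the chosen brackets that meet are comparable by (3), and minimality makes
    them equal.\<close>
  have part: "w \<in> level T ?k \<and> last (M w) = last (M v)" if v: "v \<in> level T ?k" and w: "w \<in> last (M v)" for v w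
  proof -
    have wl: "w \<in> level T ?k" using w is_bracket_last(5)[OF MB(4)[OF v]] by auto
    have "M v \<in> bracket_level B ?k" "M w \<in> bracket_level B ?k"
      using MB[OF v] MB[OF wl] by (auto simp: bracket_level_def)
    moreover have "last (M v) \<inter> last (M w) \<noteq> {}" using w M(2)[OF wl] by blast
    ultimately have "bracket_le (M v) (M w) \<or> bracket_le (M w) (M v)"
      using axioms_B(8)[rule_format, OF k(2)] by blast
    then have "M v = M w"
      using M(3)[OF v M(1)[OF wl]] M(3)[OF wl M(1)[OF v]] by (auto simp: bracket_less_def)
    then show ?thesis using wl by simp
  qed
  \<comment> \<open>The gaps of the new level that the partition does not cut. Lower levels are
    untouched, so the new brackets still project to \<open>?X\<close>.\<close>
  define N where "N = {(k', p) \<in> coords t. k' = ?k \<and>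
    last (M (take m b @ [p - 1])) = last (M (take m b @ [p]))}"
  have blk: "block T (S \<union> N) v = last (M v)" if v: "v \<in> level T ?k" for v
  proof (rule block_of_partition[where f = "\<lambda>v. last (M v)", OF k _ _ _ _ v])
    show "(?k, p) \<in> S \<union> N \<longleftrightarrow> (?k, p) \<in> coords t \<and>
        last (M (take (?k - 1) b @ [p - 1])) = last (M (take (?k - 1) b @ [p]))" for p
      using S[of ?k p] by (auto simp: N_def)
    show "x \<in> last (M v)"
      if "v \<in> level T ?k" "u \<in> last (M v)" "w \<in> last (M v)" "x \<in> level T ?k"
        "last u \<le> last x" "last x \<le> last w" for v u w x
      using is_bracket_convex[OF MB(4)[OF that(1)] k that(2-6)] .
    show "w \<in> level T ?k \<and> last (M w) = last (M v)"
      if "v \<in> level T ?k" "w \<in> last (M v)" for v w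
      using part[OF that] .
    show "v \<in> last (M v)" if "v \<in> level T ?k" for v using M(2)[OF that] .
  qed
  have eq: "br (S \<union> N) v = M v" if v: "v \<in> level T ?k" for v
  proof -
    have vT: "v \<in> T" "length v = ?k" "v \<noteq> []" using v by (auto simp: level_def)
    have "butlast (br (S \<union> N) v) = br (S \<union> N) (take m b)"
      using butlast_block_bracket[OF vT(3)] butlast_vertex[OF vT(1,3)] vT(2) by simp
    also have "\<dots> = ?X"
      using lenm by (intro block_bracket_cong) (auto simp: N_def)
    finally have "butlast (br (S \<union> N) v) = butlast (M v)" using MB(3)[OF v] by simp
    moreover have "last (br (S \<union> N) v) = last (M v)"
      using blk[OF v] by (simp add: last_block_bracket)
    moreover have "M v \<noteq> []" using MB(2)[OF v] by auto
    ultimately show ?thesis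
      using eqI_butlast_last[of "br (S \<union> N) v" "M v"] by simp
  qed
  have "\<forall>v\<in>level T ?k. br (S \<union> N) v \<in> B \<and>
      (\<forall>A\<in>brackets_over B (butlast (br (S \<union> N) v)).
        \<not> bracket_less A (br (S \<union> N) v))"
    using eq MB M(3) by simp
  moreover have "S \<union> N - S \<subseteq> coords t \<inter> {?k} \<times> UNIV" by (auto simp: N_def)
  ultimately show ?thesis by (intro exI[of _ "S \<union> N"]) auto
qed

end

section \<open>Collisions\<close>

text \<open>On the lowest level \<open>a\<close> the positions \<open>l\<close> to \<open>r\<close>
  are fused, so the gaps in between are \<open>l + 1\<close> to \<open>r\<close>. Gaps on higher
  levels require the branching vertex, at position \<open>b ! (a - 1)\<close>, to be among the fused
  vertices. The full gap set may satisfy this; \<open>S \<noteq> coords t\<close> is demanded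
  separately where needed.\<close>

definition collision_set :: "nat list \<Rightarrow> nat list \<Rightarrow> (nat \<times> nat) set \<Rightarrow> nat \<Rightarrow> nat \<Rightarrow> nat \<Rightarrow> bool" where
  "collision_set t b S a l r \<longleftrightarrow> S \<subseteq> coords t \<and> 1 \<le> a \<and> a \<le> length t \<and> l < r \<and> r \<le> t ! (a - 1) \<and>
     (\<forall>(k, p)\<in>S. a \<le> k) \<and> (\<forall>p. (a, p) \<in> S \<longleftrightarrow> l < p \<and> p \<le> r) \<and>
     ((\<forall>(k, p)\<in>S. k = a) \<or> (l \<le> b ! (a - 1) \<and> b ! (a - 1) \<le> r))"

context stem
begin

lemma nontrivial_iff:
  "nontrivial T A \<longleftrightarrow> A \<notin> br {} ` T \<and> A \<notin> br (coords t) ` T"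
  by (simp add: nontrivial_def is_singleton_bracket_iff depth is_max_bracket_iff)

lemma nontrivial_block_bracket_iff:
  assumes "v \<in> T"
  shows "nontrivial T (br S v) \<longleftrightarrow>
    br S v \<noteq> br {} v \<and> br S v \<noteq> br (coords t) v"
proof -
  have "br S v \<in> br R ` T \<longleftrightarrow> br S v = br R v" for R
    using block_bracket_eqI[of R _ S v] assms by (metis imageE imageI)
  then show ?thesis by (simp add: nontrivial_iff)
qed

lemma last_stem: "1 \<le> k \<Longrightarrow> k \<le> length t \<Longrightarrow> last (take k b) = b ! (k - 1)"
  using take_Suc_conv_app_nth[of "k - 1" b] by (simp add: length_b)

section \<open>Block brackets of a connected gap set\<close>

context
  fixes S a l r
  assumes S: "collision_set t b S a l r"
begin

lemma collision_setD:
  "S \<subseteq> coords t" "1 \<le> a" "a \<le> length t" "l < r" "r \<le> t ! (a - 1)"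
  "\<And>k p. (k, p) \<in> S \<Longrightarrow> a \<le> k" "\<And>p. (a, p) \<in> S \<longleftrightarrow> l < p \<and> p \<le> r"
  "(\<forall>k p. (k, p) \<in> S \<longrightarrow> k = a) \<or> (l \<le> b ! (a - 1) \<and> b ! (a - 1) \<le> r)"
  using S unfolding collision_set_def by blast+

lemma block_below: "v \<in> T \<Longrightarrow> length v < a \<Longrightarrow> block T S v = {v}"
  using collision_setD(6)[of "length v"] by (intro block_trivial) auto

lemma block_fused:
  assumes v: "v \<in> T" "length v = a" and lr: "l \<le> last v" "last v \<le> r"
  shows "block T S v = {w \<in> T. length w = a \<and> l \<le> last w \<and> last w \<le> r}"
proof (intro equalityI subsetI)
  fix w assume w: "w \<in> block T S v"
  then have wT: "w \<in> T" "length w = a"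
    and g: "\<And>p. min (last v) (last w) < p \<Longrightarrow> p \<le> max (last v) (last w) \<Longrightarrow> l < p \<and> p \<le> r"
    using v collision_setD(7) by (auto simp: block_def)
  have "l \<le> last w" using g[of "Suc (last w)"] lr by (cases "last w < l") auto
  moreover have "last w \<le> r" using g[of "last w"] lr by (cases "r < last w") auto
  ultimately show "w \<in> {w \<in> T. length w = a \<and> l \<le> last w \<and> last w \<le> r}" using wT by simp
next
  fix w assume "w \<in> {w \<in> T. length w = a \<and> l \<le> last w \<and> last w \<le> r}"
  then have w: "w \<in> T" "length w = a" "l \<le> last w" "last w \<le> r" by auto
  have "(a, p) \<in> S" if "min (last v) (last w) < p" "p \<le> max (last v) (last w)" for p
    unfolding collision_setD(7) using that w lr by linarith
  then show "w \<in> block T S v" using v(2) w(1,2) unfolding block_def by simp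
qed

lemma block_unfused:
  assumes v: "v \<in> T" "length v = a" and lr: "\<not> (l \<le> last v \<and> last v \<le> r)"
  shows "block T S v = {v}"
proof -
  have "w = v" if w: "w \<in> block T S v" for w
  proof (rule ccontr)
    assume "w \<noteq> v"
    have wT: "w \<in> T" "length w = a"
      and g: "\<And>p. min (last v) (last w) < p \<Longrightarrow> p \<le> max (last v) (last w) \<Longrightarrow> l < p \<and> p \<le> r"
      using w v collision_setD(7) by (auto simp: block_def)
    have "last w \<noteq> last v" using \<open>w \<noteq> v\<close> vertex_eqI[of w v] wT v by auto
    then consider "last v < last w" | "last w < last v" by linarith
    then show False using g[of "Suc (last v)"] g[of "last v"] lr by cases auto
  qed
  then show ?thesis using block_refl[OF v(1), of S] by auto
qed

lemma fused_two:
  obtains u v where "u \<in> T" "v \<in> T" "length u = a" "length v = a" "last u = l" "last v = r"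
proof -
  let ?nd = "\<lambda>j. take (a - 1) b @ [j]"
  have "?nd l \<in> level T a" "?nd r \<in> level T a"
    using collision_setD(2-5) by (intro node_level; linarith)+
  then show ?thesis using that[of "?nd l" "?nd r"] by (auto simp: level_def)
qed

lemma block_fused_not_singleton:
  assumes "v \<in> T" "length v = a" "l \<le> last v" "last v \<le> r"
  shows "block T S v \<noteq> {v}"
proof -
  obtain x y where xy: "x \<in> T" "y \<in> T" "length x = a" "length y = a" "last x = l" "last y = r"
    by (rule fused_two)
  then have "x \<in> block T S v" "y \<in> block T S v" "x \<noteq> y"
    using block_fused[OF assms] collision_setD(4) by auto
  then show ?thesis by (metis singletonD)
qed

text \<open>A vertex above level \<open>a\<close> has the branching vertex as its ancestor on that
  level. If this ancestor is not fused, \<open>S\<close> has no gaps on higher levels and all blocks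
  on the path are trivial.\<close>

lemma block_bracket_collision_singleton_iff:
  assumes v: "v \<in> T"
  shows "br S v = br {} v \<longleftrightarrow>
    length v < a \<or> \<not> (l \<le> last (take a v) \<and> last (take a v) \<le> r)"
proof (cases "length v < a")
  case True
  then show ?thesis
    using block_below[OF take_mem[OF v]] by (simp add: block_bracket_singleton_iff[OF v])
next
  case False
  have ta: "take a v \<in> T" "length (take a v) = a" using False take_mem[OF v] by auto
  show ?thesis
  proof (cases "l \<le> last (take a v) \<and> last (take a v) \<le> r")
    case True
    then have "block T S (take a v) \<noteq> {take a v}"
      using block_fused_not_singleton[OF ta] by simp
    then show ?thesis using True False by (auto simp: block_bracket_singleton_iff[OF v])
  next
    case un: False
    have "block T S (take i v) = {take i v}" if i: "i \<le> length v" for i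
    proof -
      have ti: "take i v \<in> T" "length (take i v) = i" using i take_mem[OF v] by auto
      consider "i < a" | "i = a" | "a < i" by linarith
      then show ?thesis
      proof cases
        case 1
        then show ?thesis using block_below ti by simp
      next
        case 2
        then show ?thesis using block_unfused[OF ta un] by simp
      next
        case 3
        then have "take a v = take a b" using take_vertex[OF v] i by simp
        then have "\<not> (l \<le> b ! (a - 1) \<and> b ! (a - 1) \<le> r)"
          using un last_stem collision_setD(2,3) by simp
        then have "(i, p) \<notin> S" for p using collision_setD(8) 3 by blast
        then show ?thesis using ti by (intro block_trivial) auto
      qed
    qed
    then show ?thesis using un by (simp add: block_bracket_singleton_iff[OF v])
  qed
qed

lemma block_full:
  assumes "br S u = br (coords t) u" "u \<in> T" "w \<in> T" "length w \<le> length u"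
  shows "block T S w = level T (length w)"
proof -
  have "br S u ! length w = br (coords t) u ! length w" using assms by simp
  then have "block T S (take (length w) u) = block T (coords t) (take (length w) u)"
    by (simp only: nth_block_bracket[OF assms(4)])
  then have "block T S (take (length w) u) = level T (length w)"
    using block_coords[OF take_mem[OF assms(2)]] assms(4) by simp
  moreover have "w \<in> level T (length w)" using assms(3) by (simp add: level_def)
  ultimately show ?thesis using block_eq[of w S "take (length w) u"] by simp
qed

text \<open>If a nonsingleton block bracket is maximum, the gap missing from \<open>S\<close> must
  lie on a higher level. A vertex next to this gap has a block that is not its full level, and its
  ancestor on level \<open>a\<close> is fused, so its bracket is nontrivial.\<close>

lemma nontrivial_above:
  assumes ne: "S \<noteq> coords t" and u: "u \<in> T" "br S u \<noteq> br {} u"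
  shows "\<exists>v\<in>T. nontrivial T (br S v) \<and> length u \<le> length v \<and>
    br S u = br S (take (length u) v)"
proof (cases "br S u = br (coords t) u")
  case False
  then show ?thesis
    using u by (intro bexI[of _ u]) (simp_all add: nontrivial_block_bracket_iff)
next
  case full: True
  have au: "a \<le> length u" and lu: "l \<le> last (take a u)" "last (take a u) \<le> r"
    using u(2) block_bracket_collision_singleton_iff[OF u(1)] by auto
  have ta: "take a u \<in> T" "length (take a u) = a" using au take_mem[OF u(1)] by auto
  obtain k p where kp: "(k, p) \<in> coords t" "(k, p) \<notin> S"
    using ne collision_setD(1) by auto
  define v where "v = take (k - 1) b @ [p]"
  have v: "v \<in> T" "length v = k" "take (k - 1) b @ [p - 1] \<notin> block T S v"
    "take (k - 1) b @ [p - 1] \<in> level T (length v)"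
    using gap_iff[OF kp(1)] kp(2) by (auto simp: v_def level_def)
  have uv: "length u < length v"
  proof (rule ccontr)
    assume "\<not> length u < length v"
    then have "block T S v = level T (length v)"
      using block_full[OF full u(1) v(1)] by simp
    then show False using v by simp
  qed
  have tv: "take (length u) v \<in> T" "length (take (length u) v) = length u"
    using uv take_mem[OF v(1)] by auto
  have "block T S u = level T (length u)" using block_full[OF full u(1) u(1)] by simp
  then have "take (length u) v \<in> block T S u" using tv by (simp add: level_def)
  then have eq: "br S (take (length u) v) = br S u"
    by (rule block_bracket_eq[OF u(1)])
  have "block T S (take a v) = level T a"
    using block_full[OF full u(1) take_mem[OF v(1), of a]] uv au by simp
  moreover have "block T S (take a u) = level T a"
    using block_full[OF full u(1) ta(1)] au ta(2) by simp
  ultimately have "take a v \<in> block T S (take a u)"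
    using block_refl[OF take_mem[OF v(1), of a], of S] by simp
  then have "l \<le> last (take a v) \<and> last (take a v) \<le> r"
    using block_fused[OF ta lu] by simp
  then have "br S v \<noteq> br {} v"
    using block_bracket_collision_singleton_iff[OF v(1)] uv au by simp
  moreover have "br S v \<noteq> br (coords t) v"
    using block_full[OF _ v(1) v(1)] v(3,4) by auto
  ultimately have "nontrivial T (br S v)"
    using v(1) by (simp add: nontrivial_block_bracket_iff)
  then show ?thesis using v(1) uv eq by (intro bexI[of _ v]) simp_all
qed

end

definition collision_brackets :: "(nat \<times> nat) set \<Rightarrow> bracket set" where
  "collision_brackets S = chain_brackets T {{}, S, coords t}"

lemma collision_brackets_iff:
  "A \<in> collision_brackets S \<longleftrightarrow>
    A \<in> br {} ` T \<or> A \<in> br S ` T \<or> A \<in> br (coords t) ` T"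
  by (auto simp: collision_brackets_def chain_brackets_def)

lemma is_bracketing_collision_brackets:
  "S \<subseteq> coords t \<Longrightarrow> is_bracketing T (collision_brackets S) (block_order (collision_brackets S))"
  unfolding collision_brackets_def by (rule is_bracketing_chain_brackets) auto

text \<open>Nontrivial block brackets of \<open>S'\<close> must be block brackets of
  \<open>S\<close>, and by \<open>nontrivial_above\<close> the agreement passes down to all
  nonsingleton ones. The fused intervals then coincide, hence the singleton ones agree as well, and
  the blocks determine the gap sets.\<close>

lemma collision_brackets_antichain:
  assumes S: "collision_set t b S a l r" and S': "collision_set t b S' a' l' r'" "S' \<noteq> coords t"
    and sub: "br S' ` T \<subseteq> collision_brackets S"
  shows "S' = S"
proof -
  have nt: "br S' v = br S v"
    if v: "v \<in> T" "nontrivial T (br S' v)" for v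
  proof -
    have "br S' v \<in> collision_brackets S" using sub v(1) by blast
    then obtain w where w: "w \<in> T" "br S w = br S' v"
      using v(2) unfolding collision_brackets_iff nontrivial_iff by auto
    show ?thesis using block_bracket_eqI[OF w(2,1) v(1)] by simp
  qed
  have ns: "br S' u = br S u"
    if u: "u \<in> T" "br S' u \<noteq> br {} u" for u
  proof -
    obtain v where v: "v \<in> T" "nontrivial T (br S' v)" "length u \<le> length v"
      "br S' u = br S' (take (length u) v)"
      using nontrivial_above[OF S' u] by blast
    have "br S' (take (length u) v) = br S (take (length u) v)"
      using nt[OF v(1,2)] take_block_bracket[OF v(3), of T S'] take_block_bracket[OF v(3), of T S] by simp
    then have "br S (take (length u) v) = br S' u" using v(4) by simp
    from block_bracket_eqI[OF this take_mem[OF v(1)] u(1)] show ?thesis by simp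
  qed
  obtain w0 w1 where w0: "w0 \<in> T" "length w0 = a'" "last w0 = l'"
    and w1: "w1 \<in> T" "length w1 = a'" "last w1 = r'"
    by (rule fused_two[OF S'(1)])
  note D = collision_setD[OF S] and D' = collision_setD[OF S'(1)]
  have w0ns: "br S' w0 \<noteq> br {} w0"
    using block_bracket_collision_singleton_iff[OF S'(1) w0(1)] w0 D'(4) by simp
  note E0 = ns[OF w0(1) w0ns]
  have blk0: "block T S' (take i w0) = block T S (take i w0)" if "i \<le> a'" for i
    using arg_cong[OF E0, of "\<lambda>A. A ! i"] that w0(2) by (simp add: nth_block_bracket)
  have "br S w0 \<noteq> br {} w0" using w0ns E0 by simp
  then have aa: "a \<le> a'" "l \<le> last (take a w0)" "last (take a w0) \<le> r"
    using block_bracket_collision_singleton_iff[OF S w0(1)] w0(2) by auto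
  \<comment> \<open>If \<open>a < a'\<close>, then \<open>S'\<close> leaves the
    level-\<open>a\<close> ancestor of \<open>w0\<close> alone in its block, whereas
    \<open>S\<close> fuses it.\<close>
  have "a = a'"
  proof (rule ccontr)
    assume "a \<noteq> a'"
    then have "a < a'" using aa by simp
    have ta: "take a w0 \<in> T" "length (take a w0) = a" using take_mem[OF w0(1)] w0(2) aa by auto
    have "block T S' (take a w0) = {take a w0}"
      using block_below[OF S'(1) ta(1)] ta(2) \<open>a < a'\<close> by simp
    then show False
      using block_fused_not_singleton[OF S ta] aa blk0[of a] by simp
  qed
  have J: "l \<le> last v \<and> last v \<le> r \<longleftrightarrow> l' \<le> last v \<and> last v \<le> r'" if v: "v \<in> T" "length v = a" for v
  proof -
    have "block T S' w0 = block T S w0" using blk0[of a'] w0(2) by simp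
    moreover have "block T S' w0 = {w \<in> T. length w = a' \<and> l' \<le> last w \<and> last w \<le> r'}"
      using block_fused[OF S'(1) w0(1,2)] w0(3) D'(4) by simp
    moreover have "block T S w0 = {w \<in> T. length w = a \<and> l \<le> last w \<and> last w \<le> r}"
      using block_fused[OF S w0(1)] w0(2) aa(2,3) \<open>a = a'\<close> by simp
    ultimately show ?thesis using v \<open>a = a'\<close> by blast
  qed
  have all: "br S' u = br S u" if u: "u \<in> T" for u
  proof (cases "br S' u = br {} u")
    case True
    have "last (take a u) \<ge> l \<and> last (take a u) \<le> r \<longleftrightarrow> l' \<le> last (take a u) \<and> last (take a u) \<le> r'"
      if "\<not> length u < a"
      using J[of "take a u"] that take_mem[OF u, of a] by auto
    then have "br S u = br {} u"
      using True unfolding block_bracket_collision_singleton_iff[OF S u]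
        block_bracket_collision_singleton_iff[OF S'(1) u] \<open>a = a'\<close>[symmetric] by blast
    then show ?thesis using True by simp
  qed (use ns u in blast)
  have "(k, p) \<in> S' \<longleftrightarrow> (k, p) \<in> S" if kp: "(k, p) \<in> coords t" for k p
  proof -
    have "block T S' (take (k - 1) b @ [p]) = block T S (take (k - 1) b @ [p])"
      using arg_cong[OF all[OF gap_iff(1)[OF kp]], of last] by (simp only: last_block_bracket)
    then show ?thesis using gap_iff(5)[OF kp] by metis
  qed
  then show ?thesis using D(1) D'(1) by auto
qed

end

section \<open>A connected gap set inside a bracketing with a nontrivial bracket\<close>

context stem_bracketing
begin

lemma singletonB: "v \<in> T \<Longrightarrow> br {} v \<in> B"
  using axioms_B(6) by (simp add: block_bracket_empty)

text \<open>The lowest nonsingleton projection \<open>E0\<close> of \<open>A\<close> fixes the level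
  and the fused interval. If the branching vertex is not fused, these gaps suffice; otherwise
  minimal brackets of \<open>B\<close> fill the higher levels, so that \<open>S\<close> could be all
  of \<open>coords t\<close> only if \<open>A\<close> were maximum.\<close>

lemma collision_set_below:
  assumes A: "A \<in> B" "nontrivial T A"
  shows "\<exists>S a l r. collision_set t b S a l r \<and> S \<noteq> coords t \<and> br S ` T \<subseteq> B"
proof -
  let ?sing = "\<lambda>C. C \<in> br {} ` T"
  have lenA: "0 < length A" using is_bracketB(3)[OF A(1)] by simp
  have tB: "take (Suc i) A \<in> B" "length (take (Suc i) A) = Suc i" "is_bracket T i (take (Suc i) A)"
    "i \<le> length t" if "i < length A" for i
  proof -
    show 1: "take (Suc i) A \<in> B" using that by (intro takeB A(1)) auto
    show 2: "length (take (Suc i) A) = Suc i" using that by simp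
    show "is_bracket T i (take (Suc i) A)" "i \<le> length t"
      using is_bracketB(1,2)[OF 1] 2 by simp_all
  qed
  \<comment> \<open>Such a level exists because \<open>A\<close> itself is not a singleton.\<close>
  define a where "a = (LEAST i. i < length A \<and> \<not> ?sing (take (Suc i) A))"
  have "length A - 1 < length A \<and> \<not> ?sing (take (Suc (length A - 1)) A)"
    using A(2) lenA by (simp add: nontrivial_iff)
  then have a: "a < length A" "\<not> ?sing (take (Suc a) A)"
    and least: "\<And>i. i < a \<Longrightarrow> i < length A \<Longrightarrow> ?sing (take (Suc i) A)"
    unfolding a_def using LeastI[of "\<lambda>i. i < length A \<and> \<not> ?sing (take (Suc i) A)"] not_less_Least
    by blast+
  define E0 where "E0 = take (Suc a) A"
  define W where "W = last E0"
  note E0 = tB[OF a(1), folded E0_def]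
  have "a \<noteq> 0"
  proof
    assume a0: "a = 0"
    have "last E0 \<subseteq> {[]}" "last E0 \<noteq> {}"
      using is_bracket_last(4,5)[OF E0(3)] level_0 a0 by auto
    then have "last E0 = {[]}" by blast
    moreover have "butlast E0 = []" using E0(2) a0 by (cases E0) auto
    moreover have nil: "[] \<in> T" by (simp add: mem_T)
    moreover have "br {} [] = [{[]}]" using block_empty[OF nil] by (simp add: block_bracket_def)
    ultimately have "E0 = br {} []" using E0(2) eqI_butlast_last[of E0 "br {} []"] by (cases E0) auto
    then show False using a(2) nil unfolding E0_def[symmetric] by blast
  qed
  then have a1: "1 \<le> a" "a \<le> length t" using E0(4) by auto
  have stem1: "take (a - 1) b \<in> T" "length (take (a - 1) b) = a - 1"
    using a1 by (auto intro!: stem_mem simp: length_b)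
  have butE0: "butlast E0 = br {} (take (a - 1) b)"
  proof -
    have but: "butlast E0 = take (Suc (a - 1)) A"
      using a1 a(1) unfolding E0_def by (simp add: butlast_take)
    have "?sing (take (Suc (a - 1)) A)" using a1 a(1) by (intro least) auto
    then obtain u where u: "u \<in> T" "butlast E0 = br {} u" unfolding but by blast
    have "take (a - 1) b \<in> last (br {} u)" using is_bracket_parent(1)[OF E0(3) a1] u(2) by simp
    then show ?thesis using u block_empty[OF u(1)] by (simp add: last_block_bracket)
  qed
  have E0nn: "E0 \<noteq> []" using E0(2) by auto
  have W: "W \<noteq> {}" "W \<subseteq> level T a" using is_bracket_last(4,5)[OF E0(3)] by (auto simp: W_def)
  then have WT: "w \<in> T" "length w = a" if "w \<in> W" for w using that by (auto simp: level_def)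
  have E_below: "br S v = br {} v" if "v \<in> T" "\<And>k p. (k, p) \<in> S \<Longrightarrow> length v < k" for S v
    using that(2) by (intro block_bracket_cong) fastforce
  have E_W: "br S w = E0" if w: "w \<in> T" "length w = a" and blk: "block T S w = W"
    and low: "\<And>k p. (k, p) \<in> S \<Longrightarrow> a \<le> k" for S w
  proof -
    have "w \<noteq> []" using w a1 by auto
    then have "butlast (br S w) = br S (take (a - 1) b)"
      using butlast_block_bracket butlast_vertex[OF w(1)] w(2) by simp
    also have "\<dots> = br {} (take (a - 1) b)"
      using low stem1 a1 by (intro E_below) fastforce+
    finally show ?thesis
      using butE0 blk E0nn eqI_butlast_last[of "br S w" E0] by (simp add: last_block_bracket W_def)
  qed
  obtain w0 where w0: "w0 \<in> W" using W(1) by blast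
  have "W \<noteq> {w0}"
  proof
    assume "W = {w0}"
    then have "block T {} w0 = W" using block_empty[OF WT(1)[OF w0]] by simp
    then have "br {} w0 = E0" using E_W[OF WT[OF w0], of "{}"] by simp
    then show False using a(2) WT(1)[OF w0] unfolding E0_def[symmetric] by blast
  qed
  then obtain w1 where w1: "w1 \<in> W" "w0 \<noteq> w1" using w0 by blast
  have "\<forall>x\<in>W. \<forall>y\<in>W. \<forall>z\<in>level T a. last x \<le> last z \<and> last z \<le> last y \<longrightarrow> z \<in> W"
    using is_bracket_convex[OF E0(3) a1] unfolding W_def by blast
  from level_interval[OF W(2) w0 w1 a1 this]
  obtain l r wl where "l < r" and rt: "r \<le> t ! (a - 1)" and wl: "wl \<in> W" "last wl = l"
    and W_eq: "W = {w \<in> T. length w = a \<and> l \<le> last w \<and> last w \<le> r}"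
    by blast
  have W_iff: "w \<in> W \<longleftrightarrow> l \<le> last w \<and> last w \<le> r" if "w \<in> T" "length w = a" for w
    using that by (simp add: W_eq)
  have lr: "l \<le> last w" "last w \<le> r" if "w \<in> W" for w using W_iff[OF WT[OF that]] that by simp_all
  have blkW: "block T S w = W" if "collision_set t b S a l r" "w \<in> W" for S w
    unfolding W_eq by (rule block_fused[OF that(1) WT[OF that(2)] lr[OF that(2)]])
  define S0 where "S0 = {a} \<times> {l<..r}"
  have S0: "S0 \<subseteq> coords t" using a1 rt by (auto simp: S0_def coords_def)
  have coll: "collision_set t b S a l r"
    if "S \<subseteq> coords t" "\<And>k p. (k, p) \<in> S \<Longrightarrow> a \<le> k" "\<And>p. (a, p) \<in> S \<longleftrightarrow> l < p \<and> p \<le> r"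
      "(\<forall>k p. (k, p) \<in> S \<longrightarrow> k = a) \<or> (l \<le> b ! (a - 1) \<and> b ! (a - 1) \<le> r)" for S
    unfolding collision_set_def using that a1 \<open>l < r\<close> rt by blast
  have E_a: "br S v \<in> B" if S: "collision_set t b S a l r" and v: "v \<in> T" "length v \<le> a" for S v
  proof (cases "v \<in> W")
    case True
    then have "block T S v = W" using blkW[OF S] by simp
    then have "br S v = E0" using E_W[OF WT[OF True], of S] collision_setD(6)[OF S] by blast
    then show ?thesis using E0(1) by simp
  next
    case False
    then have "br S v = br {} v"
      using v W_iff[of "take a v"] take_mem[OF v(1), of a] unfolding block_bracket_collision_singleton_iff[OF S v(1)]
      by (cases "length v = a") auto
    then show ?thesis using singletonB[OF v(1)] by simp
  qed
  have stema: "take a b \<in> T" "length (take a b) = a" "last (take a b) = b ! (a - 1)"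
    using a1 last_stem[OF a1] by (auto intro!: stem_mem simp: length_b)
  show ?thesis
  proof (cases "take a b \<in> W")
    case False
    have S: "collision_set t b S0 a l r" by (rule coll[OF S0]) (auto simp: S0_def)
    \<comment> \<open>Vertices above level \<open>a\<close> all descend from the branching vertex,
      which is not fused here, so their brackets are singletons.\<close>
    have "br S0 v \<in> B" if v: "v \<in> T" for v
    proof (cases "length v \<le> a")
      case True
      then show ?thesis using E_a[OF S v] by simp
    next
      case la: False
      then have "take a v = take a b" using take_vertex[OF v] by simp
      then have "br S0 v = br {} v"
        using block_bracket_collision_singleton_iff[OF S v] False W_iff[OF stema(1,2)] by simp
      then show ?thesis using singletonB[OF v] by simp
    qed
    moreover have "S0 \<noteq> coords t"
    proof
      assume "S0 = coords t"
      then have "block T S0 wl = level T a"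
        using block_coords[of wl] WT[OF wl(1)] by simp
      moreover have "block T S0 wl = W"
        using blkW[OF S wl(1)] .
      ultimately show False using False stema by (auto simp: level_def)
    qed
    ultimately show ?thesis using S by blast
  next
    case True
    \<comment> \<open>Invariant of the construction up to level \<open>m\<close>. Minimality is
      demanded only strictly above level \<open>a\<close>, since on level \<open>a\<close> the fused
      bracket is prescribed by \<open>E0\<close>.\<close>
    define good where "good m S \<longleftrightarrow> S \<subseteq> coords t \<and> (\<forall>k p. (k, p) \<in> S \<longrightarrow> a \<le> k \<and> k \<le> m) \<and>
      (\<forall>p. (a, p) \<in> S \<longleftrightarrow> l < p \<and> p \<le> r) \<and> (\<forall>v\<in>T. length v \<le> m \<longrightarrow> br S v \<in> B) \<and>
      (\<forall>v\<in>T. a < length v \<and> length v \<le> m \<longrightarrow>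
        (\<forall>C\<in>brackets_over B (butlast (br S v)). \<not> bracket_less C (br S v)))" for m S
    have bl: "l \<le> b ! (a - 1) \<and> b ! (a - 1) \<le> r" using lr[OF True] stema(3) by simp
    have "\<exists>S. good (length t) S"
    proof (rule dec_induct[OF a1(2), of "\<lambda>m. \<exists>S. good m S"])
      have S: "collision_set t b S0 a l r" by (rule coll[OF S0]) (auto simp: S0_def)
      have "good a S0" unfolding good_def using S0 E_a[OF S] by (auto simp: S0_def)
      then show "\<exists>S. good a S" by blast
    next
      fix m assume m: "a \<le> m" "m < length t" and "\<exists>S. good m S"
      then obtain S where S: "good m S" by blast
      have Sg: "S \<subseteq> coords t" "\<And>k p. (k, p) \<in> S \<Longrightarrow> a \<le> k \<and> k \<le> m"
        "\<And>p. (a, p) \<in> S \<longleftrightarrow> l < p \<and> p \<le> r" "\<And>v. v \<in> T \<Longrightarrow> length v \<le> m \<Longrightarrow> br S v \<in> B"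
        "\<And>v C. v \<in> T \<Longrightarrow> a < length v \<Longrightarrow> length v \<le> m \<Longrightarrow> C \<in> brackets_over B (butlast (br S v)) \<Longrightarrow>
          \<not> bracket_less C (br S v)"
        using S unfolding good_def by blast+
      have "take m b \<in> T" "length (take m b) = m" using m by (auto intro!: stem_mem simp: length_b)
      then have "br S (take m b) \<in> B" using Sg(4) by simp
      from extend_block_set[OF this m(2)] Sg(2)
      obtain S' where S': "S \<subseteq> S'" "S' - S \<subseteq> coords t \<inter> {Suc m} \<times> UNIV"
        "\<forall>v\<in>level T (Suc m). br S' v \<in> B \<and>
          (\<forall>A\<in>brackets_over B (butlast (br S' v)). \<not> bracket_less A (br S' v))"
        by blast
      have same: "(k, p) \<in> S' \<longleftrightarrow> (k, p) \<in> S" if "k \<le> m" for k p using S'(1,2) that by auto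
      have Esame: "br S' v = br S v" if "length v \<le> m" for v
        using same that by (intro block_bracket_cong) simp
      have "good (Suc m) S'"
        unfolding good_def
      proof (intro conjI allI ballI impI)
        show "S' \<subseteq> coords t" using S'(2) Sg(1) by blast
        show "a \<le> k" "k \<le> Suc m" if "(k, p) \<in> S'" for k p
          using that S'(2) Sg(2)[of k p] m(1) by (cases "(k, p) \<in> S"; auto)+
        show "(a, p) \<in> S' \<longleftrightarrow> l < p \<and> p \<le> r" for p using same[OF m(1)] Sg(3) by simp
        show "br S' v \<in> B" if v: "v \<in> T" "length v \<le> Suc m" for v
        proof (cases "length v = Suc m")
          case True
          then show ?thesis using S'(3) v(1) by (simp add: level_def)
        next
          case False
          then have "length v \<le> m" using v(2) by simp
          then show ?thesis using Esame[of v] Sg(4)[OF v(1)] by simp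
        qed
        show "\<not> bracket_less C (br S' v)"
          if v: "v \<in> T" "a < length v \<and> length v \<le> Suc m" and C: "C \<in> brackets_over B (butlast (br S' v))"
          for v C
        proof (cases "length v = Suc m")
          case True
          then show ?thesis using S'(3) v(1) C by (simp add: level_def)
        next
          case False
          then have "length v \<le> m" using v(2) by simp
          then show ?thesis using Esame[of v] Sg(5)[OF v(1)] v(2) C by simp
        qed
      qed
      then show "\<exists>S. good (Suc m) S" by blast
    qed
    then obtain S where S: "good (length t) S" by blast
    have Sg: "S \<subseteq> coords t" "\<And>k p. (k, p) \<in> S \<Longrightarrow> a \<le> k"
      "\<And>p. (a, p) \<in> S \<longleftrightarrow> l < p \<and> p \<le> r" "\<And>v. v \<in> T \<Longrightarrow> br S v \<in> B"
      "\<And>v C. v \<in> T \<Longrightarrow> a < length v \<Longrightarrow> C \<in> brackets_over B (butlast (br S v)) \<Longrightarrow>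
        \<not> bracket_less C (br S v)"
      using S length_le unfolding good_def by blast+
    have cS: "collision_set t b S a l r" by (rule coll[OF Sg(1)]) (use Sg(2,3) bl in blast)+
    \<comment> \<open>If \<open>S\<close> were full, the maximum brackets above level
      \<open>a\<close> would be minimal over their projections. Going up level by level, every
      projection of \<open>A\<close> would be maximum, and finally \<open>A\<close> itself.\<close>
    have "S \<noteq> coords t"
    proof
      assume full: "S = coords t"
      have mx: "br S v = max_bracket T (length v)" if "v \<in> T" for v
        using block_bracket_coords[OF that] full by simp
      have "block T S wl = W"
        using blkW[OF cS wl(1)] .
      then have E0w: "br S wl = E0"
        using E_W[OF WT[OF wl(1)], of S] Sg(2) by blast
      have "take (Suc i) A = max_bracket T i" if "i < length A" for i
        using that
      proof (induction i)
        case 0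
        have "take (Suc 0) E0 = br S (take 0 wl)"
          using E0w take_block_bracket[of 0 wl T S] by simp
        then show ?case using mx[of "[]"] a1 by (simp add: E0_def mem_T min_def)
      next
        case (Suc i)
        show ?case
        proof (cases "Suc i \<le> a")
          case True
          have "take (Suc (Suc i)) E0 = br S (take (Suc i) wl)"
            using E0w take_block_bracket[of "Suc i" wl T S] True WT(2)[OF wl(1)] by simp
          moreover have "take (Suc (Suc i)) E0 = take (Suc (Suc i)) A"
            unfolding E0_def using True by (simp add: min_def)
          ultimately show ?thesis
            using mx[OF take_mem[OF WT(1)[OF wl(1)]], of "Suc i"] True WT(2)[OF wl(1)] by simp
        next
          case False
          let ?C = "take (Suc (Suc i)) A" and ?v = "take (Suc i) b"
          note C = tB[OF Suc.prems]
          have v: "?v \<in> T" "length ?v = Suc i" using C(4) by (auto intro!: stem_mem simp: length_b)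
          have "?v \<noteq> []" using v(2) by auto
          then have "butlast (br S ?v) = br S (butlast ?v)" by (rule butlast_block_bracket)
          also have "\<dots> = max_bracket T i"
            using mx[of "butlast ?v"] v take_mem[OF v(1), of i] by (simp add: butlast_conv_take)
          also have "\<dots> = take (Suc i) A" using Suc by simp
          also have "\<dots> = butlast ?C" using Suc.prems by (simp add: butlast_take)
          finally have but: "butlast (br S ?v) = butlast ?C" .
          have "?C \<in> brackets_over B (butlast (br S ?v))"
            unfolding but brackets_over_def using C(1,2) Suc.prems by simp
          then have "\<not> bracket_less ?C (br S ?v)"
            using False v by (intro Sg(5)) auto
          moreover have "bracket_le ?C (br S ?v)"
          proof -
            have "?C ! j \<subseteq> level T j" if "j \<le> Suc i" for j
              using C(3) that unfolding is_bracket_def by blast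
            then show ?thesis
              unfolding mx[OF v(1)] v(2) bracket_le_def max_bracket_def
              using C(2) by (simp add: less_Suc_eq_le del: upt_Suc take_Suc_Cons)
          qed
          ultimately show ?thesis using mx[OF v(1)] v(2) by (simp add: bracket_less_def)
        qed
      qed
      from this[of "length A - 1"] have "A = max_bracket T (length A - 1)" using lenA by simp
      moreover have "length A - 1 \<le> length t" using is_bracketB(2)[OF A(1)] .
      ultimately have "\<exists>k\<le>length t. A = max_bracket T k" by blast
      then show False using A(2) unfolding nontrivial_iff is_max_bracket_iff by blast
    qed
    then show ?thesis using cS Sg(4) by blast
  qed
qed

end

text \<open>The gaps spanned by the pair on each level. Below the top level of the unit the
  branching vertex is added to the pair, because every bracket that reaches higher contains
  it.\<close>

definition unit_gaps :: "nat list \<Rightarrow> nat list \<Rightarrow> (nat \<Rightarrow> vertex set) \<Rightarrow> (nat \<times> nat) set" where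
  "unit_gaps t b c = {(k, p) \<in> coords t. c k \<noteq> {} \<and>
     (\<exists>u \<in> c k \<union> (if k < unit_level c then {take k b} else {}). last u < p) \<and>
     (\<exists>u \<in> c k \<union> (if k < unit_level c then {take k b} else {}). p \<le> last u)}"

section \<open>Collisions as atoms\<close>

context stem
begin

lemma bracketings_iff: "X \<in> bracketings T \<longleftrightarrow> is_bracketing T (fst X) (snd X)"
  by (simp add: bracketings_def case_prod_beta)

text \<open>Both orders are \<open>block_order\<close> of their bracket sets, so the restriction
  condition is automatic.\<close>

lemma bracketing_le_iff:
  assumes "X \<in> bracketings T" "Y \<in> bracketings T"
  shows "bracketing_le X Y \<longleftrightarrow> fst X \<subseteq> fst Y"
proof -
  have "snd X = block_order (fst X)" "snd Y = block_order (fst Y)"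
    using assms bracketing_order unfolding bracketings_iff by blast+
  then show ?thesis unfolding bracketing_le_def by (auto simp: block_order_def)
qed

lemma bracketing_eqI:
  assumes "X \<in> bracketings T" "Y \<in> bracketings T" "fst X = fst Y"
  shows "X = Y"
proof -
  have "snd X = block_order (fst X)" "snd Y = block_order (fst Y)"
    using assms(1,2) bracketing_order unfolding bracketings_iff by blast+
  then show ?thesis using assms(3) by (simp add: prod_eq_iff)
qed

definition collision_of :: "(nat \<times> nat) set \<Rightarrow> bracketing" where
  "collision_of S = (collision_brackets S, block_order (collision_brackets S))"

lemma fst_collision_of [simp]: "fst (collision_of S) = collision_brackets S"
  by (simp add: collision_of_def)

lemma collision_of_bracketing: "S \<subseteq> coords t \<Longrightarrow> collision_of S \<in> bracketings T"
  unfolding bracketings_iff collision_of_def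
  using is_bracketing_collision_brackets by simp

lemma trivial_brackets_subset:
  assumes "X \<in> bracketings T"
  shows "collision_brackets {} \<subseteq> fst X"
proof -
  have X: "is_bracketing T (fst X) (snd X)" using assms by (simp add: bracketings_iff)
  have "br {} v \<in> fst X" "br (coords t) v \<in> fst X" if "v \<in> T" for v
    using is_bracketingD(5,6)[OF X] length_le[OF that] that
    by (simp_all add: block_bracket_empty block_bracket_coords depth)
  then show ?thesis by (auto simp: collision_brackets_iff)
qed

text \<open>Singleton and maximum brackets belong to every bracketing and already form one by
  themselves, namely \<open>collision_of {}\<close>.\<close>

lemma is_min_bracketing_iff:
  assumes "X \<in> bracketings T"
  shows "is_min_bracketing T X \<longleftrightarrow> (\<forall>A\<in>fst X. \<not> nontrivial T A)"
proof
  assume "is_min_bracketing T X"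
  then have "bracketing_le X (collision_of {})"
    using collision_of_bracketing[of "{}"] by (simp add: is_min_bracketing_def)
  then have "fst X \<subseteq> collision_brackets {}"
    using bracketing_le_iff[OF assms collision_of_bracketing[of "{}"]] by simp
  then show "\<forall>A\<in>fst X. \<not> nontrivial T A"
    unfolding nontrivial_iff using collision_brackets_iff[of _ "{}"] by blast
next
  assume "\<forall>A\<in>fst X. \<not> nontrivial T A"
  then have "fst X \<subseteq> collision_brackets {}"
    unfolding nontrivial_iff using collision_brackets_iff[of _ "{}"] by blast
  then have "bracketing_le X Y" if "Y \<in> bracketings T" for Y
    using trivial_brackets_subset[OF that] bracketing_le_iff[OF assms that] by blast
  then show "is_min_bracketing T X" using assms by (simp add: is_min_bracketing_def)
qed

lemma collision_of_not_min:
  assumes S: "collision_set t b S a l r" "S \<noteq> coords t"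
  shows "\<not> is_min_bracketing T (collision_of S)"
proof -
  obtain u where u: "u \<in> T" "length u = a" "last u = l"
    using fused_two[OF S(1)] by blast
  then have "br S u \<noteq> br {} u"
    using block_bracket_collision_singleton_iff[OF S(1) u(1)] collision_setD(4)[OF S(1)] by simp
  then obtain v where "v \<in> T" "nontrivial T (br S v)"
    using nontrivial_above[OF S u(1)] by blast
  then show ?thesis
    using is_min_bracketing_iff[OF collision_of_bracketing[OF collision_setD(1)[OF S(1)]]]
      collision_brackets_iff[of _ S] by auto
qed

lemma collision_set_below_bracketing:
  assumes "X \<in> bracketings T" "\<not> is_min_bracketing T X"
  shows "\<exists>S a l r. collision_set t b S a l r \<and> S \<noteq> coords t \<and> collision_brackets S \<subseteq> fst X"
proof -
  obtain A where A: "A \<in> fst X" "nontrivial T A"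
    using assms is_min_bracketing_iff by blast
  interpret stem_bracketing t b T "fst X" "snd X"
    using assms(1) by unfold_locales (simp add: bracketings_iff)
  obtain S a l r where S: "collision_set t b S a l r" "S \<noteq> coords t" "br S ` T \<subseteq> fst X"
    using collision_set_below[OF A] by blast
  then have "collision_brackets S \<subseteq> fst X"
    using trivial_brackets_subset[OF assms(1)] collision_brackets_iff[of _ S]
      collision_brackets_iff[of _ "{}"] by blast
  then show ?thesis using S by blast
qed

text \<open>Every nonminimal bracketing contains the brackets of a proper connected set, so an atom
  equals one of these bracketings. Conversely, anything nonminimal below such a bracketing contains
  another one, and \<open>collision_brackets_antichain\<close> identifies the two.\<close>

lemma collisions_eq:
  "collisions T = collision_of ` {S. S \<noteq> coords t \<and> (\<exists>a l r. collision_set t b S a l r)}"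
proof (intro equalityI subsetI)
  fix C assume "C \<in> collisions T"
  then have C: "C \<in> bracketings T" "\<not> is_min_bracketing T C"
    "\<And>X. X \<in> bracketings T \<Longrightarrow> bracketing_le X C \<Longrightarrow> X = C \<or> is_min_bracketing T X"
    by (auto simp: collisions_def)
  obtain S a l r where S: "collision_set t b S a l r" "S \<noteq> coords t" "collision_brackets S \<subseteq> fst C"
    using collision_set_below_bracketing[OF C(1,2)] by blast
  have X: "collision_of S \<in> bracketings T"
    using collision_of_bracketing[OF collision_setD(1)[OF S(1)]] .
  have "bracketing_le (collision_of S) C" using bracketing_le_iff[OF X C(1)] S(3) by simp
  then have "collision_of S = C"
    using C(3)[OF X] collision_of_not_min[OF S(1,2)] by simp
  then show "C \<in> collision_of ` {S. S \<noteq> coords t \<and> (\<exists>a l r. collision_set t b S a l r)}"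
    using S by blast
next
  fix C assume "C \<in> collision_of ` {S. S \<noteq> coords t \<and> (\<exists>a l r. collision_set t b S a l r)}"
  then obtain S a l r where C: "C = collision_of S" and S: "collision_set t b S a l r" "S \<noteq> coords t"
    by blast
  have CB: "C \<in> bracketings T"
    unfolding C using collision_of_bracketing[OF collision_setD(1)[OF S(1)]] .
  have "X = C" if X: "X \<in> bracketings T" "bracketing_le X C" "\<not> is_min_bracketing T X" for X
  proof -
    obtain S' a' l' r' where S': "collision_set t b S' a' l' r'" "S' \<noteq> coords t"
      "collision_brackets S' \<subseteq> fst X"
      using collision_set_below_bracketing[OF X(1,3)] by blast
    have le: "fst X \<subseteq> collision_brackets S"
      using X(2) bracketing_le_iff[OF X(1) CB] by (simp add: C)
    have "br S' ` T \<subseteq> collision_brackets S"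
      using S'(3) le collision_brackets_iff[of _ S'] by blast
    then have "S' = S" using collision_brackets_antichain[OF S(1) S'(1,2)] by simp
    then have "fst X = fst C" using S'(3) le C by simp
    then show ?thesis using bracketing_eqI[OF X(1) CB] by simp
  qed
  then show "C \<in> collisions T"
    using CB collision_of_not_min[OF S] by (auto simp: collisions_def C)
qed

lemma Nil_notin_collision_brackets: "[] \<notin> collision_brackets S"
  unfolding collision_brackets_iff using block_bracket_not_Nil by (metis imageE)

lemma funpow_butlast_block_bracket:
  "l \<le> length v \<Longrightarrow> (butlast ^^ l) (br S v) = br S (take (length v - l) v)"
  using take_block_bracket[of "length v - l" v T S]
  by (simp add: butlast_power length_block_bracket Suc_diff_le)

lemma funpow_butlast_Nil: "length v < l \<Longrightarrow> (butlast ^^ l) (br S v) = []"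
  by (simp add: butlast_power length_block_bracket)

section \<open>Fusion bracket, essential brackets and ray generator\<close>

context
  fixes S a l r
  assumes S: "collision_set t b S a l r" and proper: "S \<noteq> coords t"
begin

lemma is_projection_block_bracket:
  assumes u: "u \<in> T" "br S u \<noteq> br {} u"
  shows "is_projection_of_nontrivial T (collision_of S) (br S u)"
proof -
  obtain v where v: "v \<in> T" "nontrivial T (br S v)" "length u \<le> length v"
    "br S u = br S (take (length u) v)"
    using nontrivial_above[OF S proper u] by blast
  have "br S u = (butlast ^^ (length v - length u)) (br S v)"
    using funpow_butlast_block_bracket[of "length v - length u" v S] v(3,4) by simp
  moreover have "br S v \<in> fst (collision_of S)"
    using v(1) by (simp add: collision_brackets_iff)
  ultimately show ?thesis using v(2) unfolding is_projection_of_nontrivial_def by blast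
qed

lemma projection_is_block_bracket:
  assumes "is_projection_of_nontrivial T (collision_of S) E" "E \<noteq> []"
  shows "\<exists>u\<in>T. E = br S u"
proof -
  obtain A m where A: "A \<in> collision_brackets S" "nontrivial T A" "E = (butlast ^^ m) A"
    using assms(1) unfolding is_projection_of_nontrivial_def by auto
  then obtain v where v: "v \<in> T" "A = br S v"
    unfolding collision_brackets_iff nontrivial_iff by blast
  have "m \<le> length v" using funpow_butlast_Nil[of v m S] assms(2) A(3) v(2) by force
  then show ?thesis
    using funpow_butlast_block_bracket[of m v S] A(3) v take_mem[OF v(1)] by auto
qed

lemma is_singleton_block_bracket_iff:
  assumes u: "u \<in> T"
  shows "is_singleton_bracket T (br S u) \<longleftrightarrow> br S u = br {} u"
proof
  assume "is_singleton_bracket T (br S u)"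
  then obtain w where "w \<in> T" "br {} w = br S u"
    unfolding is_singleton_bracket_iff by fastforce
  then show "br S u = br {} u"
    using block_bracket_eqI[of "{}" w S u] u by simp
qed (use u in \<open>simp add: is_singleton_bracket_iff\<close>)

text \<open>A nonsingleton block bracket whose projection is a singleton must be based at a fused
  vertex of level \<open>a\<close>, and all fused vertices give the same bracket.\<close>

lemma fusion_bracket_eq:
  assumes w: "w \<in> T" "length w = a" "l \<le> last w" "last w \<le> r"
  shows "fusion_bracket T (collision_of S) = br S w"
  unfolding fusion_bracket_def
proof (rule the_equality)
  note sing = block_bracket_collision_singleton_iff[OF S]
  have a1: "1 \<le> a" using collision_setD(2)[OF S] .
  have "w \<noteq> []" using w(2) a1 by auto
  have wns: "br S w \<noteq> br {} w" using sing[OF w(1)] w by simp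
  have bw: "butlast w \<in> T" "length (butlast w) < a"
    using w a1 take_mem[OF w(1), of "length w - 1"] by (auto simp: butlast_conv_take)
  have "br S (butlast w) = br {} (butlast w)"
    using sing[OF bw(1)] bw(2) by simp
  then have "is_singleton_bracket T (butlast (br S w))"
    using butlast_block_bracket[OF \<open>w \<noteq> []\<close>] is_singleton_block_bracket_iff[OF bw(1)] by simp
  then show "br S w \<in> fst (collision_of S) \<and>
      \<not> is_singleton_bracket T (br S w) \<and>
      is_singleton_bracket T (butlast (br S w)) \<and>
      is_projection_of_nontrivial T (collision_of S) (br S w)"
    using is_projection_block_bracket[OF w(1) wns] is_singleton_block_bracket_iff[OF w(1)] wns w(1)
    by (simp add: collision_brackets_iff)
  fix E assume E: "E \<in> fst (collision_of S) \<and> \<not> is_singleton_bracket T E \<and>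
    is_singleton_bracket T (butlast E) \<and> is_projection_of_nontrivial T (collision_of S) E"
  then have "E \<noteq> []" using Nil_notin_collision_brackets[of S] by auto
  then obtain u where u: "u \<in> T" "E = br S u" using projection_is_block_bracket E by blast
  have uns: "br S u \<noteq> br {} u"
    using E u is_singleton_block_bracket_iff[OF u(1)] by simp
  then have au: "a \<le> length u" "l \<le> last (take a u)" "last (take a u) \<le> r"
    using sing[OF u(1)] by auto
  then have "u \<noteq> []" using a1 by auto
  have bu: "butlast u \<in> T" using take_mem[OF u(1), of "length u - 1"] by (simp add: butlast_conv_take)
  have "br S (butlast u) = br {} (butlast u)"
    using E u(2) butlast_block_bracket[OF \<open>u \<noteq> []\<close>, of T S] is_singleton_block_bracket_iff[OF bu] by simp
  then have bs: "length (butlast u) < a \<or>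
      \<not> (l \<le> last (take a (butlast u)) \<and> last (take a (butlast u)) \<le> r)"
    using sing[OF bu] by simp
  have "length u = a"
  proof (rule ccontr)
    assume "length u \<noteq> a"
    then have "a \<le> length (butlast u)" "take a (butlast u) = take a u"
      using au(1) by (auto simp: take_butlast)
    then show False using bs au by simp
  qed
  then have "u \<in> block T S w" using block_fused[OF S w] u(1) au by simp
  then show "E = br S w" using block_bracket_eq[OF w(1)] u(2) by simp
qed

text \<open>A nonsingleton block bracket projects on level \<open>a\<close> to the block of a fused
  vertex, which is the fusion bracket. Projections of a singleton remain singletons and never reach
  it.\<close>

lemma essential_brackets_eq:
  "essential_brackets T (collision_of S) =
    br S ` {u \<in> T. br S u \<noteq> br {} u}"
proof -
  obtain w where w: "w \<in> T" "length w = a" "last w = l" using fused_two[OF S] by blast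
  have lw: "l \<le> last w" "last w \<le> r" using w collision_setD(4)[OF S] by auto
  have fb: "fusion_bracket T (collision_of S) = br S w"
    using fusion_bracket_eq[OF w(1,2) lw] .
  note sing = block_bracket_collision_singleton_iff[OF S]
  have wns: "br S w \<noteq> br {} w" using sing[OF w(1)] w lw by simp
  show ?thesis
  proof (intro equalityI subsetI)
    fix E assume "E \<in> essential_brackets T (collision_of S)"
    then have E: "E \<in> collision_brackets S" "is_projection_of_nontrivial T (collision_of S) E"
      and "\<exists>j. (butlast ^^ j) E = br S w"
      by (auto simp: essential_brackets_def fb)
    then obtain j where j: "(butlast ^^ j) E = br S w" by blast
    have "E \<noteq> []" using E(1) Nil_notin_collision_brackets by metis
    then obtain u where u: "u \<in> T" "E = br S u" using projection_is_block_bracket E(2) by blast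
    have "br S u \<noteq> br {} u"
    proof
      assume eq: "br S u = br {} u"
      then have jw: "(butlast ^^ j) (br {} u) = br S w" using j u by simp
      have "j \<le> length u"
      proof (rule ccontr)
        assume "\<not> j \<le> length u"
        then show False using funpow_butlast_Nil[of u j "{}"] jw by simp
      qed
      then have "br {} (take (length u - j) u) = br S w"
        using funpow_butlast_block_bracket[of j u "{}"] jw by simp
      from block_bracket_eqI[OF this take_mem[OF u(1)] w(1)] show False using wns by simp
    qed
    then show "E \<in> br S ` {u \<in> T. br S u \<noteq> br {} u}"
      using u by blast
  next
    fix E assume "E \<in> br S ` {u \<in> T. br S u \<noteq> br {} u}"
    then obtain u where u: "u \<in> T" "br S u \<noteq> br {} u" "E = br S u"
      by blast
    then have au: "a \<le> length u" "l \<le> last (take a u)" "last (take a u) \<le> r"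
      using sing[OF u(1)] by auto
    have "take a u \<in> T" "length (take a u) = a" using take_mem[OF u(1)] au(1) by auto
    then have "take a u \<in> block T S w" using block_fused[OF S w(1,2) lw] au by simp
    then have "br S (take a u) = br S w"
      using block_bracket_eq[OF w(1)] by simp
    then have "(butlast ^^ (length u - a)) E = br S w"
      using funpow_butlast_block_bracket[of "length u - a" u S] au(1) u(3) by simp
    moreover have "E \<in> collision_brackets S" using u by (simp add: collision_brackets_iff)
    ultimately show "E \<in> essential_brackets T (collision_of S)"
      using is_projection_block_bracket[OF u(1,2)] u(3) by (auto simp: essential_brackets_def fb)
  qed
qed

text \<open>The two vertices next to a gap lie in a common block exactly when the gap is in
  \<open>S\<close>, and a block with two vertices gives a nonsingleton, hence essential,
  bracket.\<close>

lemma ray_generator_eq: "ray_generator e t T (collision_of S) = sum e S"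
proof -
  have "(\<exists>E\<in>essential_brackets T (collision_of S). length E = Suc k \<and>
      {vtx T k i, vtx T k (Suc i)} \<subseteq> last E) \<longleftrightarrow> (k, i) \<in> S" if ki: "(k, i) \<in> coords t" for k i
  proof -
    let ?x = "take (k - 1) b @ [i - 1]" and ?y = "take (k - 1) b @ [i]"
    note g = gap_iff[OF ki]
    have "k - 1 < length t" "1 \<le> i" "i \<le> t ! (k - 1)" "Suc (k - 1) = k"
      using ki by (auto simp: coords_def)
    then have v: "vtx T k i = ?x" "vtx T k (Suc i) = ?y"
      using vtx[of "k - 1" i] vtx[of "k - 1" "Suc i"] by simp_all
    show ?thesis
    proof
      assume "\<exists>E\<in>essential_brackets T (collision_of S). length E = Suc k \<and>
        {vtx T k i, vtx T k (Suc i)} \<subseteq> last E"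
      then obtain u where u: "u \<in> T" "?x \<in> block T S u" "?y \<in> block T S u"
        unfolding essential_brackets_eq v by (auto simp: last_block_bracket)
      then have "?x \<in> block T S ?y" using block_eq[OF u(3)] by simp
      then show "(k, i) \<in> S" using g(5) by simp
    next
      assume "(k, i) \<in> S"
      then have x: "?x \<in> block T S ?y" using g(5) by simp
      have y: "?y \<in> block T S ?y" using block_refl[OF g(1)] .
      have "?x \<noteq> ?y" using \<open>1 \<le> i\<close> by simp
      then have "block T S ?y \<noteq> block T {} ?y" using x block_empty[OF g(1)] by auto
      then have "br S ?y \<noteq> br {} ?y"
        using last_block_bracket[of T _ ?y] by metis
      then have "br S ?y \<in> essential_brackets T (collision_of S)"
        unfolding essential_brackets_eq using g(1) by blast
      moreover have "length (br S ?y) = Suc k"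
        using g(3) by (simp only: length_block_bracket)
      moreover have "{?x, ?y} \<subseteq> last (br S ?y)"
        using x y by (simp add: last_block_bracket)
      ultimately show "\<exists>E\<in>essential_brackets T (collision_of S). length E = Suc k \<and>
        {vtx T k i, vtx T k (Suc i)} \<subseteq> last E"
        unfolding v by blast
    qed
  qed
  then have "ray_generator e t T (collision_of S) = (\<Sum>p\<in>coords t. if p \<in> S then e p else 0)"
    unfolding ray_generator_def by (intro sum.cong) auto
  also have "\<dots> = sum e S"
    using collision_setD(1)[OF S] finite_coords[of t] by (simp add: sum.If_cases Int_absorb1)
  finally show ?thesis .
qed

end

end

section \<open>Collision units\<close>

context stem
begin

abbreviation gaps :: "(nat \<Rightarrow> vertex set) \<Rightarrow> (nat \<times> nat) set" where
  "gaps \<equiv> unit_gaps t b"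

lemma unitE:
  assumes "c \<in> collision_units T" "c k \<noteq> {}"
  obtains i j where "1 \<le> k" "k \<le> length t" "i < j" "j \<le> t ! (k - 1)"
    "c k = {take (k - 1) b @ [i], take (k - 1) b @ [j]}"
proof -
  have out: "\<forall>k. k \<notin> {1..depth T} \<longrightarrow> c k = {}"
    and pairs: "\<forall>k\<in>{1..depth T}. c k = {} \<or>
        (\<exists>i j. 1 \<le> i \<and> i < j \<and> j \<le> card (level T k) \<and> c k = {vtx T k i, vtx T k j})"
    using assms(1) unfolding collision_units_def by blast+
  have k: "k \<in> {1..depth T}" using out assms(2) by blast
  then obtain i j where ij: "1 \<le> i" "i < j" "j \<le> card (level T k)" "c k = {vtx T k i, vtx T k j}"
    using pairs assms(2) by blast
  have k': "1 \<le> k" "k - 1 < length t" "Suc (k - 1) = k" using k depth by auto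
  have card: "card (level T k) = Suc (t ! (k - 1))" using card_level[OF k'(2)] k'(3) by simp
  have "vtx T k i = take (k - 1) b @ [i - 1]" "vtx T k j = take (k - 1) b @ [j - 1]"
    using vtx[OF k'(2)] ij(1-3) k'(3) card by auto
  then show ?thesis using that[of "i - 1" "j - 1"] k' ij card by auto
qed

lemma unit_subset_level: "c \<in> collision_units T \<Longrightarrow> c k \<subseteq> level T k"
proof (cases "c k = {}")
  case False
  assume c: "c \<in> collision_units T"
  obtain i j where k: "1 \<le> k" "k \<le> length t" "i < j" "j \<le> t ! (k - 1)"
    "c k = {take (k - 1) b @ [i], take (k - 1) b @ [j]}"
    using unitE[OF c False] .
  then show ?thesis using node_level[OF k(1,2), of i] node_level[OF k(1,2), of j] by simp
qed simp

lemma unit_level_props: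
  assumes c: "c \<in> collision_units T"
  shows "c (unit_level c) \<noteq> {}" "1 \<le> unit_level c" "unit_level c \<le> length t"
    "c k \<noteq> {} \<Longrightarrow> k \<le> unit_level c"
proof -
  have sub: "{k. c k \<noteq> {}} \<subseteq> {1..length t}"
  proof
    fix k assume "k \<in> {k. c k \<noteq> {}}"
    then have "c k \<noteq> {}" by simp
    then show "k \<in> {1..length t}" by (rule unitE[OF c]) simp
  qed
  then have fin: "finite {k. c k \<noteq> {}}" using finite_subset by blast
  have ne: "{k. c k \<noteq> {}} \<noteq> {}" using c unfolding collision_units_def by blast
  have "unit_level c \<in> {k. c k \<noteq> {}}" unfolding unit_level_def using Max_in[OF fin ne] .
  then show "c (unit_level c) \<noteq> {}" "1 \<le> unit_level c" "unit_level c \<le> length t" using sub by auto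
  show "c k \<noteq> {} \<Longrightarrow> k \<le> unit_level c" unfolding unit_level_def using Max_ge[OF fin] by simp
qed

text \<open>The vertices of level \<open>k\<close> that must share a block for the unit to fit into
  a block bracket.\<close>

definition unit_span :: "(nat \<Rightarrow> vertex set) \<Rightarrow> nat \<Rightarrow> vertex set" where
  "unit_span c k = c k \<union> (if k < unit_level c then {take k b} else {})"

lemma unit_gaps_iff:
  "(k, p) \<in> gaps c \<longleftrightarrow> (k, p) \<in> coords t \<and> c k \<noteq> {} \<and>
    (\<exists>u \<in> unit_span c k. last u < p) \<and> (\<exists>u \<in> unit_span c k. p \<le> last u)"
  by (simp add: unit_gaps_def unit_span_def)

lemma unit_span_subset_level:
  assumes "c \<in> collision_units T"
  shows "unit_span c k \<subseteq> level T k"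
proof -
  have "take k b \<in> level T k" if "k < unit_level c"
    using that unit_level_props(3)[OF assms] by (auto simp: level_def length_b intro!: stem_mem)
  then show ?thesis using unit_subset_level[OF assms] by (auto simp: unit_span_def)
qed

lemma subset_block_iff:
  assumes W: "W \<subseteq> level T k" and k: "1 \<le> k" "k \<le> length t" and v: "v \<in> W"
  shows "W \<subseteq> block T S v \<longleftrightarrow>
    (\<forall>p. (k, p) \<in> coords t \<longrightarrow> (\<exists>u\<in>W. last u < p) \<longrightarrow> (\<exists>u\<in>W. p \<le> last u) \<longrightarrow> (k, p) \<in> S)"
proof -
  have WT: "u \<in> T" "length u = k" "last u \<le> t ! (k - 1)" if "u \<in> W" for u
    using W that level_nodeE(2)[of u k] k by (auto simp: level_def)
  show ?thesis
  proof
    assume sub: "W \<subseteq> block T S v"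
    show "\<forall>p. (k, p) \<in> coords t \<longrightarrow> (\<exists>u\<in>W. last u < p) \<longrightarrow> (\<exists>u\<in>W. p \<le> last u) \<longrightarrow> (k, p) \<in> S"
    proof (intro allI impI)
      fix p assume "\<exists>u\<in>W. last u < p" "\<exists>u\<in>W. p \<le> last u"
      then obtain x y where x: "x \<in> W" "last x < p" and y: "y \<in> W" "p \<le> last y" by blast
      have g: "(k, q) \<in> S" if "u \<in> W" "min (last v) (last u) < q" "q \<le> max (last v) (last u)" for u q
        using that sub WT(2)[OF v] unfolding block_def by blast
      show "(k, p) \<in> S"
      proof (cases "p \<le> last v")
        case True
        then show ?thesis using g[OF x(1), of p] x(2) by simp
      next
        case False
        then show ?thesis using g[OF y(1), of p] y(2) by simp
      qed
    qed
  next
    assume gaps: "\<forall>p. (k, p) \<in> coords t \<longrightarrow> (\<exists>u\<in>W. last u < p) \<longrightarrow> (\<exists>u\<in>W. p \<le> last u) \<longrightarrow> (k, p) \<in> S"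
    show "W \<subseteq> block T S v"
    proof
      fix w assume w: "w \<in> W"
      have "(k, p) \<in> S" if p: "min (last v) (last w) < p" "p \<le> max (last v) (last w)" for p
      proof -
        have "(k, p) \<in> coords t" using p k WT(3)[OF v] WT(3)[OF w] by (auto simp: coords_def)
        moreover have "\<exists>u\<in>W. last u < p" using p(1) v w unfolding min_def by (metis (full_types))
        moreover have "\<exists>u\<in>W. p \<le> last u" using p(2) v w unfolding max_def by (metis (full_types))
        ultimately show ?thesis using gaps by blast
      qed
      then show "w \<in> block T S v" using WT[OF v] WT[OF w] unfolding block_def by simp
    qed
  qed
qed

lemma unit_gaps_subset_iff:
  assumes c: "c \<in> collision_units T"
  shows "gaps c \<subseteq> S \<longleftrightarrow>
    (\<forall>k. c k \<noteq> {} \<longrightarrow> (\<forall>v\<in>unit_span c k. unit_span c k \<subseteq> block T S v))"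
proof -
  have "gaps c \<subseteq> S \<longleftrightarrow> (\<forall>k. c k \<noteq> {} \<longrightarrow> (\<forall>p. (k, p) \<in> coords t \<longrightarrow>
      (\<exists>u\<in>unit_span c k. last u < p) \<longrightarrow> (\<exists>u\<in>unit_span c k. p \<le> last u) \<longrightarrow> (k, p) \<in> S))"
    unfolding subset_iff split_paired_All unit_gaps_iff by blast
  also have "\<dots> \<longleftrightarrow> (\<forall>k. c k \<noteq> {} \<longrightarrow> (\<forall>v\<in>unit_span c k. unit_span c k \<subseteq> block T S v))"
  proof (intro all_cong1 imp_cong refl)
    fix k assume k: "c k \<noteq> {}"
    have k': "1 \<le> k" "k \<le> length t" by (rule unitE[OF c k], simp)+
    have "unit_span c k \<noteq> {}" using k by (auto simp: unit_span_def)
    then show "(\<forall>p. (k, p) \<in> coords t \<longrightarrow> (\<exists>u\<in>unit_span c k. last u < p) \<longrightarrow>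
        (\<exists>u\<in>unit_span c k. p \<le> last u) \<longrightarrow> (k, p) \<in> S) \<longleftrightarrow>
      (\<forall>v\<in>unit_span c k. unit_span c k \<subseteq> block T S v)"
      using subset_block_iff[OF unit_span_subset_level[OF c] k', of _ S] by blast
  qed
  finally show ?thesis .
qed

lemma unit_span_level: "unit_span c (unit_level c) = c (unit_level c)"
  by (simp add: unit_span_def)

text \<open>Below its top level, \<open>br S u\<close> consists of the blocks of branching vertices,
  so a lower pair fits exactly when it shares a block with the branching vertex. Only the top pair
  depends on \<open>u\<close>.\<close>

lemma units_in_iff:
  assumes c: "c \<in> collision_units T" and u: "u \<in> T"
  shows "c \<in> units_in T (br S u) \<longleftrightarrow>
    unit_level c = length u \<and> c (unit_level c) \<subseteq> block T S u \<and> gaps c \<subseteq> S"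
proof -
  note L = unit_level_props[OF c]
  have "c \<in> units_in T (br S u) \<longleftrightarrow> unit_level c = length u \<and>
      (\<forall>i\<in>{1..unit_level c}. c i \<subseteq> block T S (take i u))"
  proof -
    have "(\<forall>i\<in>{1..length u}. c i \<subseteq> br S u ! i) \<longleftrightarrow>
        (\<forall>i\<in>{1..length u}. c i \<subseteq> block T S (take i u))"
      by (intro ball_cong refl) (simp add: nth_block_bracket)
    then show ?thesis using c by (simp add: units_in_def length_block_bracket cong: conj_cong)
  qed
  moreover have "(\<forall>i\<in>{1..length u}. c i \<subseteq> block T S (take i u)) \<longleftrightarrow>
      c (length u) \<subseteq> block T S u \<and> gaps c \<subseteq> S" if len: "unit_level c = length u"
  proof
    assume a: "\<forall>i\<in>{1..length u}. c i \<subseteq> block T S (take i u)"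
    have top: "c (length u) \<subseteq> block T S u" using a[rule_format, of "length u"] L(2) len by simp
    have "unit_span c k \<subseteq> block T S v" if k: "c k \<noteq> {}" and v: "v \<in> unit_span c k" for k v
    proof -
      have k': "1 \<le> k" "k \<le> length u" using unitE[OF c k] L(4)[OF k] len by simp_all
      have "unit_span c k \<subseteq> block T S (take k u)"
      proof (cases "k = length u")
        case True
        then show ?thesis using top len unit_span_level[of c] by simp
      next
        case False
        then have "take k u = take k b" "k < unit_level c"
          using take_vertex[OF u, of k] k' len by simp_all
        then show ?thesis
          using a[rule_format, of k] k' block_refl[OF take_mem[OF u], of k S]
          by (simp add: unit_span_def)
      qed
      then show ?thesis using block_eq[of v S "take k u"] v by blast
    qed
    then show "c (length u) \<subseteq> block T S u \<and> gaps c \<subseteq> S"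
      using top unfolding unit_gaps_subset_iff[OF c] by blast
  next
    assume a: "c (length u) \<subseteq> block T S u \<and> gaps c \<subseteq> S"
    show "\<forall>i\<in>{1..length u}. c i \<subseteq> block T S (take i u)"
    proof
      fix i assume i: "i \<in> {1..length u}"
      show "c i \<subseteq> block T S (take i u)"
      proof (cases "i = length u \<or> c i = {}")
        case False
        then have il: "i < length u" "c i \<noteq> {}" using i by auto
        then have "take i u = take i b" using take_vertex[OF u] by simp
        moreover have "take i b \<in> unit_span c i" using il len by (simp add: unit_span_def)
        then have "unit_span c i \<subseteq> block T S (take i b)"
          using a il(2) unfolding unit_gaps_subset_iff[OF c] by blast
        ultimately show ?thesis by (auto simp: unit_span_def)
      qed (use a in auto)
    qed
  qed
  ultimately show ?thesis by metis
qed

lemma unit_two: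
  assumes c: "c \<in> collision_units T" and k: "c k \<noteq> {}"
  shows "\<not> c k \<subseteq> {v}"
  by (rule unitE[OF c k]) auto

text \<open>Without gaps every block is a single vertex and cannot hold the top pair.\<close>

lemma unit_gaps_nonempty:
  assumes c: "c \<in> collision_units T"
  shows "gaps c \<noteq> {}"
proof
  assume "gaps c = {}"
  then have "gaps c \<subseteq> {}" by simp
  then have sub: "\<forall>k. c k \<noteq> {} \<longrightarrow> (\<forall>v\<in>unit_span c k. unit_span c k \<subseteq> block T {} v)"
    unfolding unit_gaps_subset_iff[OF c] .
  let ?L = "unit_level c"
  note L = unit_level_props[OF c]
  obtain v where v: "v \<in> c ?L" using L(1) by blast
  then have "c ?L \<subseteq> block T {} v" using sub[rule_format, OF L(1), of v] unit_span_level[of c] by simp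
  moreover have "v \<in> T" using unit_subset_level[OF c] v by (auto simp: level_def)
  ultimately show False using unit_two[OF c L(1), of v] block_empty by simp
qed

lemma unit_gaps_subset_coords: "gaps c \<subseteq> coords t"
  by (auto simp: unit_gaps_def)

text \<open>The top pair of a unit lies in only one block, so the sets \<open>units_in T E\<close>
  are disjoint. If the gaps of a unit lie in \<open>S\<close>, the block of its top pair has two
  vertices and its bracket is essential, so nothing is missed.\<close>

lemma sum_units_in:
  assumes S: "collision_set t b S a l r" "S \<noteq> coords t"
  shows "(\<Sum>E\<in>essential_brackets T (collision_of S). real (card (units_in T E))) =
    real (card {c \<in> collision_units T. gaps c \<subseteq> S})"
proof -
  let ?ess = "essential_brackets T (collision_of S)"
  note ess = essential_brackets_eq[OF S]
  have U: "units_in T E \<subseteq> collision_units T" for E by (auto simp: units_in_def)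
  have finU: "finite (collision_units T)" using finite_collision_units[OF finite_T] .
  have "card (\<Union>E\<in>?ess. units_in T E) = (\<Sum>E\<in>?ess. card (units_in T E))"
  proof (rule card_UN_disjoint)
    show "finite ?ess" unfolding ess using finite_T by simp
    show "\<forall>E\<in>?ess. finite (units_in T E)" using finU U finite_subset by blast
    show "\<forall>E\<in>?ess. \<forall>E'\<in>?ess. E \<noteq> E' \<longrightarrow> units_in T E \<inter> units_in T E' = {}"
    proof (intro ballI impI)
      fix E E' assume E: "E \<in> ?ess" and E': "E' \<in> ?ess" and ne: "E \<noteq> E'"
      obtain u where u: "u \<in> T" "E = br S u" using E unfolding ess by blast
      obtain u' where u': "u' \<in> T" "E' = br S u'" using E' unfolding ess by blast
      have False if c: "c \<in> units_in T E" "c \<in> units_in T E'" for c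
      proof -
        have cU: "c \<in> collision_units T" using c(1) U by blast
        have "c (unit_level c) \<subseteq> block T S u" "c (unit_level c) \<subseteq> block T S u'"
          using c unfolding u(2) u'(2) units_in_iff[OF cU u(1)] units_in_iff[OF cU u'(1)] by blast+
        then obtain x where "x \<in> block T S u" "x \<in> block T S u'"
          using unit_level_props(1)[OF cU] by blast
        then have "E = E'"
          using block_bracket_eq[OF u(1), of x S] block_bracket_eq[OF u'(1), of x S] u(2) u'(2) by simp
        then show False using ne by simp
      qed
      then show "units_in T E \<inter> units_in T E' = {}" by blast
    qed
  qed
  moreover have "(\<Union>E\<in>?ess. units_in T E) = {c \<in> collision_units T. gaps c \<subseteq> S}"
  proof (intro equalityI subsetI)
    fix c assume "c \<in> (\<Union>E\<in>?ess. units_in T E)"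
    then obtain u where u: "u \<in> T" "c \<in> units_in T (br S u)" unfolding ess by blast
    then have cU: "c \<in> collision_units T" using U by blast
    then show "c \<in> {c \<in> collision_units T. gaps c \<subseteq> S}"
      using units_in_iff[OF cU u(1)] u(2) by simp
  next
    fix c assume "c \<in> {c \<in> collision_units T. gaps c \<subseteq> S}"
    then have c: "c \<in> collision_units T" "gaps c \<subseteq> S" by auto
    let ?L = "unit_level c"
    note L = unit_level_props[OF c(1)]
    obtain u where u: "u \<in> c ?L" using L(1) by blast
    have uT: "u \<in> T" "length u = ?L" using u unit_subset_level[OF c(1)] by (auto simp: level_def)
    have cu: "c ?L \<subseteq> block T S u"
      using c(2) u L(1) unit_span_level[of c] unfolding unit_gaps_subset_iff[OF c(1)] by metis
    then have "block T S u \<noteq> block T {} u"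
      using unit_two[OF c(1) L(1), of u] block_empty[OF uT(1)] by auto
    then have "br S u \<noteq> br {} u"
      using last_block_bracket[of T _ u] by metis
    then have "br S u \<in> ?ess" unfolding ess using uT(1) by blast
    moreover have "c \<in> units_in T (br S u)"
      using units_in_iff[OF c(1) uT(1)] c(2) cu uT(2) by simp
    ultimately show "c \<in> (\<Union>E\<in>?ess. units_in T E)" by blast
  qed
  ultimately show ?thesis by (metis of_nat_sum)
qed

text \<open>If the branching vertex of the lowest level \<open>a\<close> has a nontrivial block,
  that block is taken together with everything above it; otherwise one block of level
  \<open>a\<close> is taken alone. No unit is cut: a unit with a pair on level \<open>a\<close> that
  reaches higher involves the branching vertex, and any other unit lies either on level
  \<open>a\<close> or strictly above it.\<close>

lemma split_collision_set:
  assumes S: "S \<subseteq> coords t" "S \<noteq> {}"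
  shows "\<exists>S1 a l r. S1 \<subseteq> S \<and> collision_set t b S1 a l r \<and>
    (\<forall>c\<in>collision_units T. gaps c \<subseteq> S \<longrightarrow>
      gaps c \<subseteq> S1 \<or> gaps c \<subseteq> S - S1)"
proof -
  define a where "a = (LEAST k. \<exists>p. (k, p) \<in> S)"
  have "\<exists>k p. (k, p) \<in> S" using S(2) by auto
  then obtain p0 where p0: "(a, p0) \<in> S" unfolding a_def using LeastI_ex[of "\<lambda>k. \<exists>p. (k, p) \<in> S"] by blast
  have least: "a \<le> k" if "(k, p) \<in> S" for k p unfolding a_def using that by (intro Least_le) blast
  have cp: "(a, p0) \<in> coords t" using p0 S(1) by blast
  then have a1: "1 \<le> a" "a \<le> length t" by (auto simp: coords_def)
  define nt where "nt \<longleftrightarrow> block T S (take a b) \<noteq> {take a b}"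
  \<comment> \<open>Base of the piece to be split off: the branching vertex if its block is
    nontrivial, else the right end of some gap of \<open>S\<close> on level
    \<open>a\<close>.\<close>
  define v0 where "v0 = (if nt then take a b else take (a - 1) b @ [p0])"
  have stem: "take a b \<in> T" "length (take a b) = a" "last (take a b) = b ! (a - 1)"
    using a1 last_stem[OF a1] by (auto simp: length_b intro!: stem_mem)
  note g = gap_iff[OF cp]
  have v0: "v0 \<in> T" "length v0 = a" using stem g by (auto simp: v0_def)
  define W where "W = block T S v0"
  have W: "v0 \<in> W" "W \<subseteq> level T a"
    using block_refl[OF v0(1)] block_subset_level[of S v0] v0(2) by (auto simp: W_def)
  have two: "\<exists>w\<in>W. w \<noteq> v0"
  proof (cases nt)
    case True
    then show ?thesis using W(1) by (auto simp: nt_def v0_def W_def)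
  next
    case False
    have "1 \<le> p0" using cp by (auto simp: coords_def)
    then have "take (a - 1) b @ [p0 - 1] \<noteq> v0" using False by (simp add: v0_def)
    moreover have "take (a - 1) b @ [p0 - 1] \<in> W" using False g(5)[of S] p0 by (simp add: v0_def W_def)
    ultimately show ?thesis by blast
  qed
  have WT: "w \<in> T" "length w = a" if "w \<in> W" for w using that W(2) by (auto simp: level_def)
  obtain w where w: "w \<in> W" "v0 \<noteq> w" using two by blast
  have "\<forall>x\<in>W. \<forall>y\<in>W. \<forall>z\<in>level T a. last x \<le> last z \<and> last z \<le> last y \<longrightarrow> z \<in> W"
  proof (intro ballI impI)
    fix x y z assume "x \<in> W" "y \<in> W" "z \<in> level T a" "last x \<le> last z \<and> last z \<le> last y"
    then show "z \<in> W" using block_convex[of x S v0 y z] v0(2) by (simp add: W_def level_def)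
  qed
  from level_interval[OF W(2,1) w a1 this]
  obtain l r wl wr where "l < r" and rt: "r \<le> t ! (a - 1)"
    and wl: "wl \<in> W" "last wl = l" and wr: "wr \<in> W" "last wr = r"
    and W_eq: "W = {w \<in> T. length w = a \<and> l \<le> last w \<and> last w \<le> r}"
    by blast
  have W_iff: "w \<in> W \<longleftrightarrow> l \<le> last w \<and> last w \<le> r" if "w \<in> T" "length w = a" for w
    using that by (simp add: W_eq)
  have lr: "l \<le> last w" "last w \<le> r" if "w \<in> W" for w using W_iff[OF WT[OF that]] that by simp_all
  have Weq: "block T S w = W" if "w \<in> W" for w
    using block_eq[of w S v0] that by (simp add: W_def)
  have gapsW: "(a, q) \<in> S" if "l < q" "q \<le> r" for q
  proof -
    have "wr \<in> block T S wl" using Weq[OF wl(1)] wr(1) by simp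
    then have "\<forall>p. min l r < p \<and> p \<le> max l r \<longrightarrow> (a, p) \<in> S"
      using wl wr WT(2)[OF wl(1)] unfolding block_def by simp
    then show ?thesis using that \<open>l < r\<close> by simp
  qed
  define S1 where "S1 = {(k, q) \<in> S. (k = a \<and> l < q \<and> q \<le> r) \<or> (a < k \<and> nt)}"
  have S1_iff: "(k, q) \<in> S1 \<longleftrightarrow> (k, q) \<in> S \<and> ((k = a \<and> l < q \<and> q \<le> r) \<or> (a < k \<and> nt))" for k q
    by (simp add: S1_def)
  have "(\<forall>(k, p)\<in>S1. k = a) \<or> (l \<le> b ! (a - 1) \<and> b ! (a - 1) \<le> r)"
  proof (cases nt)
    case True
    then have "take a b \<in> W" using W(1) by (simp add: v0_def)
    then show ?thesis using lr stem(3) by metis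
  qed (auto simp: S1_iff)
  then have coll: "collision_set t b S1 a l r"
    unfolding collision_set_def using S(1) a1 \<open>l < r\<close> rt gapsW least
    by (auto simp: S1_iff)
  have "gaps c \<subseteq> S1 \<or> gaps c \<subseteq> S - S1"
    if c: "c \<in> collision_units T" and sub: "gaps c \<subseteq> S" for c
  proof -
    have blk: "unit_span c k \<subseteq> block T S v" if "c k \<noteq> {}" "v \<in> unit_span c k" for k v
      using sub that unfolding unit_gaps_subset_iff[OF c] by blast
    have gS: "(k, p) \<in> S \<and> a \<le> k \<and> c k \<noteq> {}" if "(k, p) \<in> gaps c" for k p
    proof -
      have "(k, p) \<in> S" using sub that by blast
      moreover have "c k \<noteq> {}" using that unfolding unit_gaps_iff by blast
      ultimately show ?thesis using least by blast
    qed
    \<comment> \<open>The span on level \<open>a\<close> lies in a single \<open>S\<close>-block, so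
      it is contained in \<open>W\<close> as soon as it meets \<open>W\<close>.\<close>
    have meet: "l < q \<and> q \<le> r" if aq: "(a, q) \<in> gaps c" and sp: "unit_span c a \<inter> W \<noteq> {}" for q
    proof -
      obtain w where w: "w \<in> unit_span c a" "w \<in> W" using sp by blast
      have "c a \<noteq> {}" using gS[OF aq] by simp
      then have sW: "unit_span c a \<subseteq> W" using blk[OF _ w(1)] Weq[OF w(2)] by simp
      obtain x y where "x \<in> unit_span c a" "last x < q" "y \<in> unit_span c a" "q \<le> last y"
        using aq unfolding unit_gaps_iff by blast
      then show ?thesis using lr[of x] lr[of y] sW by fastforce
    qed
    \<comment> \<open>A span avoiding \<open>W\<close> but using one of its gaps would have vertices
      on both sides of \<open>W\<close>; convexity would merge the two blocks.\<close>
    have miss: "\<not> (l < q \<and> q \<le> r)" if aq: "(a, q) \<in> gaps c" and sp: "unit_span c a \<inter> W = {}" for q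
    proof
      assume q: "l < q \<and> q \<le> r"
      obtain x y where x: "x \<in> unit_span c a" "last x < q" and y: "y \<in> unit_span c a" "q \<le> last y"
        using aq unfolding unit_gaps_iff by blast
      have xyT: "x \<in> T" "length x = a" "y \<in> T" "length y = a"
        using x y unit_span_subset_level[OF c, of a] by (auto simp: level_def)
      have "x \<notin> W" "y \<notin> W" using x y sp by blast+
      then have xl: "last x < l" and yr: "r < last y"
        using W_iff[OF xyT(1,2)] W_iff[OF xyT(3,4)] x(2) y(2) q by auto
      have "c a \<noteq> {}" using gS[OF aq] by simp
      then have yx: "y \<in> block T S x" using blk[OF _ x(1)] y(1) by blast
      have "wl \<in> block T S x"
        using block_convex[OF block_refl[OF xyT(1), of S] yx WT(1)[OF wl(1)]] WT(2)[OF wl(1)]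
          xyT(2) xl yr wl(2) \<open>l < r\<close> by simp
      then have "block T S wl = block T S x" by (rule block_eq)
      then have "x \<in> W" using Weq[OF wl(1)] block_refl[OF xyT(1), of S] by simp
      then show False using \<open>x \<notin> W\<close> by simp
    qed
    have single: "(k, p) \<in> gaps c \<Longrightarrow> k = a" if "\<not> a < unit_level c" for k p
      using gS[of k p] unit_level_props(4)[OF c, of k] that by auto
    show ?thesis
    proof (cases "c a \<noteq> {} \<and> a < unit_level c")
      case True
      then have st: "take a b \<in> unit_span c a" by (simp add: unit_span_def)
      \<comment> \<open>The span contains the branching vertex and a pair of distinct vertices, so
        the block of the branching vertex is nontrivial.\<close>
      have nt
      proof (rule ccontr)
        assume "\<not> nt"
        then have "unit_span c a \<subseteq> {take a b}" using blk[OF _ st] True by (simp add: nt_def)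
        then show False using unit_two[OF c, of a "take a b"] True by (auto simp: unit_span_def)
      qed
      then have "take a b \<in> W" using W(1) by (simp add: v0_def)
      then have "unit_span c a \<inter> W \<noteq> {}" using st by blast
      then have "(k, p) \<in> S1" if "(k, p) \<in> gaps c" for k p
        using gS[OF that] meet[of p] that \<open>nt\<close> unfolding S1_iff by (cases "k = a") auto
      then show ?thesis by auto
    next
      case False
      show ?thesis
      proof (cases "c a = {}")
        case True
        then have "a < k" if "(k, p) \<in> gaps c" for k p
          using gS[OF that] by (cases "k = a") auto
        then have "(k, p) \<in> S1 \<longleftrightarrow> nt" if "(k, p) \<in> gaps c" for k p
          using gS[OF that] that unfolding S1_iff by auto
        then show ?thesis using sub by (cases nt) auto
      next
        case ne: False
        then have nl: "\<not> a < unit_level c" using False by simp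
        show ?thesis
        proof (cases "unit_span c a \<inter> W = {}")
          case True
          then have "(k, p) \<notin> S1" if "(k, p) \<in> gaps c" for k p
            using single[OF nl that] miss[of p] that unfolding S1_iff by auto
          then show ?thesis using sub by auto
        next
          case False
          then have "(k, p) \<in> S1" if "(k, p) \<in> gaps c" for k p
            using single[OF nl that] meet[of p] gS[OF that] that unfolding S1_iff by auto
          then show ?thesis by auto
        qed
      qed
    qed
  qed
  moreover have "S1 \<subseteq> S" by (auto simp: S1_def)
  ultimately show ?thesis using coll by blast
qed

text \<open>Splitting off a connected piece splits the sum and separates the units inside
  \<open>S\<close>, so the bounds for both pieces add up. The full set is the one case settled by
  the equation \<open>total\<close>.\<close>

lemma all_sets_from_collision_sets:
  fixes f :: "nat \<times> nat \<Rightarrow> real"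
  assumes total: "sum f (coords t) = card (collision_units T)"
    and coll: "\<And>S a l r. collision_set t b S a l r \<Longrightarrow> S \<noteq> coords t \<Longrightarrow>
      sum f S \<ge> card {c \<in> collision_units T. gaps c \<subseteq> S}"
    and S: "S \<subseteq> coords t"
  shows "sum f S \<ge> card {c \<in> collision_units T. gaps c \<subseteq> S}"
  using S
proof (induction "card S" arbitrary: S rule: less_induct)
  case less
  let ?z = "\<lambda>S. {c \<in> collision_units T. gaps c \<subseteq> S}"
  have fin: "finite S" using less.prems finite_coords finite_subset by blast
  consider "S = {}" | "S = coords t" | "S \<noteq> {}" "S \<noteq> coords t" by blast
  then show ?case
  proof cases
    case 1
    then have "?z S = {}" using unit_gaps_nonempty by blast
    then have "card (?z S) = 0" by (simp only: card.empty)
    then show ?thesis using 1 by (simp only: sum.empty of_nat_0 order_refl)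
  next
    case 2
    then have "?z S = collision_units T" using unit_gaps_subset_coords by auto
    then show ?thesis using 2 total by simp
  next
    case 3
    obtain S1 a l r where S1: "S1 \<subseteq> S" "collision_set t b S1 a l r"
      and split: "\<forall>c\<in>collision_units T. gaps c \<subseteq> S \<longrightarrow>
        gaps c \<subseteq> S1 \<or> gaps c \<subseteq> S - S1"
      using split_collision_set[OF less.prems 3(1)] by blast
    \<comment> \<open>The gap \<open>(a, r)\<close> belongs to \<open>S1\<close> because
      \<open>l < r\<close>, so the remainder is strictly smaller.\<close>
    have 1: "S1 \<noteq> {}"
      using collision_setD(4)[OF S1(2)] collision_setD(7)[OF S1(2), of r] by blast
    have z1: "real (card (?z S1)) \<le> sum f S1"
      using coll[OF S1(2)] S1(1) less.prems 3(2) by blast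
    have "card (S - S1) < card S"
      using S1(1) 1 fin by (intro psubset_card_mono) auto
    then have z2: "real (card (?z (S - S1))) \<le> sum f (S - S1)"
      using less.hyps[of "S - S1"] less.prems by blast
    have finU: "finite (collision_units T)" using finite_collision_units[OF finite_T] .
    have "?z S \<subseteq> ?z S1 \<union> ?z (S - S1)" using split by blast
    then have "card (?z S) \<le> card (?z S1 \<union> ?z (S - S1))"
      using finU by (intro card_mono) auto
    also have "\<dots> \<le> card (?z S1) + card (?z (S - S1))" by (rule card_Un_le)
    finally have "real (card (?z S)) \<le> real (card (?z S1)) + real (card (?z (S - S1)))"
      by linarith
    also have "\<dots> \<le> sum f S1 + sum f (S - S1)" using z1 z2 by linarith
    also have "\<dots> = sum f S" using sum.subset_diff[OF S1(1) fin, of f] by simp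
    finally show ?thesis .
  qed
qed

text \<open>The definition imposes the bounds of \<open>minkowski_sum_simplices\<close> only for
  proper connected gap sets; \<open>all_sets_from_collision_sets\<close> supplies the
  others.\<close>

theorem tree_polytope_eq:
  fixes e :: "nat \<times> nat \<Rightarrow> 'a::euclidean_space"
  assumes e: "bij_betw e (coords t) Basis"
  shows "tree_polytope e t T = (\<Sum>c\<in>collision_units T. convex hull (e ` gaps c))"
proof -
  let ?z = "\<lambda>S. real (card {c \<in> collision_units T. gaps c \<subseteq> S})"
  have "(\<forall>C\<in>collisions T. ray_generator e t T C \<bullet> x \<ge>
        (\<Sum>E\<in>essential_brackets T C. real (card (units_in T E)))) \<longleftrightarrow>
      (\<forall>S a l r. collision_set t b S a l r \<longrightarrow> S \<noteq> coords t \<longrightarrow> ?z S \<le> (\<Sum>p\<in>S. x \<bullet> e p))" for x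
  proof -
    have eqs: "ray_generator e t T (collision_of S) \<bullet> x = (\<Sum>p\<in>S. x \<bullet> e p)"
      "(\<Sum>E\<in>essential_brackets T (collision_of S). real (card (units_in T E))) = ?z S"
      if "collision_set t b S a l r" "S \<noteq> coords t" for S a l r
      using ray_generator_eq[OF that, of e] sum_units_in[OF that]
      by (simp_all add: inner_sum_left inner_commute[of x])
    show ?thesis (is "?L \<longleftrightarrow> ?R")
    proof
      assume L: ?L
      show ?R
      proof (intro allI impI)
        fix S a l r assume S: "collision_set t b S a l r" "S \<noteq> coords t"
        then have "collision_of S \<in> collisions T" unfolding collisions_eq by blast
        then show "?z S \<le> (\<Sum>p\<in>S. x \<bullet> e p)" using L eqs[OF S] by fastforce
      qed
    next
      assume R: ?R
      show ?L
      proof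
        fix C assume "C \<in> collisions T"
        then obtain S a l r where C: "C = collision_of S"
          and S: "collision_set t b S a l r" "S \<noteq> coords t"
          unfolding collisions_eq by blast
        then have "?z S \<le> (\<Sum>p\<in>S. x \<bullet> e p)" using R by blast
        then show "ray_generator e t T C \<bullet> x \<ge> (\<Sum>E\<in>essential_brackets T C. real (card (units_in T E)))"
          using eqs[OF S] C by simp
      qed
    qed
  qed
  then have "tree_polytope e t T = {x. (\<Sum>p\<in>coords t. x \<bullet> e p) = card (collision_units T) \<and>
      (\<forall>S a l r. collision_set t b S a l r \<longrightarrow> S \<noteq> coords t \<longrightarrow> ?z S \<le> (\<Sum>p\<in>S. x \<bullet> e p))}"
    unfolding tree_polytope_def by simp
  also have "\<dots> = {x. (\<Sum>p\<in>coords t. x \<bullet> e p) = card (collision_units T) \<and>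
      (\<forall>S\<subseteq>coords t. ?z S \<le> (\<Sum>p\<in>S. x \<bullet> e p))}"
  proof -
    have "(\<forall>S a l r. collision_set t b S a l r \<longrightarrow> S \<noteq> coords t \<longrightarrow> ?z S \<le> (\<Sum>p\<in>S. x \<bullet> e p)) \<longleftrightarrow>
        (\<forall>S\<subseteq>coords t. ?z S \<le> (\<Sum>p\<in>S. x \<bullet> e p))"
      if "(\<Sum>p\<in>coords t. x \<bullet> e p) = card (collision_units T)" for x
      using all_sets_from_collision_sets[of "\<lambda>p. x \<bullet> e p", OF that] collision_setD(1) by blast
    then show ?thesis by (intro Collect_cong conj_cong refl)
  qed
  also have "\<dots> = (\<Sum>c\<in>collision_units T. convex hull (e ` gaps c))"
    by (rule minkowski_sum_simplices[OF e finite_collision_units[OF finite_T], symmetric])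
      (use unit_gaps_subset_coords unit_gaps_nonempty in blast)
  finally show ?thesis .
qed

section \<open>Comparison with the standard constrainahedron\<close>

lemma T_in_concentrated_trees: "T \<in> concentrated_trees t"
proof -
  have plane: "plane_tree T"
    unfolding plane_tree_def
  proof (intro conjI allI impI)
    show "finite T" by (rule finite_T)
    show "[] \<in> T" by (simp add: mem_T)
    fix u i assume ui: "u @ [i] \<in> T"
    show "u \<in> T" using take_mem[OF ui, of "length u"] by simp
    fix j assume "j < i"
    then show "u @ [j] \<in> T" using ui by (auto simp: mem_T)
  qed
  have conc: "concentrated T"
    unfolding concentrated_def depth
  proof (intro allI impI)
    fix k assume k: "k < length t"
    show "\<exists>!u. u \<in> level T k \<and> children T u \<noteq> {}"
    proof (rule ex1I[of _ "take k b"])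
      show "take k b \<in> level T k \<and> children T (take k b) \<noteq> {}"
        using k level_nonempty[of "Suc k"] stem_mem[of k]
        by (simp add: level_def[of T k] children length_b)
    qed (auto simp: children level_def split: if_splits)
  qed
  have "card (level T k) = t ! (k - 1) + 1" if "k \<in> {1..length t}" for k
    using card_level that by (cases k) auto
  then show ?thesis
    using plane conc unfolding concentrated_trees_def has_profile_def by (simp add: depth)
qed

end

section \<open>Concentrated trees are stem trees\<close>

lemma initial_segment_of_card:
  fixes J :: "nat set"
  assumes "finite J" "\<And>i j. i \<in> J \<Longrightarrow> j < i \<Longrightarrow> j \<in> J"
  shows "J = {..<card J}"
proof (rule card_subset_eq)
  show "J \<subseteq> {..<card J}"
  proof
    fix i assume i: "i \<in> J"
    have "{..i} \<subseteq> J" using assms(2)[OF i] i by (auto simp: le_less)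
    then have "card {..i} \<le> card J" using assms(1) by (rule card_mono[rotated])
    then show "i \<in> {..<card J}" by simp
  qed
qed simp_all

text \<open>A whole level consists of children of one vertex, so each branching vertex is a child of
  the preceding one, and all are prefixes of one word \<open>b\<close>. Closure under smaller
  siblings and the profile fix the child positions.\<close>

lemma concentrated_tree_stem:
  assumes T: "T \<in> concentrated_trees t"
  shows "\<exists>b. stem t b T"
proof -
  let ?n = "length t"
  have fin: "finite T" and nil: "[] \<in> T" and par: "\<And>u i. u @ [i] \<in> T \<Longrightarrow> u \<in> T"
    and sib: "\<And>u i j. u @ [i] \<in> T \<Longrightarrow> j < i \<Longrightarrow> u @ [j] \<in> T"
    and dep: "depth T = ?n" and card: "\<And>k. k < ?n \<Longrightarrow> card (level T (Suc k)) = Suc (t ! k)"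
    and conc: "\<forall>k<?n. \<exists>!u. u \<in> level T k \<and> children T u \<noteq> {}"
    using T by (auto simp: concentrated_trees_def has_profile_def plane_tree_def concentrated_def)
  define s where "s k = (THE u. u \<in> level T k \<and> children T u \<noteq> {})" for k
  have s: "s k \<in> level T k" and s_unique: "\<And>u. u \<in> level T k \<Longrightarrow> children T u \<noteq> {} \<Longrightarrow> u = s k"
    if k: "k < ?n" for k
  proof -
    have ex: "\<exists>!u. u \<in> level T k \<and> children T u \<noteq> {}" using conc k by blast
    show "s k \<in> level T k" using theI'[OF ex] unfolding s_def by blast
    show "u = s k" if "u \<in> level T k" "children T u \<noteq> {}" for u
      using the1_equality[OF ex, of u] that unfolding s_def by simp
  qed
  have lev: "level T (Suc k) = (\<lambda>i. s k @ [i]) ` {..t ! k}" if k: "k < ?n" for k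
  proof -
    define J where "J = {i. s k @ [i] \<in> T}"
    have im: "level T (Suc k) = (\<lambda>i. s k @ [i]) ` J"
    proof (intro equalityI subsetI)
      fix v assume "v \<in> level T (Suc k)"
      then have v: "v \<in> T" "length v = Suc k" by (auto simp: level_def)
      then have "v \<noteq> []" by auto
      then obtain u i where ui: "v = u @ [i]" by (cases v rule: rev_cases) auto
      then have "u \<in> level T k" "v \<in> children T u"
        using v par[of u i] by (auto simp: level_def children_def)
      then have "u = s k" using s_unique[OF k] by blast
      then show "v \<in> (\<lambda>i. s k @ [i]) ` J" using ui v by (simp add: J_def)
    next
      fix v assume "v \<in> (\<lambda>i. s k @ [i]) ` J"
      then show "v \<in> level T (Suc k)" using s[OF k] by (auto simp: J_def level_def)
    qed
    have inj: "inj_on (\<lambda>i. s k @ [i]) J" by (simp add: inj_on_def)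
    have "finite (level T (Suc k))" using fin by (simp add: level_def)
    then have "finite J" using im inj by (simp add: finite_image_iff)
    moreover have "card J = Suc (t ! k)" using card[OF k] im inj by (simp add: card_image)
    ultimately have "J = {..<Suc (t ! k)}"
      using initial_segment_of_card[of J] sib unfolding J_def by auto
    then show ?thesis using im by (simp add: lessThan_Suc_atMost)
  qed
  \<comment> \<open>Entry \<open>k\<close> is the child position of the branching vertex of level
    \<open>k + 1\<close>. On the last level nothing branches; the default 0 satisfies the bound
    \<open>b ! k \<le> t ! k\<close>.\<close>
  define b where "b = map (\<lambda>k. if Suc k < ?n then last (s (Suc k)) else 0) [0..<?n]"
  have lb: "length b = ?n" by (simp add: b_def)
  have s_Suc: "s (Suc k) = s k @ [b ! k]" "b ! k \<le> t ! k" if k: "Suc k < ?n" for k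
  proof -
    have "s (Suc k) \<in> (\<lambda>i. s k @ [i]) ` {..t ! k}" using s[OF k] lev[of k] k by simp
    then show "s (Suc k) = s k @ [b ! k]" "b ! k \<le> t ! k" using k by (auto simp: b_def)
  qed
  have take: "take k b = s k" if "k < ?n" for k
    using that
  proof (induction k)
    case 0
    then show ?case using s[of 0] by (simp add: level_def)
  next
    case (Suc k)
    then show ?case using s_Suc[of k] lb by (simp add: take_Suc_conv_app_nth)
  qed
  have le: "b ! k \<le> t ! k" if "k < ?n" for k
    using s_Suc(2)[of k] that by (cases "Suc k < ?n") (auto simp: b_def)
  have "finite {k. level T k \<noteq> {}}"
    by (rule finite_subset[of _ "length ` T"]) (use fin in \<open>auto simp: level_def\<close>)
  then have bound: "length v \<le> ?n" if "v \<in> T" for v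
    unfolding dep[symmetric] depth_def using that by (intro Max_ge) (auto simp: level_def)
  have "T = stem_tree t b"
  proof (intro equalityI subsetI)
    fix v assume v: "v \<in> T"
    show "v \<in> stem_tree t b"
    proof (cases "length v")
      case (Suc k)
      then have k: "k < ?n" using bound[OF v] by simp
      have "v \<in> level T (Suc k)" using v Suc by (simp add: level_def)
      then obtain i where "i \<le> t ! k" "v = take k b @ [i]" using lev[OF k] take[OF k] by auto
      then show ?thesis using k by (auto simp: stem_tree_def)
    qed (simp add: stem_tree_def)
  next
    fix v assume "v \<in> stem_tree t b"
    then consider "v = []" | k j where "k < ?n" "j \<le> t ! k" "v = take k b @ [j]"
      by (auto simp: stem_tree_def)
    then show "v \<in> T"
    proof cases
      case 2
      then have "v \<in> level T (Suc k)" using lev[OF 2(1)] take[OF 2(1)] by simp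
      then show ?thesis by (simp add: level_def)
    qed (use nil in simp)
  qed
  then have "stem t b T" using lb le by unfold_locales auto
  then show ?thesis by blast
qed

section \<open>Summands of the standard constrainahedron as gap sets of units\<close>

context stem
begin

text \<open>A unit with one nonempty component may use any two vertices, and no branching vertex is
  added on its top level. The gaps \<open>i\<close> to \<open>j\<close> lie between the vertices
  with indices \<open>i\<close> and \<open>j + 1\<close>.\<close>

lemma interval_is_unit_gaps:
  assumes k: "1 \<le> k" "k \<le> length t" and ij: "1 \<le> i" "i < j" "j \<le> t ! (k - 1)"
  shows "\<exists>c\<in>collision_units T. gaps c = {(k, l) |l. i \<le> l \<and> l \<le> j}"
proof -
  define c where "c m = (if m = k then {vtx T k i, vtx T k (Suc j)} else {})" for m
  have k': "k - 1 < length t" "Suc (k - 1) = k" using k by auto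
  have v: "vtx T k i = take (k - 1) b @ [i - 1]" "vtx T k (Suc j) = take (k - 1) b @ [j]"
    using vtx[OF k'(1), of i] vtx[OF k'(1), of "Suc j"] k'(2) ij by simp_all
  have card: "card (level T k) = Suc (t ! (k - 1))" using card_level[OF k'(1)] k'(2) by simp
  have supp: "{m. c m \<noteq> {}} = {k}" by (auto simp: c_def)
  have "c \<in> collision_units T"
    unfolding collision_units_def depth mem_Collect_eq supp
  proof (intro conjI)
    show "\<forall>m\<in>{1..length t}. c m = {} \<or> (\<exists>i j. 1 \<le> i \<and> i < j \<and> j \<le> card (level T m) \<and>
        c m = {vtx T m i, vtx T m j})"
    proof
      fix m
      show "c m = {} \<or> (\<exists>i j. 1 \<le> i \<and> i < j \<and> j \<le> card (level T m) \<and> c m = {vtx T m i, vtx T m j})"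
      proof (cases "m = k")
        case True
        have "1 \<le> i \<and> i < Suc j \<and> Suc j \<le> card (level T m) \<and> c m = {vtx T m i, vtx T m (Suc j)}"
          using ij card True by (simp add: c_def)
        then show ?thesis by blast
      qed (simp add: c_def)
    qed
    show "\<exists>m. c m \<noteq> {}" using supp by blast
  qed (use k in \<open>auto simp: c_def\<close>)
  moreover have lev: "unit_level c = k" unfolding unit_level_def supp by simp
  have "(m, p) \<in> gaps c \<longleftrightarrow> (m, p) \<in> {(k, l) |l. i \<le> l \<and> l \<le> j}" for m p
  proof (cases "m = k")
    case True
    have span: "unit_span c k = {take (k - 1) b @ [i - 1], take (k - 1) b @ [j]}"
      unfolding unit_span_def lev by (simp add: c_def v)
    have "c k \<noteq> {}" by (simp add: c_def)
    then show ?thesis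
      unfolding True unit_gaps_iff span using ij k by (auto simp: coords_def)
  next
    case False
    then have "c m = {}" by (simp add: c_def)
    then show ?thesis using False by (simp add: unit_gaps_iff)
  qed
  then have "gaps c = {(k, l) |l. i \<le> l \<and> l \<le> j}" by auto
  ultimately show ?thesis by blast
qed

text \<open>
  Putting the branching vertex of the lower level at the right end of the lower gap keeps the
  lower part of the unit from spreading.
\<close>

lemma pair_is_unit_gaps:
  assumes ki: "(k, i) \<in> coords t" and kj: "(k', j) \<in> coords t" and less: "k < k'"
    and bk: "b ! (k - 1) = i"
  shows "\<exists>c\<in>collision_units T. gaps c = {(k, i), (k', j)}"
proof -
  define c where "c m = (if m = k then {vtx T k i, vtx T k (Suc i)}
    else if m = k' then {vtx T k' j, vtx T k' (Suc j)} else {})" for m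
  have k: "1 \<le> k" "k \<le> length t" "k - 1 < length t" "Suc (k - 1) = k" "1 \<le> i" "i \<le> t ! (k - 1)"
    using ki by (auto simp: coords_def)
  have k': "1 \<le> k'" "k' \<le> length t" "k' - 1 < length t" "Suc (k' - 1) = k'" "1 \<le> j" "j \<le> t ! (k' - 1)"
    using kj by (auto simp: coords_def)
  have v: "vtx T k i = take (k - 1) b @ [i - 1]" "vtx T k (Suc i) = take (k - 1) b @ [i]"
    using vtx[OF k(3), of i] vtx[OF k(3), of "Suc i"] k by simp_all
  have v': "vtx T k' j = take (k' - 1) b @ [j - 1]" "vtx T k' (Suc j) = take (k' - 1) b @ [j]"
    using vtx[OF k'(3), of j] vtx[OF k'(3), of "Suc j"] k' by simp_all
  have card: "card (level T k) = Suc (t ! (k - 1))" "card (level T k') = Suc (t ! (k' - 1))"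
    using card_level[OF k(3)] card_level[OF k'(3)] k(4) k'(4) by simp_all
  have supp: "{m. c m \<noteq> {}} = {k, k'}" by (auto simp: c_def)
  have adj: "\<exists>i. 1 \<le> i \<and> Suc i \<le> card (level T m) \<and> c m = {vtx T m i, vtx T m (Suc i)}"
    if "c m \<noteq> {}" for m
  proof -
    have "m = k \<or> m = k'" using that supp by blast
    then show ?thesis
    proof
      assume m: "m = k"
      show ?thesis using k card m by (intro exI[of _ i]) (simp add: c_def)
    next
      assume m: "m = k'"
      show ?thesis using k' card m less by (intro exI[of _ j]) (simp add: c_def)
    qed
  qed
  have "c \<in> collision_units T"
    unfolding collision_units_def depth mem_Collect_eq
  proof (intro conjI)
    show "\<forall>m\<in>{1..length t}. c m = {} \<or> (\<exists>i j. 1 \<le> i \<and> i < j \<and> j \<le> card (level T m) \<and>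
        c m = {vtx T m i, vtx T m j})"
      using adj by (metis lessI)
    show "\<exists>m. c m \<noteq> {}" using supp by blast
    show "\<forall>m. m \<notin> {1..length t} \<longrightarrow> c m = {}" using k k' by (auto simp: c_def)
    show "2 \<le> card {k. c k \<noteq> {}} \<longrightarrow> (\<forall>k. c k \<noteq> {} \<longrightarrow>
        (\<exists>i. 1 \<le> i \<and> Suc i \<le> card (level T k) \<and> c k = {vtx T k i, vtx T k (Suc i)}))"
      using adj by blast
  qed
  moreover have lev: "unit_level c = k'" unfolding unit_level_def supp using less by simp
  have "(m, p) \<in> gaps c \<longleftrightarrow> (m, p) \<in> {(k, i), (k', j)}" for m p
  proof -
    consider "m = k" | "m = k'" | "m \<noteq> k" "m \<noteq> k'" by blast
    then show ?thesis
    proof cases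
      case 1
      have "take k b = take (k - 1) b @ [i]"
        using take_Suc_conv_app_nth[of "k - 1" b] k bk length_b by simp
      then have span: "unit_span c k = {take (k - 1) b @ [i - 1], take (k - 1) b @ [i]}"
        unfolding unit_span_def lev using less by (auto simp: c_def v)
      have "c k \<noteq> {}" by (simp add: c_def)
      then show ?thesis
        unfolding 1 unit_gaps_iff span using k less by (auto simp: coords_def)
    next
      case 2
      have span: "unit_span c k' = {take (k' - 1) b @ [j - 1], take (k' - 1) b @ [j]}"
        unfolding unit_span_def lev using less by (simp add: c_def v')
      have "c k' \<noteq> {}" by (simp add: c_def)
      then show ?thesis
        unfolding 2 unit_gaps_iff span using k' less by (auto simp: coords_def)
    next
      case 3
      then have "c m = {}" by (simp add: c_def)
      then show ?thesis using 3 by (simp add: unit_gaps_iff)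
    qed
  qed
  then have "gaps c = {(k, i), (k', j)}" by auto
  ultimately show ?thesis by blast
qed

lemma unit_gaps_convex:
  assumes "(k, p) \<in> gaps c" "(k, q) \<in> gaps c" "p \<le> r" "r \<le> q"
  shows "(k, r) \<in> gaps c"
proof -
  have "(k, r) \<in> coords t" using assms by (auto simp: unit_gaps_iff coords_def)
  moreover have "\<exists>u\<in>unit_span c k. last u < r" "\<exists>u\<in>unit_span c k. r \<le> last u"
    using assms unfolding unit_gaps_iff by (meson less_le_trans le_trans)+
  ultimately show ?thesis using assms(1) by (simp add: unit_gaps_iff)
qed

end

text \<open>By \<open>max_face_simplex_subset_iff\<close>, the combinatorial form of face inclusion
  for the simplex on \<open>S\<close>.\<close>

definition argmax_refines :: "('c \<Rightarrow> real) \<Rightarrow> ('c \<Rightarrow> real) \<Rightarrow> 'c set \<Rightarrow> bool" where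
  "argmax_refines y y' S \<longleftrightarrow> (\<forall>p\<in>S. (\<forall>q\<in>S. y q \<le> y p) \<longrightarrow> (\<forall>q\<in>S. y' q \<le> y' p))"

text \<open>A maximizer \<open>p\<close> of \<open>y\<close> on \<open>G\<close> and any other
  \<open>q\<close> in \<open>G\<close> lie in a common summand inside \<open>G\<close>: the interval
  between them if they share a level, the pair otherwise. There \<open>p\<close> still maximizes
  \<open>y\<close>, so the summand compares the values of \<open>y'\<close> at \<open>p\<close> and
  \<open>q\<close>.\<close>

lemma argmax_refines_level_convex:
  assumes G: "G \<subseteq> coords t"
    and convex: "\<And>k p q r. (k, p) \<in> G \<Longrightarrow> (k, q) \<in> G \<Longrightarrow> p \<le> r \<Longrightarrow> r \<le> q \<Longrightarrow> (k, r) \<in> G"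
    and summands: "\<And>S. S \<in> constrainahedron_summands t \<Longrightarrow> argmax_refines y y' S"
  shows "argmax_refines y y' G"
  unfolding argmax_refines_def
proof (intro ballI impI)
  fix p q assume p: "p \<in> G" "\<forall>q\<in>G. y q \<le> y p" and q: "q \<in> G"
  obtain k i where ki: "p = (k, i)" by (cases p)
  obtain k' j where kj: "q = (k', j)" by (cases q)
  have use: "y' q \<le> y' p" if "S \<in> constrainahedron_summands t" "S \<subseteq> G" "p \<in> S" "q \<in> S" for S
    using summands[OF that(1)] that p(2) unfolding argmax_refines_def by blast
  show "y' q \<le> y' p"
  proof (cases "p = q")
    case False
    have cc: "(k, i) \<in> coords t" "(k', j) \<in> coords t" using G p(1) q ki kj by auto
    show ?thesis
    proof (cases "k = k'")
      case True
      let ?S = "{(k, l) |l. min i j \<le> l \<and> l \<le> max i j}"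
      have "?S \<in> constrainahedron_summands t"
        unfolding constrainahedron_summands_def
      proof (rule UnI1, intro CollectI exI conjI)
        show "1 \<le> k" "k \<le> length t" using cc by (auto simp: coords_def)
        show "1 \<le> min i j" "max i j \<le> t ! (k - 1)" using cc True by (auto simp: coords_def)
        show "min i j < max i j" using False True ki kj by auto
      qed simp
      moreover have "?S \<subseteq> G"
      proof clarify
        fix l assume "min i j \<le> l" "l \<le> max i j"
        then show "(k, l) \<in> G"
          using convex[of k i j l] convex[of k j i l] p(1) q ki kj True by (cases "i \<le> j") auto
      qed
      moreover have "p \<in> ?S" "q \<in> ?S" using ki kj True by auto
      ultimately show ?thesis by (rule use)
    next
      case ne: False
      have "{p, q} \<in> constrainahedron_summands t"
        unfolding constrainahedron_summands_def
      proof (rule UnI2, intro CollectI exI conjI)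
        show "{p, q} = {(k, i), (k', j)}" using ki kj by simp
      qed (use cc ne in auto)
      then show ?thesis using use[of "{p, q}"] p(1) q by simp
    qed
  qed simp
qed

lemma exists_stem:
  assumes "\<And>k. k < length t \<Longrightarrow> b ! k \<le> t ! k" "length b = length t"
  shows "stem t b (stem_tree t b)"
  using assms by unfold_locales auto

text \<open>Intervals already occur in the tree of the zero word. For a pair, the entry of
  \<open>b\<close> at the lower level is set to the index of the lower gap, which makes the
  branching vertex its right end.\<close>

lemma summand_is_unit_gaps:
  assumes "S \<in> constrainahedron_summands t"
  shows "\<exists>b T. stem t b T \<and> (\<exists>c\<in>collision_units T. unit_gaps t b c = S)"
proof -
  consider (interval) k i j where "1 \<le> k" "k \<le> length t" "1 \<le> i" "i < j" "j \<le> t ! (k - 1)"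
      "S = {(k, l) |l. i \<le> l \<and> l \<le> j}"
    | (pair) k k' i j where "k \<noteq> k'" "(k, i) \<in> coords t" "(k', j) \<in> coords t" "S = {(k, i), (k', j)}"
    using assms unfolding constrainahedron_summands_def by blast
  then show ?thesis
  proof cases
    case interval
    let ?b = "replicate (length t) 0"
    interpret stem t ?b "stem_tree t ?b" by (rule exists_stem) auto
    show ?thesis using interval_is_unit_gaps[OF interval(1-5)] interval(6) stem_axioms by blast
  next
    case pair
    have *: "\<exists>b T. stem t b T \<and> (\<exists>c\<in>collision_units T. unit_gaps t b c = {(k, i), (k', j)})"
      if "(k, i) \<in> coords t" "(k', j) \<in> coords t" "k < k'" for k i k' j
    proof -
      let ?b = "(replicate (length t) 0)[k - 1 := i]"
      have k: "k - 1 < length t" "i \<le> t ! (k - 1)" using that(1) by (auto simp: coords_def)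
      interpret stem t ?b "stem_tree t ?b"
        by (rule exists_stem) (use k in \<open>auto simp: nth_list_update\<close>)
      have "?b ! (k - 1) = i" using k by simp
      then show ?thesis using pair_is_unit_gaps[OF that] stem_axioms by blast
    qed
    show ?thesis
    proof (cases "k < k'")
      case True
      then show ?thesis using *[OF pair(2,3)] pair(4) by simp
    next
      case False
      then have "k' < k" using pair(1) by simp
      then show ?thesis using *[OF pair(3,2)] pair(4) by (simp add: insert_commute)
    qed
  qed
qed

context
  fixes t :: "nat list" and e :: "nat \<times> nat \<Rightarrow> 'a::euclidean_space"
  assumes e: "bij_betw e (coords t) Basis"
begin

lemma sum_simplices:
  fixes D :: "'i \<Rightarrow> (nat \<times> nat) set"
  assumes "finite I" "\<And>i. i \<in> I \<Longrightarrow> D i \<subseteq> coords t \<and> D i \<noteq> {}"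
  shows "polytope (\<Sum>i\<in>I. convex hull (e ` D i))" "(\<Sum>i\<in>I. convex hull (e ` D i)) \<noteq> {}"
    "max_face (\<Sum>i\<in>I. convex hull (e ` D i)) y \<subseteq> max_face (\<Sum>i\<in>I. convex hull (e ` D i)) y' \<longleftrightarrow>
      (\<forall>i\<in>I. argmax_refines (\<lambda>p. y \<bullet> e p) (\<lambda>p. y' \<bullet> e p) (D i))"
proof -
  have poly: "polytope (convex hull (e ` D i)) \<and> convex hull (e ` D i) \<noteq> {}" if "i \<in> I" for i
  proof -
    have "finite (D i)" using assms(2)[OF that] finite_coords finite_subset by blast
    then show ?thesis using assms(2)[OF that] by (simp add: polytope_convex_hull)
  qed
  show "polytope (\<Sum>i\<in>I. convex hull (e ` D i))" "(\<Sum>i\<in>I. convex hull (e ` D i)) \<noteq> {}"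
    using sum_polytopes(1,2)[of I "\<lambda>i. convex hull (e ` D i)", OF assms(1) poly] by blast+
  have "max_face (\<Sum>i\<in>I. convex hull (e ` D i)) y \<subseteq> max_face (\<Sum>i\<in>I. convex hull (e ` D i)) y' \<longleftrightarrow>
      (\<forall>i\<in>I. max_face (convex hull (e ` D i)) y \<subseteq> max_face (convex hull (e ` D i)) y')"
    by (rule sum_polytopes(3)[of I "\<lambda>i. convex hull (e ` D i)", OF assms(1) poly])
  also have "\<dots> \<longleftrightarrow> (\<forall>i\<in>I. argmax_refines (\<lambda>p. y \<bullet> e p) (\<lambda>p. y' \<bullet> e p) (D i))"
    unfolding argmax_refines_def
    by (intro ball_cong refl max_face_simplex_subset_iff[OF e]) (use assms(2) in blast)
  finally show "max_face (\<Sum>i\<in>I. convex hull (e ` D i)) y \<subseteq> max_face (\<Sum>i\<in>I. convex hull (e ` D i)) y' \<longleftrightarrow>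
      (\<forall>i\<in>I. argmax_refines (\<lambda>p. y \<bullet> e p) (\<lambda>p. y' \<bullet> e p) (D i))" .
qed

lemma tree_polytope_props:
  assumes "stem t b T"
  shows "polytope (tree_polytope e t T)" "tree_polytope e t T \<noteq> {}"
    "max_face (tree_polytope e t T) y \<subseteq> max_face (tree_polytope e t T) y' \<longleftrightarrow>
      (\<forall>c\<in>collision_units T. argmax_refines (\<lambda>p. y \<bullet> e p) (\<lambda>p. y' \<bullet> e p) (unit_gaps t b c))"
proof -
  interpret stem t b T by (rule assms)
  have D: "unit_gaps t b c \<subseteq> coords t \<and> unit_gaps t b c \<noteq> {}" if "c \<in> collision_units T" for c
    using that unit_gaps_subset_coords unit_gaps_nonempty by simp
  note facts = sum_simplices[OF finite_collision_units[OF finite_T], of "unit_gaps t b", OF D]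
  show "polytope (tree_polytope e t T)" "tree_polytope e t T \<noteq> {}"
    "max_face (tree_polytope e t T) y \<subseteq> max_face (tree_polytope e t T) y' \<longleftrightarrow>
      (\<forall>c\<in>collision_units T. argmax_refines (\<lambda>p. y \<bullet> e p) (\<lambda>p. y' \<bullet> e p) (unit_gaps t b c))"
    unfolding tree_polytope_eq[OF e] by (rule facts; assumption)+
qed

lemma summand_props:
  assumes "S \<in> constrainahedron_summands t"
  shows "S \<subseteq> coords t \<and> S \<noteq> {}"
proof -
  obtain b T c where "stem t b T" "c \<in> collision_units T" "unit_gaps t b c = S"
    using summand_is_unit_gaps[OF assms] by blast
  then show ?thesis
    using stem.unit_gaps_subset_coords[of t b T c] stem.unit_gaps_nonempty[of t b T c] by simp
qed

text \<open>Face inclusion is tested on the gap sets of all units of all trees for one polytope, and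
  on the standard summands for the other. Each summand is such a gap set, and each gap set is convex
  on every level, so the tests agree.\<close>

lemma constrainahedron_concentrated_sum: "constrainahedron e t (concentrated_sum e t)"
proof -
  let ?Q = "concentrated_sum e t" and ?C = "standard_constrainahedron e t"
  let ?ref = "\<lambda>y y'. argmax_refines (\<lambda>p. y \<bullet> e p) (\<lambda>p. y' \<bullet> e p)"
  have T: "polytope (tree_polytope e t T) \<and> tree_polytope e t T \<noteq> {}"
    if "T \<in> concentrated_trees t" for T
    using concentrated_tree_stem[OF that] tree_polytope_props(1,2) by blast
  have Q: "polytope ?Q" "?Q \<noteq> {}"
    unfolding concentrated_sum_def
    using sum_polytopes(1,2)[of "concentrated_trees t" "tree_polytope e t", OF finite_concentrated_trees T]
    by blast+
  have C: "polytope ?C" "?C \<noteq> {}"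
    unfolding standard_constrainahedron_def
    using sum_simplices(1,2)[of "constrainahedron_summands t" "\<lambda>S. S",
        OF finite_constrainahedron_summands summand_props] by blast+
  have "max_face ?Q y \<subseteq> max_face ?Q y' \<longleftrightarrow> max_face ?C y \<subseteq> max_face ?C y'" for y y'
  proof -
    have Q_iff: "max_face ?Q y \<subseteq> max_face ?Q y' \<longleftrightarrow> (\<forall>T\<in>concentrated_trees t.
        max_face (tree_polytope e t T) y \<subseteq> max_face (tree_polytope e t T) y')"
      unfolding concentrated_sum_def
      by (rule sum_polytopes(3)[of "concentrated_trees t" "tree_polytope e t",
            OF finite_concentrated_trees T])
    have C_iff: "max_face ?C y \<subseteq> max_face ?C y' \<longleftrightarrow> (\<forall>S\<in>constrainahedron_summands t. ?ref y y' S)"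
      unfolding standard_constrainahedron_def
      by (rule sum_simplices(3)[of "constrainahedron_summands t" "\<lambda>S. S",
            OF finite_constrainahedron_summands summand_props])
    show ?thesis
    proof
      assume L: "max_face ?Q y \<subseteq> max_face ?Q y'"
      have "?ref y y' S" if S: "S \<in> constrainahedron_summands t" for S
      proof -
        obtain b T c where st: "stem t b T" and c: "c \<in> collision_units T" "unit_gaps t b c = S"
          using summand_is_unit_gaps[OF S] by blast
        have "max_face (tree_polytope e t T) y \<subseteq> max_face (tree_polytope e t T) y'"
          using L stem.T_in_concentrated_trees[OF st] unfolding Q_iff by blast
        then show ?thesis using c unfolding tree_polytope_props(3)[OF st] by blast
      qed
      then show "max_face ?C y \<subseteq> max_face ?C y'" unfolding C_iff by blast
    next
      assume R: "max_face ?C y \<subseteq> max_face ?C y'"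
      have "max_face (tree_polytope e t T) y \<subseteq> max_face (tree_polytope e t T) y'"
        if T: "T \<in> concentrated_trees t" for T
      proof -
        obtain b where st: "stem t b T" using concentrated_tree_stem[OF T] by blast
        have "?ref y y' (unit_gaps t b c)" for c
        proof (rule argmax_refines_level_convex[OF stem.unit_gaps_subset_coords[OF st]])
          show "(k, r) \<in> unit_gaps t b c"
            if "(k, p) \<in> unit_gaps t b c" "(k, q) \<in> unit_gaps t b c" "p \<le> r" "r \<le> q" for k p q r
            using stem.unit_gaps_convex[OF st that] .
        qed (use R in \<open>unfold C_iff, blast\<close>)
        then show ?thesis unfolding tree_polytope_props(3)[OF st] by blast
      qed
      then show "max_face ?Q y \<subseteq> max_face ?Q y'" unfolding Q_iff by blast
    qed
  qed
  then have "normal_fan ?Q = normal_fan ?C"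
    unfolding normal_fan_polytope[OF Q] normal_fan_polytope[OF C] by simp
  then show ?thesis using Q(1) by (simp add: constrainahedron_def)
qed

end

theorem theorem8p40:
  fixes t :: "nat list" and e :: "nat \<times> nat \<Rightarrow> 'a::euclidean_space"
  assumes "t \<noteq> []" and "\<exists>s\<in>set t. s \<noteq> 0"
    and "bij_betw e (coords t) Basis"
  shows "constrainahedron e t (concentrated_sum e t)"
  by (rule constrainahedron_concentrated_sum[OF assms(3)])

end
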